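(* Let $d\geq 2$ be a fixed integer. The problem $d$-Cut is solvable in constant time on claw-free graphs with maximum degree $\Delta\leq 2d+1$, and $d$-Cut is NP-complete on claw-free graphs with maximum degree $\Delta = 2d+3$.
   Context: All graphs are finite, simple and undirected. A graph is claw-free if it contains no induced subgraph isomorphic to the claw $K_{1,3}$. For an integer $d\geq 1$ and a connected graph $G=(V,E)$, a set $M\subseteq E$ is a $d$-cut of $G$ if $V$ can be partitioned into two non-empty sets $B$ and $R$ such that $M$ is exactly the set of edges with one end in $B$ and the other in $R$, and every vertex of $B$ has at most $d$ neighbours in $R$ and every vertex of $R$ has at most $d$ neighbours in $B$. For fixed $d$, the decision problem $d$-Cut takes as input a connected graph $G$ and asks whether $G$ has a $d$-cut. *)

theory Defs
  imports "HOL-Computational_Algebra.Polynomial"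
begin

record 'a ugraph =
  verts :: "'a set"
  edges :: "'a set set"

definition simple_graph :: "'a ugraph \<Rightarrow> bool" where
  "simple_graph G \<longleftrightarrow> finite (verts G) \<and> (\<forall>e\<in>edges G. e \<subseteq> verts G \<and> card e = 2)"

definition neighbours :: "'a ugraph \<Rightarrow> 'a \<Rightarrow> 'a set" where
  "neighbours G v = {w. {v, w} \<in> edges G}"

definition max_degree :: "'a ugraph \<Rightarrow> nat" where
  "max_degree G = Max ((\<lambda>v. card (neighbours G v)) ` verts G)"

definition connected_graph :: "'a ugraph \<Rightarrow> bool" where
  "connected_graph G \<longleftrightarrow>
     verts G \<noteq> {} \<and> (\<forall>u\<in>verts G. \<forall>v\<in>verts G. (u, v) \<in> {(x, y). {x, y} \<in> edges G}\<^sup>*)"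

definition induced_subgraph :: "'a ugraph \<Rightarrow> 'a set \<Rightarrow> 'a ugraph" where
  "induced_subgraph G S = \<lparr>verts = S, edges = {e \<in> edges G. e \<subseteq> S}\<rparr>"

definition isomorphic :: "'a ugraph \<Rightarrow> 'b ugraph \<Rightarrow> bool" where
  "isomorphic G H \<longleftrightarrow>
     (\<exists>f. bij_betw f (verts G) (verts H) \<and>
          (\<forall>u\<in>verts G. \<forall>v\<in>verts G. {u, v} \<in> edges G \<longleftrightarrow> {f u, f v} \<in> edges H))"

definition claw :: "nat ugraph" where
  "claw = \<lparr>verts = {0, 1, 2, 3}, edges = {{0, 1}, {0, 2}, {0, 3}}\<rparr>"

definition claw_free :: "'a ugraph \<Rightarrow> bool" where
  "claw_free G \<longleftrightarrow> \<not> (\<exists>S\<subseteq>verts G. isomorphic (induced_subgraph G S) claw)"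

definition is_d_cut :: "nat \<Rightarrow> 'a ugraph \<Rightarrow> 'a set set \<Rightarrow> bool" where
  "is_d_cut d G M \<longleftrightarrow> M \<subseteq> edges G \<and>
     (\<exists>B R. B \<union> R = verts G \<and> B \<inter> R = {} \<and> B \<noteq> {} \<and> R \<noteq> {} \<and>
            M = {e \<in> edges G. \<exists>b\<in>B. \<exists>r\<in>R. e = {b, r}} \<and>
            (\<forall>v\<in>B. card (neighbours G v \<inter> R) \<le> d) \<and>
            (\<forall>v\<in>R. card (neighbours G v \<inter> B) \<le> d))"

text \<open>
  Deterministic machines with finitely many two-way infinite tapes, a finite set of working
  states and a finite tape alphabet.  Working states and symbols are initial segments of the
  natural numbers: the machine starts in \<open>Work 0\<close>, symbol 0 is the blank, and symbols 1 and 2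
  represent the bits \<open>False\<close> and \<open>True\<close>.  \<open>Accept\<close> and \<open>Reject\<close> are the halting states.
\<close>

datatype tm_state = Work nat | Accept | Reject

datatype move = MoveLeft | Stay | MoveRight

record tm =
  num_tapes :: nat
  num_states :: nat
  num_symbols :: nat
  delta :: "nat \<Rightarrow> nat list \<Rightarrow> tm_state \<times> (nat \<times> move) list"

definition wf_tm :: "tm \<Rightarrow> bool" where
  "wf_tm M \<longleftrightarrow> num_tapes M \<ge> 1 \<and> num_states M \<ge> 1 \<and> num_symbols M \<ge> 3 \<and>
     (\<forall>q < num_states M. \<forall>ss. length ss = num_tapes M \<and> (\<forall>s\<in>set ss. s < num_symbols M) \<longrightarrow>
        (case delta M q ss of (q', acts) \<Rightarrow>
           (\<forall>r. q' = Work r \<longrightarrow> r < num_states M) \<and>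
           length acts = num_tapes M \<and> (\<forall>(s, m)\<in>set acts. s < num_symbols M)))"

text \<open>A tape is given by its contents and the position of its head.\<close>

type_synonym tape = "(int \<Rightarrow> nat) \<times> int"

type_synonym config = "tm_state \<times> tape list"

definition word_contents :: "bool list \<Rightarrow> int \<Rightarrow> nat" where
  "word_contents x i =
     (if 0 \<le> i \<and> i < int (length x) then (if x ! nat i then 2 else 1) else 0)"

fun act :: "nat \<times> move \<Rightarrow> tape \<Rightarrow> tape" where
  "act (s, m) (c, h) =
     (c(h := s), case m of MoveLeft \<Rightarrow> h - 1 | Stay \<Rightarrow> h | MoveRight \<Rightarrow> h + 1)"

fun tm_step :: "tm \<Rightarrow> config \<Rightarrow> config" where
  "tm_step M (Work q, ts) =
     (case delta M q (map (\<lambda>(c, h). c h) ts) of (q', acts) \<Rightarrow> (q', map2 act acts ts))"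
| "tm_step M (Accept, ts) = (Accept, ts)"
| "tm_step M (Reject, ts) = (Reject, ts)"

definition tm_init :: "tm \<Rightarrow> bool list list \<Rightarrow> config" where
  "tm_init M xs =
     (Work 0, map (\<lambda>i. (word_contents (if i < length xs then xs ! i else []), 0)) [0..<num_tapes M])"

definition tm_run :: "tm \<Rightarrow> bool list list \<Rightarrow> nat \<Rightarrow> config" where
  "tm_run M xs t = (tm_step M ^^ t) (tm_init M xs)"

text \<open>Halting configurations do not change any more, so these mean ``within t steps''.\<close>

definition halts_within :: "tm \<Rightarrow> bool list list \<Rightarrow> nat \<Rightarrow> bool" where
  "halts_within M xs t \<longleftrightarrow> fst (tm_run M xs t) \<in> {Accept, Reject}"

definition accepts_within :: "tm \<Rightarrow> bool list list \<Rightarrow> nat \<Rightarrow> bool" where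
  "accepts_within M xs t \<longleftrightarrow> fst (tm_run M xs t) = Accept"

text \<open>The output of a halted machine is the word on its last tape.\<close>

definition outputs_within :: "tm \<Rightarrow> bool list list \<Rightarrow> nat \<Rightarrow> bool list \<Rightarrow> bool" where
  "outputs_within M xs t y \<longleftrightarrow>
     halts_within M xs t \<and> fst (last (snd (tm_run M xs t))) = word_contents y"

definition NP :: "bool list set set" where
  "NP = {L. \<exists>M (p :: nat poly) (q :: nat poly). wf_tm M \<and> num_tapes M \<ge> 2 \<and>
     (\<forall>x u. length u \<le> poly p (length x) \<longrightarrow> halts_within M [x, u] (poly q (length x))) \<and>
     (\<forall>x. x \<in> L \<longleftrightarrow>
        (\<exists>u. length u \<le> poly p (length x) \<and> accepts_within M [x, u] (poly q (length x))))}"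

definition polytime_computable :: "(bool list \<Rightarrow> bool list) \<Rightarrow> bool" where
  "polytime_computable f \<longleftrightarrow>
     (\<exists>M (p :: nat poly). wf_tm M \<and> (\<forall>x. outputs_within M [x] (poly p (length x)) (f x)))"

text \<open>
  A decision problem whose inputs are restricted to a class is a pair of the set of admissible
  inputs and the set of yes-inputs.  Algorithms may assume that their input is admissible;
  conversely, reductions to such a problem have to produce admissible inputs.  Membership in NP
  is required of the language of yes-inputs, so the certificate check may not assume
  admissibility.
\<close>

type_synonym decision_problem = "bool list set \<times> bool list set"

definition constant_time_solvable :: "decision_problem \<Rightarrow> bool" where
  "constant_time_solvable = (\<lambda>(Inst, Yes). \<exists>M t. wf_tm M \<and>
     (\<forall>x\<in>Inst. halts_within M [x] t \<and> (accepts_within M [x] t \<longleftrightarrow> x \<in> Yes)))"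

definition NP_complete :: "decision_problem \<Rightarrow> bool" where
  "NP_complete = (\<lambda>(Inst, Yes). Yes \<in> NP \<and>
     (\<forall>L\<in>NP. \<exists>f. polytime_computable f \<and> (\<forall>x. f x \<in> Inst \<and> (x \<in> L \<longleftrightarrow> f x \<in> Yes))))"

text \<open>
  Input graphs have vertex set \<open>{..<n}\<close>, which covers all finite graphs up to isomorphism.  They
  are encoded by n in unary, followed by the adjacency matrix row by row.
\<close>

definition encode_graph :: "nat ugraph \<Rightarrow> bool list" where
  "encode_graph G = (let n = card (verts G) in
     replicate n True @ [False] @
     concat (map (\<lambda>i. map (\<lambda>j. {i, j} \<in> edges G) [0..<n]) [0..<n]))"

definition d_Cut_inputs :: "(nat ugraph \<Rightarrow> bool) \<Rightarrow> nat ugraph set" where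
  "d_Cut_inputs C =
     {G. simple_graph G \<and> (\<exists>n. verts G = {..<n}) \<and> connected_graph G \<and> C G}"

definition d_Cut :: "nat \<Rightarrow> (nat ugraph \<Rightarrow> bool) \<Rightarrow> decision_problem" where
  "d_Cut d C =
     (encode_graph ` d_Cut_inputs C,
      encode_graph ` {G \<in> d_Cut_inputs C. \<exists>M. is_d_cut d G M})"

end

theory Submission
  imports Defs "HOL-Library.Countable"
begin

text \<open>
  Small degree: every vertex of \<open>N[v]\<close> has at most \<open>d\<close> neighbours outside \<open>N[v]\<close>, unless some \<open>u \<in> N(v)\<close> has
  more; since \<open>G\<close> is claw-free, \<open>u\<close> and its neighbours outside \<open>N[v]\<close> then form a clique on at least \<open>d+2\<close>
  vertices, each of which has at most \<open>d\<close> neighbours outside the clique.  Either set grows to one side of a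
  \<open>d\<close>-cut by absorbing vertices with more than \<open>d\<close> neighbours in it; each absorption removes edges from the
  boundary, so this stops after a bounded number of steps.  Hence only boundedly many inputs are no-instances.

  Hardness: a computation of an NP machine is described by rules \<open>a \<and> b \<longrightarrow> c\<close> and \<open>a \<longrightarrow> b \<or> c\<close>.  The rules that
  follow the tapes are Horn rules: they derive all facts that hold in the run, so they need not exclude
  spurious ones, and only the certificate is guessed.  Rules are broken into gates
  \<open>x \<noteq> y \<longrightarrow> p \<noteq> b\<close>, and a gate is a vertex in two cliques of sizes \<open>d+2\<close> and \<open>d+1\<close> whose other members are copies
  of \<open>x, y, b, \<dots>, b\<close> and of \<open>p, \<dots>, p\<close>: if exactly one of \<open>x, y\<close> differs from \<open>b\<close>, then its copy already has \<open>d\<close>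
  neighbours of the other colour, so the gate vertex has its colour; now the gate vertex has \<open>d\<close> neighbours
  of the other colour in the first clique, so \<open>p\<close> has the colour of the gate vertex.

  Machines are programmed with counters that are head positions; functions built from bounded sums are
  closed under everything needed to print the adjacency matrix of the gadget graph and to check certificates.
\<close>

section \<open>Structured tape programs\<close>

text \<open>Two features of the problem shape the hardness half. A \<open>d\<close>-cut only yields
  a non-constant colouring, so no single gate excludes that the variables for true and false share a
  colour; therefore every variable \<open>v\<close> also gets a gate saying that \<open>v\<close>
  may differ from true only if false does, which in that case makes the whole graph monochromatic.
  And colours can be exchanged, so constraints can only compare variables; choosing true or false as
  the base turns the same gate into a conjunction or a disjunction.

  The degree \<open>2 * d + 3\<close> comes from the copies of a variable: the core of a copy needs
  two halves of \<open>d + 1\<close> vertices, each large enough to outvote a vertex, and the lower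
  vertices have two neighbours outside the core, one passing the colour on to the next copy and one
  entering the gate.

  Membership in NP may not presuppose admissible inputs, so the certificate also has to witness
  connectivity. No running time is analysed for a concrete algorithm: each closure lemma on counter
  programs carries its own polynomial bound.\<close>

datatype com =
    Op nat "nat option" move
  | Seq com com
  | IfEq nat nat com com
  | UntilEq nat nat com

type_synonym tapes = "nat \<Rightarrow> tape"

definition scanned :: "tapes \<Rightarrow> nat \<Rightarrow> nat" where
  "scanned T i = fst (T i) (snd (T i))"

definition written :: "nat option \<Rightarrow> nat \<Rightarrow> nat" where
  "written w s = (case w of None \<Rightarrow> s | Some s' \<Rightarrow> s')"

text \<open>The step counts are those of the compiled code: a test costs one step, and leaving the
  else branch or returning to the head of a loop costs one more for the jump.\<close>

inductive exec :: "com \<Rightarrow> tapes \<Rightarrow> nat \<Rightarrow> tapes \<Rightarrow> bool" where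
  exec_Op: "exec (Op i w m) T 1 (T(i := act (written w (scanned T i), m) (T i)))"
| exec_Seq: "exec c1 T n1 T1 \<Longrightarrow> exec c2 T1 n2 T2 \<Longrightarrow> exec (Seq c1 c2) T (n1 + n2) T2"
| exec_IfT: "scanned T i = s \<Longrightarrow> exec c1 T n T1 \<Longrightarrow> exec (IfEq i s c1 c2) T (n + 1) T1"
| exec_IfF: "scanned T i \<noteq> s \<Longrightarrow> exec c2 T n T1 \<Longrightarrow> exec (IfEq i s c1 c2) T (n + 2) T1"
| exec_stop: "scanned T i = s \<Longrightarrow> exec (UntilEq i s c) T 1 T"
| exec_loop: "scanned T i \<noteq> s \<Longrightarrow> exec c T n1 T1 \<Longrightarrow> exec (UntilEq i s c) T1 n2 T2 \<Longrightarrow>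
    exec (UntilEq i s c) T (n1 + n2 + 2) T2"

fun wf_com :: "nat \<Rightarrow> com \<Rightarrow> bool" where
  "wf_com K (Op i w m) \<longleftrightarrow> i < K \<and> (\<forall>s. w = Some s \<longrightarrow> s < 3)"
| "wf_com K (Seq c1 c2) \<longleftrightarrow> wf_com K c1 \<and> wf_com K c2"
| "wf_com K (IfEq i s c1 c2) \<longleftrightarrow> i < K \<and> wf_com K c1 \<and> wf_com K c2"
| "wf_com K (UntilEq i s c) \<longleftrightarrow> i < K \<and> wf_com K c"

lemma wf_com_mono: "wf_com K c \<Longrightarrow> K \<le> K' \<Longrightarrow> wf_com K' c"
  by (induction c) auto

datatype instr = IOp nat "nat option" move | IBr nat nat nat | IJmp nat | IHalt bool

text \<open>Jump targets are absolute, hence the start address \<open>pc\<close>. The else branch is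
  placed first because a failed test falls through to the next instruction.\<close>

fun compile :: "nat \<Rightarrow> com \<Rightarrow> instr list" where
  "compile pc (Op i w m) = [IOp i w m]"
| "compile pc (Seq c1 c2) = (let p1 = compile pc c1 in p1 @ compile (pc + length p1) c2)"
| "compile pc (IfEq i s c1 c2) =
     (let p2 = compile (pc + 1) c2; p1 = compile (pc + length p2 + 2) c1 in
      IBr i s (pc + length p2 + 2) # p2 @ IJmp (pc + length p2 + length p1 + 2) # p1)"
| "compile pc (UntilEq i s c) =
     (let p = compile (pc + 1) c in IBr i s (pc + length p + 2) # p @ [IJmp pc])"

fun instr_delta :: "instr \<Rightarrow> nat \<Rightarrow> nat list \<Rightarrow> tm_state \<times> (nat \<times> move) list" where
  "instr_delta (IOp i w m) q ss =
     (Work (q + 1), (map (\<lambda>s. (s, Stay)) ss)[i := (written w (ss ! i), m)])"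
| "instr_delta (IBr i s t) q ss =
     (Work (if ss ! i = s then t else q + 1), map (\<lambda>s. (s, Stay)) ss)"
| "instr_delta (IJmp t) q ss = (Work t, map (\<lambda>s. (s, Stay)) ss)"
| "instr_delta (IHalt b) q ss = ((if b then Accept else Reject), map (\<lambda>s. (s, Stay)) ss)"

definition tm_of :: "nat \<Rightarrow> instr list \<Rightarrow> tm" where
  "tm_of K code = \<lparr>num_tapes = K, num_states = length code, num_symbols = 3,
     delta = (\<lambda>q. instr_delta (code ! q) q)\<rparr>"

fun wf_instr :: "nat \<Rightarrow> nat \<Rightarrow> instr \<Rightarrow> bool" where
  "wf_instr K n (IOp i w m) \<longleftrightarrow> i < K \<and> (\<forall>s. w = Some s \<longrightarrow> s < 3)"
| "wf_instr K n (IBr i s t) \<longleftrightarrow> i < K \<and> t < n"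
| "wf_instr K n (IJmp t) \<longleftrightarrow> t < n"
| "wf_instr K n (IHalt b) \<longleftrightarrow> True"

lemma wf_instr_compile:
  assumes "wf_com K c" "pc + length (compile pc c) < n" "I \<in> set (compile pc c)"
  shows "wf_instr K n I"
  using assms
proof (induction c arbitrary: pc)
  case (Seq c1 c2)
  then show ?case using Seq.IH(1)[of pc] Seq.IH(2)[of "pc + length (compile pc c1)"]
    by (auto simp: Let_def)
next
  case (IfEq i s c1 c2)
  then show ?case
    using IfEq.IH(2)[of "pc + 1"] IfEq.IH(1)[of "pc + length (compile (pc + 1) c2) + 2"]
    by (auto simp: Let_def)
next
  case (UntilEq i s c)
  then show ?case using UntilEq.IH[of "pc + 1"] by (auto simp: Let_def)
qed auto

text \<open>A closing halt instruction ensures that the successor state \<open>q + 1\<close> of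
  every other instruction still exists.\<close>

lemma wf_tm_of:
  assumes "K \<ge> 1" "\<forall>I \<in> set code. wf_instr K (length code) I" "code \<noteq> []" "last code = IHalt b"
  shows "wf_tm (tm_of K code)"
proof -
  have *: "case instr_delta (code ! q) q ss of (q', acts) \<Rightarrow>
           (\<forall>r. q' = Work r \<longrightarrow> r < length code) \<and>
           length acts = K \<and> (\<forall>(s, m)\<in>set acts. s < 3)"
    if q: "q < length code" and ss: "length ss = K" "\<forall>s\<in>set ss. s < 3" for q ss
  proof -
    have wf: "wf_instr K (length code) (code ! q)" using assms(2) q by simp
    have nxt: "q + 1 < length code" if "\<not> (\<exists>b. code ! q = IHalt b)"
    proof (rule ccontr)
      assume "\<not> q + 1 < length code"
      then have "q = length code - 1" using q by simp
      then show False using that assms(3,4) by (simp add: last_conv_nth)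
    qed
    show ?thesis
    proof (cases "code ! q")
      case (IOp i w m)
      have "s < 3" if "(s, m') \<in> set ((map (\<lambda>s. (s, Stay)) ss)[i := (written w (ss ! i), m)])" for s m'
        using that wf IOp ss set_update_subset_insert[of "map (\<lambda>s. (s, Stay)) ss" i "(written w (ss ! i), m)"]
        by (auto simp: written_def split: option.splits)
      then show ?thesis using IOp nxt ss by auto
    qed (use wf nxt ss in auto)
  qed
  show ?thesis
    using assms(1,3) * unfolding wf_tm_def tm_of_def by (cases code) auto
qed

declare tm_step.simps [simp del]

lemma act_Stay: "act (fst t (snd t), Stay) t = t"
  by (cases t) auto

lemma map2_act_Stay: "map2 act (map (\<lambda>s. (s, Stay)) (map (\<lambda>(c, h). c h) ts)) ts = ts"
  by (induction ts) (auto simp: case_prod_unfold act_Stay)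

lemma map2_act_update:
  assumes "i < length ts"
  shows "map2 act ((map (\<lambda>s. (s, Stay)) (map (\<lambda>(c, h). c h) ts))[i := a]) ts = ts[i := act a (ts ! i)]"
  using assms
  by (intro nth_equalityI) (auto simp: nth_list_update case_prod_unfold act_Stay)

lemma map_sym: "map (scanned T) [0..<K] = map (\<lambda>(c, h). c h) (map T [0..<K])"
  by (simp add: scanned_def case_prod_unfold)

lemma tm_step_tm_of:
  assumes "q < length code"
  shows "tm_step (tm_of K code) (Work q, map T [0..<K]) =
    (case instr_delta (code ! q) q (map (scanned T) [0..<K]) of (q', acts) \<Rightarrow>
      (q', map2 act acts (map T [0..<K])))"
  unfolding map_sym by (simp add: tm_of_def tm_step.simps)

lemma tm_step_IOp:
  assumes "q < length code" "code ! q = IOp i w m" "i < K"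
  shows "tm_step (tm_of K code) (Work q, map T [0..<K]) =
    (Work (q + 1), map (T(i := act (written w (scanned T i), m) (T i))) [0..<K])"
proof -
  have "map2 act ((map (\<lambda>s. (s, Stay)) (map (scanned T) [0..<K]))[i := a]) (map T [0..<K]) =
      map (T(i := act a (T i))) [0..<K]" for a
    unfolding map_sym using assms(3)
    by (subst map2_act_update) (auto intro!: nth_equalityI simp: nth_list_update)
  then show ?thesis using assms by (simp add: tm_step_tm_of)
qed

lemma tm_step_IBr:
  assumes "q < length code" "code ! q = IBr i s t" "i < K"
  shows "tm_step (tm_of K code) (Work q, map T [0..<K]) =
    (Work (if scanned T i = s then t else q + 1), map T [0..<K])"
  using assms map2_act_Stay[of "map T [0..<K]"] unfolding map_sym[symmetric]
  by (simp add: tm_step_tm_of)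

lemma tm_step_IJmp:
  assumes "q < length code" "code ! q = IJmp t"
  shows "tm_step (tm_of K code) (Work q, map T [0..<K]) = (Work t, map T [0..<K])"
  using assms map2_act_Stay[of "map T [0..<K]"] unfolding map_sym[symmetric]
  by (simp add: tm_step_tm_of)

lemma tm_step_IHalt:
  assumes "q < length code" "code ! q = IHalt b"
  shows "tm_step (tm_of K code) (Work q, map T [0..<K]) =
    ((if b then Accept else Reject), map T [0..<K])"
  using assms map2_act_Stay[of "map T [0..<K]"] unfolding map_sym[symmetric]
  by (simp add: tm_step_tm_of)

text \<open>The code is split around the compiled program so that the induction hypotheses apply to
  a subprogram in its place, with the surrounding code absorbed into \<open>xs\<close> and
  \<open>ys\<close>.\<close>

lemma exec_tm_of:
  assumes "exec c T n T'" "wf_com K c" "code = xs @ compile (length xs) c @ ys"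
  shows "(tm_step (tm_of K code) ^^ n) (Work (length xs), map T [0..<K]) =
    (Work (length xs + length (compile (length xs) c)), map T' [0..<K])"
  using assms
proof (induction arbitrary: xs ys)
  case (exec_Op i w m T)
  then show ?case using tm_step_IOp[of "length xs" code i w m K T] by (simp)
next
  case (exec_Seq c1 T n1 T1 c2 n2 T2)
  let ?p1 = "compile (length xs) c1"
  note IH1 = exec_Seq.IH(1)[of xs "compile (length (xs @ ?p1)) c2 @ ys"]
  note IH2 = exec_Seq.IH(2)[of "xs @ ?p1" ys]
  show ?case
    using IH1 IH2 exec_Seq.prems
    by (simp add: Let_def funpow_add[of n2 n1, unfolded add.commute[of n2]] add.assoc)
next
  case (exec_IfT T i s c1 n T1 c2)
  let ?p2 = "compile (length xs + 1) c2"
  let ?l1 = "length xs + length ?p2 + 2"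
  let ?xs = "xs @ IBr i s ?l1 # ?p2 @ [IJmp (length xs + length ?p2 + length (compile ?l1 c1) + 2)]"
  have step: "tm_step (tm_of K code) (Work (length xs), map T [0..<K]) = (Work ?l1, map T [0..<K])"
    using exec_IfT by (subst tm_step_IBr[of _ _ i s]) (auto simp: Let_def)
  have "length ?xs = ?l1" by simp
  then show ?case
    using exec_IfT.IH[of ?xs ys] exec_IfT.prems step
    by (simp add: Let_def funpow_swap1 numeral_2_eq_2)
next
  case (exec_IfF T i s c2 n T1 c1)
  let ?p2 = "compile (length xs + 1) c2"
  let ?l1 = "length xs + length ?p2 + 2"
  let ?p1 = "compile ?l1 c1"
  let ?end = "length xs + length ?p2 + length ?p1 + 2"
  let ?ys = "IJmp ?end # ?p1 @ ys"
  have code: "code = (xs @ [IBr i s ?l1]) @ compile (length (xs @ [IBr i s ?l1])) c2 @ ?ys"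
    using exec_IfF.prems by (simp add: Let_def)
  have step: "tm_step (tm_of K code) (Work (length xs), map T [0..<K]) = (Work (length xs + 1), map T [0..<K])"
    using exec_IfF by (subst tm_step_IBr[of _ _ i s]) (auto simp: Let_def)
  have run: "(tm_step (tm_of K code) ^^ n) (Work (length xs + 1), map T [0..<K]) =
      (Work (length xs + 1 + length ?p2), map T1 [0..<K])"
    using exec_IfF.IH[OF _ code] exec_IfF.prems by simp
  have jmp: "tm_step (tm_of K code) (Work (length xs + 1 + length ?p2), map T1 [0..<K]) =
      (Work ?end, map T1 [0..<K])"
    by (rule tm_step_IJmp) (simp_all add: code nth_append)
  show ?case
    using step run jmp by (simp add: Let_def funpow_swap1)
next
  case (exec_stop T i s c)
  then show ?case by (simp add: Let_def) (subst tm_step_IBr[of _ _ i s], auto)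
next
  case (exec_loop T i s c n1 T1 n2 T2)
  let ?p = "compile (length xs + 1) c"
  let ?end = "length xs + length ?p + 2"
  have code: "code = (xs @ [IBr i s ?end]) @ compile (length (xs @ [IBr i s ?end])) c @ (IJmp (length xs) # ys)"
    using exec_loop.prems by (simp add: Let_def)
  have step: "tm_step (tm_of K code) (Work (length xs), map T [0..<K]) = (Work (length xs + 1), map T [0..<K])"
    using exec_loop by (subst tm_step_IBr[of _ _ i s]) (auto simp: Let_def)
  have run: "(tm_step (tm_of K code) ^^ n1) (Work (length xs + 1), map T [0..<K]) =
      (Work (length xs + 1 + length ?p), map T1 [0..<K])"
    using exec_loop.IH(1)[OF _ code] exec_loop.prems by simp
  have jmp: "tm_step (tm_of K code) (Work (length xs + 1 + length ?p), map T1 [0..<K]) =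
      (Work (length xs), map T1 [0..<K])"
    by (rule tm_step_IJmp) (simp_all add: code nth_append)
  \<comment> \<open>\<open>funpow_add\<close> runs the right summand first: test, body, jump back,
    remaining loop.\<close>
  have "n1 + n2 + 2 = n2 + (1 + (n1 + 1))" by simp
  then have "(tm_step (tm_of K code) ^^ (n1 + n2 + 2)) (Work (length xs), map T [0..<K]) =
      (tm_step (tm_of K code) ^^ n2) (Work (length xs), map T1 [0..<K])"
    using step run jmp by (simp only: funpow_add o_def) simp
  then show ?case using exec_loop.IH(2)[OF exec_loop.prems] by simp
qed

section \<open>Polynomial-time arithmetic on counters\<close>

definition runs :: "com \<Rightarrow> tapes \<Rightarrow> nat \<Rightarrow> tapes \<Rightarrow> bool" where
  "runs c T B T' \<longleftrightarrow> (\<exists>n\<le>B. exec c T n T')"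

lemma runs_mono: "runs c T B T' \<Longrightarrow> B \<le> B' \<Longrightarrow> runs c T B' T'"
  unfolding runs_def by (meson le_trans)

lemma runs_Op: "runs (Op i w m) T 1 (T(i := act (written w (scanned T i), m) (T i)))"
  unfolding runs_def using exec_Op by blast

lemma runs_Seq: "runs c1 T B1 T1 \<Longrightarrow> runs c2 T1 B2 T2 \<Longrightarrow> runs (Seq c1 c2) T (B1 + B2) T2"
  unfolding runs_def by (meson add_mono exec_Seq)

lemma runs_IfT: "scanned T i = s \<Longrightarrow> runs c1 T B T1 \<Longrightarrow> runs (IfEq i s c1 c2) T (B + 2) T1"
  unfolding runs_def by (metis add_le_mono exec_IfT one_le_numeral)

lemma runs_IfF: "scanned T i \<noteq> s \<Longrightarrow> runs c2 T B T1 \<Longrightarrow> runs (IfEq i s c1 c2) T (B + 2) T1"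
  unfolding runs_def by (metis add_le_mono1 exec_IfF)

text \<open>The explicit sequence of states \<open>T 0\<close>, ..., \<open>T m\<close> takes the
  place of an invariant and a termination measure.\<close>

lemma runs_UntilEq:
  assumes "\<And>i. i < m \<Longrightarrow> scanned (T i) r \<noteq> s" "scanned (T m) r = s"
    and "\<And>i. i < m \<Longrightarrow> runs c (T i) (B i) (T (Suc i))"
  shows "runs (UntilEq r s c) (T 0) ((\<Sum>i<m. B i + 2) + 1) (T m)"
  using assms
proof (induction m arbitrary: T B)
  case 0
  then show ?case unfolding runs_def using exec_stop by fastforce
next
  case (Suc m)
  obtain n1 where n1: "n1 \<le> B 0" "exec c (T 0) n1 (T (Suc 0))"
    using Suc.prems(3)[of 0] unfolding runs_def by auto
  have "runs (UntilEq r s c) (T (Suc 0)) ((\<Sum>i<m. B (Suc i) + 2) + 1) (T (Suc m))"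
    using Suc.IH[of "\<lambda>i. T (Suc i)" "\<lambda>i. B (Suc i)"] Suc.prems by simp
  then obtain n2 where n2: "n2 \<le> (\<Sum>i<m. B (Suc i) + 2) + 1"
      "exec (UntilEq r s c) (T (Suc 0)) n2 (T (Suc m))"
    unfolding runs_def by auto
  have "exec (UntilEq r s c) (T 0) (n1 + n2 + 2) (T (Suc m))"
    using exec_loop n1(2) n2(2) Suc.prems(1)[of 0] by blast
  moreover have "n1 + n2 + 2 \<le> (\<Sum>i<Suc m. B i + 2) + 1"
    using n1(1) n2(1) unfolding sum.lessThan_Suc_shift by simp
  ultimately show ?case unfolding runs_def by blast
qed

text \<open>Contents and head positions are kept apart because arithmetic only moves heads:
  \<open>W\<close> stays fixed while \<open>p\<close> holds all the data.\<close>

definition cfg :: "(nat \<Rightarrow> int \<Rightarrow> nat) \<Rightarrow> (nat \<Rightarrow> nat) \<Rightarrow> tapes" where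
  "cfg W p = (\<lambda>i. (W i, int (p i)))"

text \<open>A counter is a tape whose only mark is at cell 0; its value is the position of the head.\<close>

definition counter :: "int \<Rightarrow> nat" where
  "counter = (\<lambda>j. if j = 0 then 1 else 0)"

definition "inc r = Op r None MoveRight"
definition "dec r = Op r None MoveLeft"
definition "skip = Op 0 None Stay"

lemma sym_cfg: "scanned (cfg W p) i = W i (int (p i))"
  by (simp add: scanned_def cfg_def)

lemma sym_counter: "W i = counter \<Longrightarrow> scanned (cfg W p) i = 1 \<longleftrightarrow> p i = 0"
  by (simp add: sym_cfg counter_def)

lemma runs_inc: "runs (inc r) (cfg W p) 1 (cfg W (p(r := p r + 1)))"
proof -
  have "(cfg W p)(r := act (written None (scanned (cfg W p) r), MoveRight) (cfg W p r)) =
      cfg W (p(r := p r + 1))"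
    by (auto simp: cfg_def written_def scanned_def)
  then show ?thesis using runs_Op[of r None MoveRight "cfg W p"] by (simp add: inc_def)
qed

lemma runs_dec: "p r > 0 \<Longrightarrow> runs (dec r) (cfg W p) 1 (cfg W (p(r := p r - 1)))"
proof -
  assume "p r > 0"
  then have "(cfg W p)(r := act (written None (scanned (cfg W p) r), MoveLeft) (cfg W p r)) =
      cfg W (p(r := p r - 1))"
    by (auto simp: cfg_def written_def scanned_def)
  then show ?thesis using runs_Op[of r None MoveLeft "cfg W p"] by (simp add: dec_def)
qed

lemma runs_skip: "runs skip (cfg W p) 1 (cfg W p)"
proof -
  have "(cfg W p)(0 := act (written None (scanned (cfg W p) 0), Stay) (cfg W p 0)) = cfg W p"
    by (auto simp: cfg_def written_def scanned_def)
  then show ?thesis using runs_Op[of 0 None Stay "cfg W p"] by (simp add: skip_def)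
qed

lemma runs_cong: "runs c T B T1 \<Longrightarrow> T1 = T2 \<Longrightarrow> runs c T B T2"
  by simp

lemma runs_for:
  assumes "W r = counter" "\<And>i. i \<le> m \<Longrightarrow> P i r = m - i"
    and "\<And>i. i < m \<Longrightarrow> runs c (cfg W (P i)) (B i) (cfg W (P (Suc i)))"
    and "p = P 0" "p' = P m"
  shows "runs (UntilEq r 1 c) (cfg W p) ((\<Sum>i<m. B i + 2) + 1) (cfg W p')"
  unfolding assms(4,5)
  by (rule runs_UntilEq) (use assms(1-3) in \<open>auto simp: sym_counter simp del: One_nat_def\<close>)

definition "clear r = UntilEq r 1 (dec r)"

lemma runs_clear:
  assumes "W r = counter"
  shows "runs (clear r) (cfg W p) (3 * p r + 1) (cfg W (p(r := 0)))"
proof -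
  have "runs (UntilEq r 1 (dec r)) (cfg W p) ((\<Sum>i<p r. 1 + 2) + 1) (cfg W (p(r := 0)))"
  proof (rule runs_for[where P = "\<lambda>i. p(r := p r - i)" and m = "p r"])
    fix i assume "i < p r"
    then show "runs (dec r) (cfg W (p(r := p r - i))) 1 (cfg W (p(r := p r - Suc i)))"
      using runs_dec[of "p(r := p r - i)" r W] by simp
  qed (use assms in auto)
  then show ?thesis unfolding clear_def by (rule runs_mono) simp
qed

definition "move_to r s = UntilEq r 1 (Seq (dec r) (inc s))"

lemma runs_move_to:
  assumes "W r = counter" "r \<noteq> s"
  shows "runs (move_to r s) (cfg W p) (4 * p r + 1) (cfg W (p(r := 0, s := p s + p r)))"
proof -
  let ?P = "\<lambda>i. p(r := p r - i, s := p s + i)"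
  have "runs (UntilEq r 1 (Seq (dec r) (inc s))) (cfg W p) ((\<Sum>i<p r. (1 + 1) + 2) + 1)
     (cfg W (p(r := 0, s := p s + p r)))"
  proof (rule runs_for[where P = ?P and m = "p r"])
    fix i assume i: "i < p r"
    show "runs (Seq (dec r) (inc s)) (cfg W (?P i)) (1 + 1) (cfg W (?P (Suc i)))"
      by (rule runs_cong[OF runs_Seq[OF runs_dec runs_inc]])
        (use i assms in \<open>auto intro!: arg_cong[where f = "cfg W"]\<close>)
  qed (use assms in auto)
  then show ?thesis unfolding move_to_def by (rule runs_mono) simp
qed

definition "copy_to r s t = UntilEq r 1 (Seq (dec r) (Seq (inc s) (inc t)))"

lemma runs_copy_to:
  assumes "W r = counter" "r \<noteq> s" "r \<noteq> t" "s \<noteq> t"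
  shows "runs (copy_to r s t) (cfg W p) (5 * p r + 1) (cfg W (p(r := 0, s := p s + p r, t := p t + p r)))"
proof -
  let ?P = "\<lambda>i. p(r := p r - i, s := p s + i, t := p t + i)"
  have "runs (UntilEq r 1 (Seq (dec r) (Seq (inc s) (inc t)))) (cfg W p)
     ((\<Sum>i<p r. (1 + (1 + 1)) + 2) + 1)
     (cfg W (p(r := 0, s := p s + p r, t := p t + p r)))"
  proof (rule runs_for[where P = ?P and m = "p r"])
    fix i assume i: "i < p r"
    show "runs (Seq (dec r) (Seq (inc s) (inc t))) (cfg W (?P i)) (1 + (1 + 1)) (cfg W (?P (Suc i)))"
      by (rule runs_cong[OF runs_Seq[OF runs_dec runs_Seq[OF runs_inc runs_inc]]])
        (use i assms in \<open>auto intro!: arg_cong[where f = "cfg W"]\<close>)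
  qed (use assms in auto)
  then show ?thesis unfolding copy_to_def by (rule runs_mono) simp
qed

lemma wf_com_simps [simp]:
  "wf_com K (inc r) \<longleftrightarrow> r < K" "wf_com K (dec r) \<longleftrightarrow> r < K" "wf_com K skip \<longleftrightarrow> 0 < K"
  "wf_com K (clear r) \<longleftrightarrow> r < K" "wf_com K (move_to r s) \<longleftrightarrow> r < K \<and> s < K"
  "wf_com K (copy_to r s t) \<longleftrightarrow> r < K \<and> s < K \<and> t < K"
  by (auto simp: inc_def dec_def skip_def clear_def move_to_def copy_to_def)

lemma poly_nat_mono: "x \<le> y \<Longrightarrow> poly (p :: nat poly) x \<le> poly p y"
  by (induction p) (auto intro!: add_mono mult_mono)

type_synonym st = "bool list \<times> bool list \<times> (nat \<Rightarrow> nat)"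

text \<open>Counters are unary, so time is measured in the values of the variables and not in their
  binary length.\<close>

definition st_size :: "nat \<Rightarrow> st \<Rightarrow> nat" where
  "st_size N = (\<lambda>(x, u, e). length x + length u + (\<Sum>i<N. e i))"

text \<open>A program only sees the counters of the first \<open>N\<close> variables; this lets the
  other counters change without affecting the value of \<open>f\<close>.\<close>

definition depends :: "nat \<Rightarrow> (st \<Rightarrow> nat) \<Rightarrow> bool" where
  "depends N f \<longleftrightarrow> (\<forall>x u e e'. (\<forall>i<N. e i = e' i) \<longrightarrow> f (x, u, e) = f (x, u, e'))"

text \<open>Since the final configuration differs only in \<open>r\<close>, the heads on both words
  are back at cell 0 and all scratch counters are zero again, so programs can be chained and share
  scratch space. The value is added to \<open>r\<close> rather than stored, which turns sums into
  plain sequencing.\<close>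

definition realizes :: "nat \<Rightarrow> nat poly \<Rightarrow> nat \<Rightarrow> (st \<Rightarrow> nat) \<Rightarrow> (nat \<Rightarrow> nat) \<Rightarrow> nat \<Rightarrow> nat \<Rightarrow> com \<Rightarrow> bool" where
  "realizes K B N f \<rho> r b c \<longleftrightarrow> wf_com (b + K) c \<and>
     (\<forall>x u W p. W 0 = word_contents x \<longrightarrow> W 1 = word_contents u \<longrightarrow>
        (\<forall>i. 2 \<le> i \<and> i < b + K \<longrightarrow> W i = counter) \<longrightarrow>
        p 0 = 0 \<longrightarrow> p 1 = 0 \<longrightarrow> (\<forall>i\<in>{b..<b + K}. p i = 0) \<longrightarrow>
        runs c (cfg W p) (poly B (st_size N (x, u, \<lambda>i. p (\<rho> i))))
          (cfg W (p(r := p r + f (x, u, \<lambda>i. p (\<rho> i))))))"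

text \<open>\<open>PF N f\<close>: for every allocation \<open>\<rho>\<close> of variables \<open>0..<N\<close> to counters there is a program that adds
  \<open>f\<close> to the counter \<open>r\<close>, using scratch counters from \<open>b\<close> on.\<close>

definition PF :: "nat \<Rightarrow> (st \<Rightarrow> nat) \<Rightarrow> bool" where
  "PF N f \<longleftrightarrow> depends N f \<and> (\<exists>K B. (\<forall>s. f s \<le> poly B (st_size N s)) \<and>
     (\<forall>\<rho> r b. (\<forall>i<N. 2 \<le> \<rho> i \<and> \<rho> i < b \<and> \<rho> i \<noteq> r) \<longrightarrow> 2 \<le> r \<longrightarrow> r < b \<longrightarrow>
        (\<exists>c. realizes K B N f \<rho> r b c)))"

lemma PFI:
  assumes "depends N f" "\<And>s. f s \<le> poly B (st_size N s)"
    and "\<And>\<rho> r b. (\<And>i. i < N \<Longrightarrow> 2 \<le> \<rho> i \<and> \<rho> i < b \<and> \<rho> i \<noteq> r) \<Longrightarrow> 2 \<le> r \<Longrightarrow> r < b \<Longrightarrow>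
        \<exists>c. realizes K B N f \<rho> r b c"
  shows "PF N f"
  using assms unfolding PF_def by blast

lemma PFE:
  assumes "PF N f"
  obtains K B where "depends N f" "\<And>s. f s \<le> poly B (st_size N s)"
    "\<And>\<rho> r b. (\<And>i. i < N \<Longrightarrow> 2 \<le> \<rho> i \<and> \<rho> i < b \<and> \<rho> i \<noteq> r) \<Longrightarrow> 2 \<le> r \<Longrightarrow> r < b \<Longrightarrow>
        \<exists>c. realizes K B N f \<rho> r b c"
  using assms unfolding PF_def by blast

lemma realizesI:
  assumes "wf_com (b + K) c"
    and "\<And>x u W p. W 0 = word_contents x \<Longrightarrow> W 1 = word_contents u \<Longrightarrow>
        (\<And>i. 2 \<le> i \<Longrightarrow> i < b + K \<Longrightarrow> W i = counter) \<Longrightarrow>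
        p 0 = 0 \<Longrightarrow> p 1 = 0 \<Longrightarrow> (\<And>i. b \<le> i \<Longrightarrow> i < b + K \<Longrightarrow> p i = 0) \<Longrightarrow>
        runs c (cfg W p) (poly B (st_size N (x, u, \<lambda>i. p (\<rho> i))))
          (cfg W (p(r := p r + f (x, u, \<lambda>i. p (\<rho> i)))))"
  shows "realizes K B N f \<rho> r b c"
  using assms unfolding realizes_def by simp

lemma realizesD:
  assumes "realizes K B N f \<rho> r b c" "W 0 = word_contents x" "W 1 = word_contents u"
    "\<And>i. 2 \<le> i \<Longrightarrow> i < b + K \<Longrightarrow> W i = counter" "p 0 = 0" "p 1 = 0"
    "\<And>i. b \<le> i \<Longrightarrow> i < b + K \<Longrightarrow> p i = 0"
  shows "runs c (cfg W p) (poly B (st_size N (x, u, \<lambda>i. p (\<rho> i))))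
          (cfg W (p(r := p r + f (x, u, \<lambda>i. p (\<rho> i)))))"
  using assms unfolding realizes_def by simp

lemma realizes_wf: "realizes K B N f \<rho> r b c \<Longrightarrow> wf_com (b + K) c"
  unfolding realizes_def by simp

lemma dependsD: "depends N f \<Longrightarrow> (\<And>i. i < N \<Longrightarrow> e i = e' i) \<Longrightarrow> f (x, u, e) = f (x, u, e')"
  unfolding depends_def by blast

lemma depends_binop:
  assumes f: "depends N f" and g: "depends N g"
  shows "depends N (\<lambda>s. h (f s) (g s))"
  unfolding depends_def
proof (intro allI impI)
  fix x u and e e' :: "nat \<Rightarrow> nat"
  assume e: "\<forall>i<N. e i = e' i"
  have "f (x, u, e) = f (x, u, e')" using dependsD[OF f] e by blast
  moreover have "g (x, u, e) = g (x, u, e')" using dependsD[OF g] e by blast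
  ultimately show "h (f (x, u, e)) (g (x, u, e)) = h (f (x, u, e')) (g (x, u, e'))" by simp
qed

lemma st_size_cong: "(\<And>i. i < N \<Longrightarrow> e i = e' i) \<Longrightarrow> st_size N (x, u, e) = st_size N (x, u, e')"
  unfolding st_size_def by simp

lemma st_size_mono: "N \<le> M \<Longrightarrow> st_size N s \<le> st_size M s"
  by (cases s) (auto simp: st_size_def intro!: sum_mono2)

text \<open>Bodies of bounded sums live in larger contexts; the time bound survives because the size
  of a state only grows with the context.\<close>

lemma PF_weaken: "PF N f \<Longrightarrow> N \<le> M \<Longrightarrow> PF M f"
proof -
  assume f: "PF N f" and NM: "N \<le> M"
  obtain K B where *: "depends N f" "\<And>s. f s \<le> poly B (st_size N s)"
    "\<And>\<rho> r b. (\<And>i. i < N \<Longrightarrow> 2 \<le> \<rho> i \<and> \<rho> i < b \<and> \<rho> i \<noteq> r) \<Longrightarrow> 2 \<le> r \<Longrightarrow> r < b \<Longrightarrow>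
        \<exists>c. realizes K B N f \<rho> r b c"
    using f by (rule PFE) blast
  show "PF M f"
  proof (rule PFI)
    show "depends M f" using *(1) NM unfolding depends_def by auto
    show "f s \<le> poly B (st_size M s)" for s
      using *(2)[of s] poly_nat_mono[OF st_size_mono[OF NM], of B s] by linarith
    fix \<rho> :: "nat \<Rightarrow> nat" and r b :: nat
    assume "\<And>i. i < M \<Longrightarrow> 2 \<le> \<rho> i \<and> \<rho> i < b \<and> \<rho> i \<noteq> r" "2 \<le> r" "r < b"
    then obtain c where c: "realizes K B N f \<rho> r b c" using *(3)[of \<rho> b r] NM by auto
    have "realizes K B M f \<rho> r b c"
      by (rule realizesI[OF realizes_wf[OF c]], rule runs_mono[OF realizesD[OF c]])
        (auto intro!: poly_nat_mono st_size_mono NM)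
    then show "\<exists>c. realizes K B M f \<rho> r b c" by blast
  qed
qed

text \<open>Reading a counter empties it, so its value \<open>v\<close> is moved to \<open>r\<close>
  and to a scratch counter and then moved back. The costs \<open>5 * v + 1\<close> and
  \<open>4 * v + 1\<close> give the bound \<open>[:2, 9:]\<close>.\<close>

lemma PF_var: "i < N \<Longrightarrow> PF N (\<lambda>(x, u, e). e i)"
proof (rule PFI[where K = 1 and B = "[:2, 9:]"])
  assume i: "i < N"
  show "depends N (\<lambda>(x, u, e). e i)" using i by (auto simp: depends_def)
  have le: "e i \<le> st_size N (x, u, e)" for x u and e :: "nat \<Rightarrow> nat"
    using i member_le_sum[of i "{..<N}" e] by (auto simp: st_size_def)
  then show "(case s of (x, u, e) \<Rightarrow> e i) \<le> poly [:2, 9:] (st_size N s)" for s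
  proof (cases s)
    case (fields x u e)
    then show ?thesis using le[of e x u] by simp
  qed
  fix \<rho> :: "nat \<Rightarrow> nat" and r b :: nat
  assume \<rho>: "\<And>i. i < N \<Longrightarrow> 2 \<le> \<rho> i \<and> \<rho> i < b \<and> \<rho> i \<noteq> r" and r: "2 \<le> r" "r < b"
  have "realizes 1 [:2, 9:] N (\<lambda>(x, u, e). e i) \<rho> r b (Seq (copy_to (\<rho> i) r b) (move_to b (\<rho> i)))"
  proof (rule realizesI)
    fix x u W and p :: "nat \<Rightarrow> nat"
    assume W: "\<And>j. 2 \<le> j \<Longrightarrow> j < b + 1 \<Longrightarrow> W j = counter" and p: "\<And>j. b \<le> j \<Longrightarrow> j < b + 1 \<Longrightarrow> p j = 0"
    let ?p = "p(\<rho> i := 0, r := p r + p (\<rho> i), b := p b + p (\<rho> i))"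
    have "runs (Seq (copy_to (\<rho> i) r b) (move_to b (\<rho> i))) (cfg W p) (5 * p (\<rho> i) + 1 + (4 * ?p b + 1))
      (cfg W (?p(b := 0, \<rho> i := ?p (\<rho> i) + ?p b)))"
      by (rule runs_Seq[OF runs_copy_to runs_move_to]) (use \<rho>[OF i] r W in auto)
    moreover have "?p(b := 0, \<rho> i := ?p (\<rho> i) + ?p b) = p(r := p r + p (\<rho> i))"
      using \<rho>[OF i] r p[of b] by auto
    moreover have "5 * p (\<rho> i) + 1 + (4 * ?p b + 1) \<le> poly [:2, 9:] (st_size N (x, u, \<lambda>i. p (\<rho> i)))"
      using le[of "\<lambda>i. p (\<rho> i)"] \<rho>[OF i] r p[of b] by auto
    ultimately show "runs (Seq (copy_to (\<rho> i) r b) (move_to b (\<rho> i))) (cfg W p)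
        (poly [:2, 9:] (st_size N (x, u, \<lambda>i. p (\<rho> i))))
        (cfg W (p(r := p r + (case (x, u, \<lambda>i. p (\<rho> i)) of (x, u, e) \<Rightarrow> e i))))"
      by (auto intro: runs_mono)
  qed (use \<rho>[OF i] r in auto)
  then show "\<exists>c. realizes 1 [:2, 9:] N (\<lambda>(x, u, e). e i) \<rho> r b c" by blast
qed

lemma PF_const: "PF N (\<lambda>s. n)"
proof (rule PFI[where K = 0 and B = "[:n + 1:]"])
  fix \<rho> :: "nat \<Rightarrow> nat" and r b :: nat
  assume r: "2 \<le> r" "r < b"
  define c where "c = ((\<lambda>c. Seq c (inc r)) ^^ n) skip"
  have run: "runs c (cfg W p) (n + 1) (cfg W (p(r := p r + n)))" for W p
    unfolding c_def
  proof (induction n)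
    case (Suc n)
    have "(p(r := p r + n))(r := (p(r := p r + n)) r + 1) = p(r := p r + Suc n)" by auto
    then show ?case using runs_Seq[OF Suc runs_inc[of r]] by (simp del: fun_upd_apply)
  qed (simp add: runs_skip[simplified])
  have "realizes 0 [:n + 1:] N (\<lambda>s. n) \<rho> r b c"
  proof (rule realizesI)
    show "wf_com (b + 0) c" unfolding c_def using r by (induction n) auto
  qed (use run in simp)
  then show "\<exists>c. realizes 0 [:n + 1:] N (\<lambda>s. n) \<rho> r b c" by blast
qed (auto simp: depends_def)

lemma PF_add:
  assumes "PF N f" "PF N g"
  shows "PF N (\<lambda>s. f s + g s)"
proof -
  obtain K1 B1 where f: "depends N f" "\<And>s. f s \<le> poly B1 (st_size N s)"
    "\<And>\<rho> r b. (\<And>i. i < N \<Longrightarrow> 2 \<le> \<rho> i \<and> \<rho> i < b \<and> \<rho> i \<noteq> r) \<Longrightarrow> 2 \<le> r \<Longrightarrow> r < b \<Longrightarrow>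
        \<exists>c. realizes K1 B1 N f \<rho> r b c"
    using assms(1) by (rule PFE) blast
  obtain K2 B2 where g: "depends N g" "\<And>s. g s \<le> poly B2 (st_size N s)"
    "\<And>\<rho> r b. (\<And>i. i < N \<Longrightarrow> 2 \<le> \<rho> i \<and> \<rho> i < b \<and> \<rho> i \<noteq> r) \<Longrightarrow> 2 \<le> r \<Longrightarrow> r < b \<Longrightarrow>
        \<exists>c. realizes K2 B2 N g \<rho> r b c"
    using assms(2) by (rule PFE) blast
  let ?K = "max K1 K2"
  show ?thesis
  proof (rule PFI[where K = ?K and B = "B1 + B2"])
    show "depends N (\<lambda>s. f s + g s)"
      by (rule depends_binop[OF f(1) g(1)])
    show "f s + g s \<le> poly (B1 + B2) (st_size N s)" for s
      using add_mono[OF f(2)[of s] g(2)[of s]] by simp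
    fix \<rho> :: "nat \<Rightarrow> nat" and r b :: nat
    assume \<rho>: "\<And>i. i < N \<Longrightarrow> 2 \<le> \<rho> i \<and> \<rho> i < b \<and> \<rho> i \<noteq> r" and r: "2 \<le> r" "r < b"
    obtain c1 where c1: "realizes K1 B1 N f \<rho> r b c1" using f(3)[of \<rho> b r] \<rho> r by blast
    obtain c2 where c2: "realizes K2 B2 N g \<rho> r b c2" using g(3)[of \<rho> b r] \<rho> r by blast
    have "realizes ?K (B1 + B2) N (\<lambda>s. f s + g s) \<rho> r b (Seq c1 c2)"
    proof (rule realizesI)
      show "wf_com (b + ?K) (Seq c1 c2)"
        using realizes_wf[OF c1] realizes_wf[OF c2] by (auto intro: wf_com_mono)
      fix x u W and p :: "nat \<Rightarrow> nat"
      assume W0: "W 0 = word_contents x" "W 1 = word_contents u"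
        and W: "\<And>j. 2 \<le> j \<Longrightarrow> j < b + ?K \<Longrightarrow> W j = counter"
        and p0: "p 0 = 0" "p 1 = 0" and p: "\<And>j. b \<le> j \<Longrightarrow> j < b + ?K \<Longrightarrow> p j = 0"
      let ?e = "\<lambda>i. p (\<rho> i)" and ?p = "p(r := p r + f (x, u, \<lambda>i. p (\<rho> i)))"
      have e: "i < N \<Longrightarrow> ?p (\<rho> i) = ?e i" for i using \<rho>[of i] by auto
      have r1: "runs c1 (cfg W p) (poly B1 (st_size N (x, u, ?e))) (cfg W ?p)"
        by (rule realizesD[OF c1]) (use W0 W p0 p in auto)
      have r2: "runs c2 (cfg W ?p) (poly B2 (st_size N (x, u, \<lambda>i. ?p (\<rho> i))))
          (cfg W (?p(r := ?p r + g (x, u, \<lambda>i. ?p (\<rho> i)))))"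
        by (rule realizesD[OF c2]) (use W0 W p0 p r in auto)
      have "g (x, u, \<lambda>i. ?p (\<rho> i)) = g (x, u, ?e)" "st_size N (x, u, \<lambda>i. ?p (\<rho> i)) = st_size N (x, u, ?e)"
        using dependsD[OF g(1), of "\<lambda>i. ?p (\<rho> i)" ?e] st_size_cong[of N "\<lambda>i. ?p (\<rho> i)" ?e] e by auto
      then show "runs (Seq c1 c2) (cfg W p) (poly (B1 + B2) (st_size N (x, u, ?e)))
          (cfg W (p(r := p r + (f (x, u, ?e) + g (x, u, ?e)))))"
        using runs_Seq[OF r1 r2] by (simp add: add.assoc)
    qed
    then show "\<exists>c. realizes ?K (B1 + B2) N (\<lambda>s. f s + g s) \<rho> r b c" by blast
  qed
qed

text \<open>In the middle of a program the counters differ from the initial ones; all that matters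
  is that those of the variables still agree with \<open>e\<close>.\<close>

lemma realizes_run:
  assumes "realizes K B N f \<rho> r b c" "depends N f" "W 0 = word_contents x" "W 1 = word_contents u"
    "\<And>i. 2 \<le> i \<Longrightarrow> i < b + K \<Longrightarrow> W i = counter" "p 0 = 0" "p 1 = 0"
    "\<And>i. b \<le> i \<Longrightarrow> i < b + K \<Longrightarrow> p i = 0" "\<And>i. i < N \<Longrightarrow> p (\<rho> i) = e i"
  shows "runs c (cfg W p) (poly B (st_size N (x, u, e))) (cfg W (p(r := p r + f (x, u, e))))"
  using realizesD[OF assms(1,3-8)] dependsD[OF assms(2), of "\<lambda>i. p (\<rho> i)" e x u]
    st_size_cong[of N "\<lambda>i. p (\<rho> i)" e x u] assms(9) by simp

text \<open>The counter for \<open>g\<close> runs down to zero and takes the counter for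
  \<open>f\<close> along as long as that is positive, which is truncated subtraction.\<close>

lemma PF_diff:
  assumes "PF N f" "PF N g"
  shows "PF N (\<lambda>s. f s - g s)"
proof -
  obtain K1 B1 where f: "depends N f" "\<And>s. f s \<le> poly B1 (st_size N s)"
    "\<And>\<rho> r b. (\<And>i. i < N \<Longrightarrow> 2 \<le> \<rho> i \<and> \<rho> i < b \<and> \<rho> i \<noteq> r) \<Longrightarrow> 2 \<le> r \<Longrightarrow> r < b \<Longrightarrow>
        \<exists>c. realizes K1 B1 N f \<rho> r b c"
    using assms(1) by (rule PFE) blast
  obtain K2 B2 where g: "depends N g" "\<And>s. g s \<le> poly B2 (st_size N s)"
    "\<And>\<rho> r b. (\<And>i. i < N \<Longrightarrow> 2 \<le> \<rho> i \<and> \<rho> i < b \<and> \<rho> i \<noteq> r) \<Longrightarrow> 2 \<le> r \<Longrightarrow> r < b \<Longrightarrow>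
        \<exists>c. realizes K2 B2 N g \<rho> r b c"
    using assms(2) by (rule PFE) blast
  let ?K = "max K1 K2 + 2"
  let ?B = "B1 + B2 + [:6:] * B2 + [:4:] * B1 + [:2:]"
  show ?thesis
  proof (rule PFI[where K = ?K and B = ?B])
    show "depends N (\<lambda>s. f s - g s)"
      by (rule depends_binop[OF f(1) g(1)])
    show "f s - g s \<le> poly ?B (st_size N s)" for s
      using f(2)[of s] by simp
    fix \<rho> :: "nat \<Rightarrow> nat" and r b :: nat
    assume \<rho>: "\<And>i. i < N \<Longrightarrow> 2 \<le> \<rho> i \<and> \<rho> i < b \<and> \<rho> i \<noteq> r" and r: "2 \<le> r" "r < b"
    have \<rho>': "\<And>i. i < N \<Longrightarrow> \<rho> i \<noteq> b \<and> \<rho> i \<noteq> Suc b" using \<rho> by (metis less_irrefl not_less_eq less_Suc_eq)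
    obtain c1 where c1: "realizes K1 B1 N f \<rho> b (b + 2) c1" using f(3)[of \<rho> "b + 2" b] \<rho> r by fastforce
    obtain c2 where c2: "realizes K2 B2 N g \<rho> (b + 1) (b + 2) c2" using g(3)[of \<rho> "b + 2" "b + 1"] \<rho> r by fastforce
    let ?body = "Seq (dec (b + 1)) (IfEq b 1 skip (dec b))"
    let ?loop = "UntilEq (b + 1) 1 ?body"
    let ?c = "Seq c1 (Seq c2 (Seq ?loop (move_to b r)))"
    have "realizes ?K ?B N (\<lambda>s. f s - g s) \<rho> r b ?c"
    proof (rule realizesI)
      show "wf_com (b + ?K) ?c"
        using realizes_wf[OF c1] realizes_wf[OF c2] r by (auto intro: wf_com_mono)
      fix x u W and p :: "nat \<Rightarrow> nat"
      assume W0: "W 0 = word_contents x" "W 1 = word_contents u"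
        and W: "\<And>j. 2 \<le> j \<Longrightarrow> j < b + ?K \<Longrightarrow> W j = counter"
        and p0: "p 0 = 0" "p 1 = 0" and p: "\<And>j. b \<le> j \<Longrightarrow> j < b + ?K \<Longrightarrow> p j = 0"
      define e where "e = (\<lambda>i. p (\<rho> i))"
      define F where "F = f (x, u, e)"
      define G where "G = g (x, u, e)"
      define m where "m = st_size N (x, u, e)"
      have F: "F \<le> poly B1 m" and G: "G \<le> poly B2 m" using f(2) g(2) by (auto simp: F_def G_def m_def)
      let ?p1 = "p(b := p b + F)"
      let ?p2 = "?p1(b + 1 := ?p1 (b + 1) + G)"
      have r1: "runs c1 (cfg W p) (poly B1 m) (cfg W ?p1)"
        unfolding F_def m_def
        by (rule realizes_run[OF c1 f(1)]) (use W0 W p0 p \<rho>' in \<open>auto simp: e_def\<close>)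
      have r2: "runs c2 (cfg W ?p1) (poly B2 m) (cfg W ?p2)"
        unfolding G_def m_def
        by (rule realizes_run[OF c2 g(1)]) (use W0 W p0 p r \<rho>' in \<open>auto simp: e_def\<close>)
      let ?P = "\<lambda>i. p(b := F - i, b + 1 := G - i)"
      have r3: "runs ?loop (cfg W ?p2) ((\<Sum>i<G. 1 + 3 + 2) + 1) (cfg W (?P G))"
      proof (rule runs_for[where P = ?P and m = G])
        fix i assume i: "i < G"
        have "runs (IfEq b 1 skip (dec b)) (cfg W (p(b := F - i, b + 1 := G - Suc i))) (1 + 2)
            (cfg W (?P (Suc i)))"
        proof (cases "F - i = 0")
          case True
          have "p(b := F - i, b + 1 := G - Suc i) = ?P (Suc i)" using True by auto
          then show ?thesis
            using runs_IfT[OF _ runs_skip, of W "p(b := F - i, b + 1 := G - Suc i)" b 1 "dec b"]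
              sym_counter[of W b "p(b := F - i, b + 1 := G - Suc i)"] W[of b] r True by simp
        next
          case False
          have *: "(p(b := F - i, b + 1 := G - Suc i))(b := (p(b := F - i, b + 1 := G - Suc i)) b - 1) = ?P (Suc i)"
            by auto
          have "runs (dec b) (cfg W (p(b := F - i, b + 1 := G - Suc i))) 1 (cfg W (?P (Suc i)))"
            unfolding *[symmetric] using False by (intro runs_dec) simp
          moreover have "scanned (cfg W (p(b := F - i, b + 1 := G - Suc i))) b \<noteq> 1"
            using False W[of b] r by (subst sym_counter) auto
          ultimately show ?thesis by (intro runs_IfF)
        qed
        moreover have "runs (dec (b + 1)) (cfg W (?P i)) 1 (cfg W (p(b := F - i, b + 1 := G - Suc i)))"
          by (rule runs_cong[OF runs_dec]) (use i in auto)
        ultimately have "runs ?body (cfg W (?P i)) (1 + (1 + 2)) (cfg W (?P (Suc i)))"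
          by (intro runs_Seq)
        then show "runs ?body (cfg W (?P i)) (1 + 3) (cfg W (?P (Suc i)))" by (rule runs_mono) simp
      next
        show "?p2 = ?P 0" using p[of b] p[of "b + 1"] by auto
      qed (use W[of "b + 1"] r in auto)
      have r4: "runs (move_to b r) (cfg W (?P G)) (4 * (F - G) + 1) (cfg W (p(r := p r + (F - G))))"
      proof -
        have "(?P G)(b := 0, r := ?P G r + ?P G b) = p(r := p r + (F - G))"
          using p[of b] p[of "b + 1"] r by auto
        then show ?thesis using runs_move_to[of W b r "?P G"] W[of b] r by auto
      qed
      have "runs ?c (cfg W p) (poly ?B m) (cfg W (p(r := p r + (F - G))))"
        by (rule runs_mono[OF runs_Seq[OF r1 runs_Seq[OF r2 runs_Seq[OF r3 r4]]]])
          (use F G in auto)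
      then show "runs ?c (cfg W p) (poly ?B (st_size N (x, u, \<lambda>i. p (\<rho> i))))
          (cfg W (p(r := p r + (f (x, u, \<lambda>i. p (\<rho> i)) - g (x, u, \<lambda>i. p (\<rho> i))))))"
        by (simp only: F_def G_def m_def e_def)
    qed
    then show "\<exists>c. realizes ?K ?B N (\<lambda>s. f s - g s) \<rho> r b c" by blast
  qed
qed

lemma PF_sum_var:
  assumes "PF N f" "PF (Suc N) h"
  shows "PF N (\<lambda>(x, u, e). \<Sum>i<f (x, u, e). h (x, u, e(N := i)))"
proof -
  obtain K1 B1 where f: "depends N f" "\<And>s. f s \<le> poly B1 (st_size N s)"
    "\<And>\<rho> r b. (\<And>i. i < N \<Longrightarrow> 2 \<le> \<rho> i \<and> \<rho> i < b \<and> \<rho> i \<noteq> r) \<Longrightarrow> 2 \<le> r \<Longrightarrow> r < b \<Longrightarrow>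
        \<exists>c. realizes K1 B1 N f \<rho> r b c"
    using assms(1) by (rule PFE) blast
  obtain K2 B2 where g: "depends (Suc N) h" "\<And>s. h s \<le> poly B2 (st_size (Suc N) s)"
    "\<And>\<rho> r b. (\<And>i. i < Suc N \<Longrightarrow> 2 \<le> \<rho> i \<and> \<rho> i < b \<and> \<rho> i \<noteq> r) \<Longrightarrow> 2 \<le> r \<Longrightarrow> r < b \<Longrightarrow>
        \<exists>c. realizes K2 B2 (Suc N) h \<rho> r b c"
    using assms(2) by (rule PFE) blast
  let ?s = "\<lambda>(x, u, e). \<Sum>i<f (x, u, e). h (x, u, e(N := i))"
  let ?K = "max K1 K2 + 2"
  \<comment> \<open>The loop index is a new variable below \<open>f s\<close>, hence below
    \<open>B1\<close>, so the body runs on states that are larger by at most that much.\<close>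
  let ?B2 = "pcompose B2 ([:0, 1:] + B1)"
  let ?B = "B1 + B1 * (?B2 + [:4:]) + [:3:] * B1 + [:2:]"
  have st_size: "st_size (Suc N) (x, u, e(N := i)) = st_size N (x, u, e) + i" for x u i and e :: "nat \<Rightarrow> nat"
    by (simp add: st_size_def)
  have h_le: "poly B2 (st_size (Suc N) (x, u, e(N := i))) \<le> poly ?B2 (st_size N (x, u, e))"
    if "i < f (x, u, e)" for x u e i
    using that f(2)[of "(x, u, e)"] by (auto simp: st_size poly_pcompose intro!: poly_nat_mono)
  show ?thesis
  proof (rule PFI[where K = ?K and B = ?B])
    show "depends N ?s"
      unfolding depends_def
    proof (intro allI impI)
      fix x u and e e' :: "nat \<Rightarrow> nat"
      assume e: "\<forall>i<N. e i = e' i"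
      have "f (x, u, e) = f (x, u, e')" using dependsD[OF f(1)] e by blast
      moreover have "h (x, u, e(N := i)) = h (x, u, e'(N := i))" for i
        by (rule dependsD[OF g(1)]) (use e in auto)
      ultimately show "?s (x, u, e) = ?s (x, u, e')" by simp
    qed
    show "?s s \<le> poly ?B (st_size N s)" for s
    proof (cases s)
      case (fields x u e)
      have "h (x, u, e(N := i)) \<le> poly ?B2 (st_size N s)" if "i < f s" for i
        using g(2)[of "(x, u, e(N := i))"] h_le[of i x u e] that fields by auto
      then have "?s s \<le> f s * poly ?B2 (st_size N s)"
        using sum_bounded_above[of "{..<f s}" "\<lambda>i. h (x, u, e(N := i))"] fields by auto
      also have "\<dots> \<le> poly B1 (st_size N s) * poly ?B2 (st_size N s)" using f(2) by (intro mult_right_mono) auto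
      finally show ?thesis by (simp add: algebra_simps)
    qed
    fix \<rho> :: "nat \<Rightarrow> nat" and r b :: nat
    assume \<rho>: "\<And>i. i < N \<Longrightarrow> 2 \<le> \<rho> i \<and> \<rho> i < b \<and> \<rho> i \<noteq> r" and r: "2 \<le> r" "r < b"
    have \<rho>': "\<And>i. i < N \<Longrightarrow> \<rho> i \<noteq> b \<and> \<rho> i \<noteq> Suc b" using \<rho> by (metis less_irrefl not_less_eq less_Suc_eq)
    obtain c1 where c1: "realizes K1 B1 N f \<rho> b (b + 2) c1" using f(3)[of \<rho> "b + 2" b] \<rho> r by fastforce
    obtain c2 where c2: "realizes K2 B2 (Suc N) h (\<rho>(N := b + 1)) r (b + 2) c2"
    proof -
      have "2 \<le> (\<rho>(N := b + 1)) i \<and> (\<rho>(N := b + 1)) i < b + 2 \<and> (\<rho>(N := b + 1)) i \<noteq> r" if "i < Suc N" for i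
        using that \<rho>[of i] r by (cases "i = N") auto
      then show thesis using that g(3)[of "\<rho>(N := b + 1)" "b + 2" r] r by auto
    qed
    let ?body = "Seq c2 (Seq (inc (b + 1)) (dec b))"
    let ?loop = "UntilEq b 1 ?body"
    let ?c = "Seq c1 (Seq ?loop (clear (b + 1)))"
    have "realizes ?K ?B N ?s \<rho> r b ?c"
    proof (rule realizesI)
      show "wf_com (b + ?K) ?c"
        using realizes_wf[OF c1] realizes_wf[OF c2] r by (auto intro: wf_com_mono)
      fix x u W and p :: "nat \<Rightarrow> nat"
      assume W0: "W 0 = word_contents x" "W 1 = word_contents u"
        and W: "\<And>j. 2 \<le> j \<Longrightarrow> j < b + ?K \<Longrightarrow> W j = counter"
        and p0: "p 0 = 0" "p 1 = 0" and p: "\<And>j. b \<le> j \<Longrightarrow> j < b + ?K \<Longrightarrow> p j = 0"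
      define e where "e = (\<lambda>i. p (\<rho> i))"
      define F where "F = f (x, u, e)"
      define m where "m = st_size N (x, u, e)"
      define G where "G i = h (x, u, e(N := i))" for i
      have F: "F \<le> poly B1 m" using f(2) by (auto simp: F_def m_def)
      let ?p1 = "p(b := p b + F)"
      have r1: "runs c1 (cfg W p) (poly B1 m) (cfg W ?p1)"
        unfolding F_def m_def
        by (rule realizes_run[OF c1 f(1)]) (use W0 W p0 p \<rho>' in \<open>auto simp: e_def\<close>)
      let ?P = "\<lambda>i. p(b := F - i, b + 1 := i, r := p r + (\<Sum>j<i. G j))"
      have r3: "runs ?loop (cfg W ?p1) ((\<Sum>i<F. poly ?B2 m + (1 + 1) + 2) + 1) (cfg W (?P F))"
      proof (rule runs_for[where P = ?P and m = F])
        fix i assume i: "i < F"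
        let ?q = "(?P i)(r := ?P i r + G i)"
        have "?P i ((\<rho>(N := b + 1)) j) = (e(N := i)) j" if "j < Suc N" for j
          using that \<rho>[of j] \<rho>'[of j] r by (auto simp: e_def less_Suc_eq)
        then have "runs c2 (cfg W (?P i)) (poly B2 (st_size (Suc N) (x, u, e(N := i)))) (cfg W ?q)"
          unfolding G_def by (intro realizes_run[OF c2 g(1)]) (use W0 W p0 p r in auto)
        then have "runs c2 (cfg W (?P i)) (poly ?B2 m) (cfg W ?q)"
          using h_le[of i x u e] i by (auto simp: F_def m_def intro: runs_mono)
        then have "runs ?body (cfg W (?P i)) (poly ?B2 m + (1 + 1))
            (cfg W ((?q(b + 1 := ?q (b + 1) + 1))(b := (?q(b + 1 := ?q (b + 1) + 1)) b - 1)))"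
          by (rule runs_Seq[OF _ runs_Seq[OF runs_inc runs_dec]]) (use i r in auto)
        moreover have "(?q(b + 1 := ?q (b + 1) + 1))(b := (?q(b + 1 := ?q (b + 1) + 1)) b - 1) = ?P (Suc i)"
          using r by auto
        ultimately show "runs ?body (cfg W (?P i)) (poly ?B2 m + (1 + 1)) (cfg W (?P (Suc i)))" by simp
      next
        show "?p1 = ?P 0" using p[of b] p[of "b + 1"] r by auto
      qed (use W[of b] r in auto)
      have r4: "runs (clear (b + 1)) (cfg W (?P F)) (3 * F + 1) (cfg W (p(r := p r + (\<Sum>j<F. G j))))"
      proof -
        have "(?P F)(b + 1 := 0) = p(r := p r + (\<Sum>j<F. G j))"
          using p[of b] p[of "b + 1"] r by auto
        then show ?thesis using runs_clear[of W "b + 1" "?P F"] W[of "b + 1"] r by auto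
      qed
      have "F * (poly ?B2 m + 4) \<le> poly B1 m * (poly ?B2 m + 4)" using F by (rule mult_right_mono) simp
      then have "runs ?c (cfg W p) (poly ?B m) (cfg W (p(r := p r + (\<Sum>j<F. G j))))"
        using F by (intro runs_mono[OF runs_Seq[OF r1 runs_Seq[OF r3 r4]]]) (auto simp: algebra_simps)
      then show "runs ?c (cfg W p) (poly ?B (st_size N (x, u, \<lambda>i. p (\<rho> i))))
          (cfg W (p(r := p r + ?s (x, u, \<lambda>i. p (\<rho> i)))))"
        by (simp only: F_def G_def m_def e_def prod.case)
    qed
    then show "\<exists>c. realizes ?K ?B N ?s \<rho> r b c" by blast
  qed
qed

text \<open>The bound variable is represented by an arbitrary function \<open>v\<close> computable in the extended
  context; thus the premise can be discharged without naming variables.\<close>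

lemma PF_sum:
  assumes "PF N f" and g: "\<And>M v. N \<le> M \<Longrightarrow> PF M v \<Longrightarrow> PF M (\<lambda>s. g (v s) s)"
  shows "PF N (\<lambda>s. \<Sum>i<f s. g i s)"
proof -
  have "PF (Suc N) (\<lambda>s. g ((\<lambda>(x, u, e). e N) s) s)" by (rule g[OF _ PF_var]) auto
  then have sum: "PF N (\<lambda>(x, u, e). \<Sum>i<f (x, u, e). g i (x, u, e(N := i)))"
    using PF_sum_var[OF assms(1), of "\<lambda>s. g ((\<lambda>(x, u, e). e N) s) s"] by simp
  have "g i (x, u, e(N := i)) = g i (x, u, e)" for i x u e
  proof -
    \<comment> \<open>Instantiating \<open>v\<close> with a constant shows that \<open>g i\<close>
      depends on the first \<open>N\<close> variables only, so overwriting variable \<open>N\<close>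
      by the index is harmless.\<close>
    have "PF N (\<lambda>s. g i s)" using g[OF _ PF_const, of N i] by simp
    then show ?thesis using dependsD[of N "g i" "e(N := i)" e] unfolding PF_def by auto
  qed
  then have "(\<lambda>(x, u, e). \<Sum>i<f (x, u, e). g i (x, u, e(N := i))) = (\<lambda>s. \<Sum>i<f s. g i s)"
    by (auto simp: fun_eq_iff)
  then show ?thesis using sum by simp
qed

text \<open>Bits are the symbols 1 and 2, so the first blank marks the end of the word. The distance
  is recorded in \<open>b\<close> as well, in order to bring the head back.\<close>

lemma PF_len: "PF N (\<lambda>s. length (fst s))"
proof (rule PFI[where K = 1 and B = "[:2, 9:]"])
  show "depends N (\<lambda>s. length (fst s))" by (simp add: depends_def)
  show "length (fst s) \<le> poly [:2, 9:] (st_size N s)" for s :: st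
    by (cases s) (simp add: st_size_def)
  fix \<rho> :: "nat \<Rightarrow> nat" and r b :: nat
  assume r: "2 \<le> r" "r < b"
  let ?c1 = "UntilEq 0 0 (Seq (inc r) (Seq (inc b) (inc 0)))"
  let ?c2 = "UntilEq b 1 (Seq (dec b) (dec 0))"
  have "realizes 1 [:2, 9:] N (\<lambda>s. length (fst s)) \<rho> r b (Seq ?c1 ?c2)"
  proof (rule realizesI)
    show "wf_com (b + 1) (Seq ?c1 ?c2)" using r by auto
    fix x u W and p :: "nat \<Rightarrow> nat"
    assume W0: "W 0 = word_contents x"
      and W: "\<And>j. 2 \<le> j \<Longrightarrow> j < b + 1 \<Longrightarrow> W j = counter"
      and p0: "p 0 = 0" and p: "\<And>j. b \<le> j \<Longrightarrow> j < b + 1 \<Longrightarrow> p j = 0"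
    let ?n = "length x"
    let ?P = "\<lambda>i. p(r := p r + i, b := i, 0 := i)"
    have r1: "runs ?c1 (cfg W (?P 0)) ((\<Sum>i<?n. 1 + (1 + 1) + 2) + 1) (cfg W (?P ?n))"
    proof (rule runs_UntilEq[where T = "\<lambda>i. cfg W (?P i)"])
      fix i assume i: "i < ?n"
      then show "scanned (cfg W (?P i)) 0 \<noteq> 0" using W0 by (simp add: sym_cfg word_contents_def)
      show "runs (Seq (inc r) (Seq (inc b) (inc 0))) (cfg W (?P i)) (1 + (1 + 1)) (cfg W (?P (Suc i)))"
        by (rule runs_cong[OF runs_Seq[OF runs_inc runs_Seq[OF runs_inc runs_inc]]])
          (use r in \<open>auto intro!: arg_cong[where f = "cfg W"]\<close>)
    qed (use W0 in \<open>auto simp: sym_cfg word_contents_def\<close>)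
    let ?Q = "\<lambda>i. p(r := p r + ?n, b := ?n - i, 0 := ?n - i)"
    have r2: "runs ?c2 (cfg W (?P ?n)) ((\<Sum>i<?n. 1 + 1 + 2) + 1) (cfg W (?Q ?n))"
    proof (rule runs_for[where P = ?Q])
      fix i assume i: "i < ?n"
      show "runs (Seq (dec b) (dec 0)) (cfg W (?Q i)) (1 + 1) (cfg W (?Q (Suc i)))"
        by (rule runs_cong[OF runs_Seq[OF runs_dec runs_dec]])
          (use i r in \<open>auto intro!: arg_cong[where f = "cfg W"]\<close>)
    qed (use W r in auto)
    have "?P 0 = p" "?Q ?n = p(r := p r + ?n)" using p0 p[of b] r by auto
    then have "runs (Seq ?c1 ?c2) (cfg W p) (9 * ?n + 2) (cfg W (p(r := p r + ?n)))"
      using runs_Seq[OF r1 r2] by (auto elim!: runs_mono)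
    then show "runs (Seq ?c1 ?c2) (cfg W p) (poly [:2, 9:] (st_size N (x, u, \<lambda>i. p (\<rho> i))))
        (cfg W (p(r := p r + length (fst (x, u, \<lambda>i. p (\<rho> i))))))"
      by (auto simp: st_size_def elim!: runs_mono)
  qed
  then show "\<exists>c. realizes 1 [:2, 9:] N (\<lambda>s. length (fst s)) \<rho> r b c" by blast
qed

text \<open>Positions past the end give \<open>False\<close>; on the tape they hold the blank, which
  also differs from symbol 2, so reading needs no range check.\<close>

definition bit_at :: "bool list \<Rightarrow> nat \<Rightarrow> bool" where
  "bit_at x i \<longleftrightarrow> i < length x \<and> x ! i"

lemma word_contents_bit: "word_contents x (int i) = 2 \<longleftrightarrow> bit_at x i"
  by (simp add: word_contents_def bit_at_def)

definition word_on :: "nat \<Rightarrow> st \<Rightarrow> bool list" where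
  "word_on \<tau> s = (if \<tau> = 0 then fst s else fst (snd s))"

text \<open>The head of an input tape moves like that of a counter, so \<open>copy_to\<close> sends
  it to position \<open>f s\<close> and records the distance. The rewinding loop stands in both
  branches because the test has to come before the head leaves the cell.\<close>

lemma PF_bit_on:
  assumes "PF N f" and \<tau>: "\<tau> < 2"
  shows "PF N (\<lambda>s. of_bool (bit_at (word_on \<tau> s) (f s)))"
proof -
  obtain K1 B1 where f: "depends N f" "\<And>s. f s \<le> poly B1 (st_size N s)"
    "\<And>\<rho> r b. (\<And>i. i < N \<Longrightarrow> 2 \<le> \<rho> i \<and> \<rho> i < b \<and> \<rho> i \<noteq> r) \<Longrightarrow> 2 \<le> r \<Longrightarrow> r < b \<Longrightarrow>
        \<exists>c. realizes K1 B1 N f \<rho> r b c"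
    using assms(1) by (rule PFE) blast
  let ?s = "\<lambda>s. of_bool (bit_at (word_on \<tau> s) (f s)) :: nat"
  let ?K = "K1 + 2"
  let ?B = "B1 + [:9:] * B1 + [:5:]"
  show ?thesis
  proof (rule PFI[where K = ?K and B = ?B])
    show "depends N ?s"
      using f(1) unfolding depends_def by (auto simp: word_on_def) metis+
    show "?s s \<le> poly ?B (st_size N s)" for s by simp
    fix \<rho> :: "nat \<Rightarrow> nat" and r b :: nat
    assume \<rho>: "\<And>i. i < N \<Longrightarrow> 2 \<le> \<rho> i \<and> \<rho> i < b \<and> \<rho> i \<noteq> r" and r: "2 \<le> r" "r < b"
    have \<rho>': "\<And>i. i < N \<Longrightarrow> \<rho> i \<noteq> b \<and> \<rho> i \<noteq> Suc b" using \<rho> by (metis less_irrefl not_less_eq less_Suc_eq)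
    obtain c1 where c1: "realizes K1 B1 N f \<rho> b (b + 2) c1" using f(3)[of \<rho> "b + 2" b] \<rho> r by fastforce
    let ?rewind = "UntilEq (b + 1) 1 (Seq (dec (b + 1)) (dec \<tau>))"
    let ?c = "Seq c1 (Seq (copy_to b (b + 1) \<tau>) (IfEq \<tau> 2 (Seq ?rewind (inc r)) ?rewind))"
    have "realizes ?K ?B N ?s \<rho> r b ?c"
    proof (rule realizesI)
      show "wf_com (b + ?K) ?c"
        using realizes_wf[OF c1] r \<tau> by (auto intro: wf_com_mono)
      fix x u W and p :: "nat \<Rightarrow> nat"
      assume W0: "W 0 = word_contents x" "W 1 = word_contents u"
        and W: "\<And>j. 2 \<le> j \<Longrightarrow> j < b + ?K \<Longrightarrow> W j = counter"
        and p0: "p 0 = 0" "p 1 = 0" and p: "\<And>j. b \<le> j \<Longrightarrow> j < b + ?K \<Longrightarrow> p j = 0"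
      define e where "e = (\<lambda>i. p (\<rho> i))"
      define F where "F = f (x, u, e)"
      define m where "m = st_size N (x, u, e)"
      have F: "F \<le> poly B1 m" using f(2) by (auto simp: F_def m_def)
      have p\<tau>: "p \<tau> = 0" using p0 less_2_cases[OF \<tau>] by auto
      have ne: "\<tau> \<noteq> b" "\<tau> \<noteq> b + 1" "\<tau> \<noteq> r" using \<tau> r by auto
      have scanned: "scanned (cfg W q) \<tau> = 2 \<longleftrightarrow> bit_at (word_on \<tau> (x, u, e)) (q \<tau>)" for q
        using W0 less_2_cases[OF \<tau>] by (auto simp: sym_cfg word_on_def word_contents_bit)
      let ?p1 = "p(b := p b + F)"
      have r1: "runs c1 (cfg W p) (poly B1 m) (cfg W ?p1)"
        unfolding F_def m_def
        by (rule realizes_run[OF c1 f(1)]) (use W0 W p0 p \<rho>' in \<open>auto simp: e_def\<close>)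
      let ?Q = "\<lambda>i. p(b + 1 := F - i, \<tau> := F - i)"
      have r2: "runs (copy_to b (b + 1) \<tau>) (cfg W ?p1) (5 * F + 1) (cfg W (?Q 0))"
      proof -
        have "?p1(b := 0, b + 1 := ?p1 (b + 1) + ?p1 b, \<tau> := ?p1 \<tau> + ?p1 b) = ?Q 0"
          using ne p[of b] p[of "b + 1"] p\<tau> by auto
        then show ?thesis using runs_copy_to[of W b "b + 1" \<tau> ?p1] W[of b] r ne p[of b] by auto
      qed
      have "runs ?rewind (cfg W (?Q 0)) ((\<Sum>i<F. 1 + 1 + 2) + 1) (cfg W (?Q F))"
      proof (rule runs_for[where P = ?Q])
        fix i assume i: "i < F"
        show "runs (Seq (dec (b + 1)) (dec \<tau>)) (cfg W (?Q i)) (1 + 1) (cfg W (?Q (Suc i)))"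
          by (rule runs_cong[OF runs_Seq[OF runs_dec runs_dec]])
            (use i ne in \<open>auto intro!: arg_cong[where f = "cfg W"]\<close>)
      qed (use W[of "b + 1"] r ne in auto)
      moreover have "?Q F = p" using p[of "b + 1"] p\<tau> by auto
      ultimately have rewind: "runs ?rewind (cfg W (?Q 0)) (4 * F + 1) (cfg W p)" by (auto elim!: runs_mono)
      have r3: "runs (IfEq \<tau> 2 (Seq ?rewind (inc r)) ?rewind) (cfg W (?Q 0)) (4 * F + 1 + 1 + 2)
          (cfg W (p(r := p r + ?s (x, u, e))))"
      proof (cases "bit_at (word_on \<tau> (x, u, e)) F")
        case True
        then show ?thesis
          using runs_IfT[OF _ runs_Seq[OF rewind runs_inc], of \<tau> 2 r ?rewind] scanned[of "?Q 0"] by (simp add: F_def)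
      next
        case False
        then show ?thesis
          using runs_mono[OF runs_IfF[OF _ rewind, of \<tau> 2 "Seq ?rewind (inc r)"], of "4 * F + 1 + 1 + 2"]
            scanned[of "?Q 0"] by (simp add: F_def)
      qed
      have "runs ?c (cfg W p) (poly ?B m) (cfg W (p(r := p r + ?s (x, u, e))))"
        by (rule runs_mono[OF runs_Seq[OF r1 runs_Seq[OF r2 r3]]]) (use F in auto)
      then show "runs ?c (cfg W p) (poly ?B (st_size N (x, u, \<lambda>i. p (\<rho> i))))
          (cfg W (p(r := p r + ?s (x, u, \<lambda>i. p (\<rho> i)))))"
        by (simp only: m_def e_def)
    qed
    then show "\<exists>c. realizes ?K ?B N ?s \<rho> r b c" by blast
  qed
qed

section \<open>Closure of polynomial-time functions and predicates\<close>

definition PB :: "nat \<Rightarrow> (st \<Rightarrow> bool) \<Rightarrow> bool" where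
  "PB N P \<longleftrightarrow> PF N (\<lambda>s. of_bool (P s))"

lemma PF_cong: "PF N f \<Longrightarrow> (\<And>s. f s = g s) \<Longrightarrow> PF N g"
  by (metis ext)

lemma PF_of_bool: "PB N P \<Longrightarrow> PF N (\<lambda>s. of_bool (P s))"
  unfolding PB_def .

lemma PF_mult:
  assumes "PF N f" "PF N g"
  shows "PF N (\<lambda>s. f s * g s)"
proof -
  have "PF N (\<lambda>s. \<Sum>i<f s. g s)"
    by (rule PF_sum[OF assms(1)]) (rule PF_weaken[OF assms(2)])
  then show ?thesis by (rule PF_cong) simp
qed

lemma PB_not: "PB N P \<Longrightarrow> PB N (\<lambda>s. \<not> P s)"
  unfolding PB_def by (rule PF_cong[OF PF_diff[OF PF_const[of _ 1]]]) auto

lemma PB_conj: "PB N P \<Longrightarrow> PB N Q \<Longrightarrow> PB N (\<lambda>s. P s \<and> Q s)"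
  unfolding PB_def
  by (rule PF_cong[OF PF_mult[of N "\<lambda>s. of_bool (P s)" "\<lambda>s. of_bool (Q s)"]]) auto

lemma PB_disj:
  assumes "PB N P" "PB N Q"
  shows "PB N (\<lambda>s. P s \<or> Q s)"
  using PB_not[OF PB_conj[OF PB_not[OF assms(1)] PB_not[OF assms(2)]]] by simp

lemma PB_imp:
  assumes "PB N P" "PB N Q"
  shows "PB N (\<lambda>s. P s \<longrightarrow> Q s)"
  unfolding imp_conv_disj by (intro PB_disj PB_not assms)

text \<open>With truncated subtraction, \<open>1 - (1 - (g - f))\<close> is the sign of
  \<open>g - f\<close>.\<close>

lemma PB_less: "PF N f \<Longrightarrow> PF N g \<Longrightarrow> PB N (\<lambda>s. f s < g s)"
  unfolding PB_def
  by (rule PF_cong[OF PF_diff[OF PF_const[of _ 1] PF_diff[OF PF_const[of _ 1] PF_diff[of N g f]]]]) auto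

lemma PB_le:
  assumes "PF N f" "PF N g"
  shows "PB N (\<lambda>s. f s \<le> g s)"
  using PB_not[OF PB_less[OF assms(2,1)]] by (simp add: not_less)

lemma PB_eq:
  assumes "PF N f" "PF N g"
  shows "PB N (\<lambda>s. f s = g s)"
  using PB_conj[OF PB_le[OF assms] PB_le[OF assms(2,1)]] by (simp add: eq_iff)

lemma PB_const: "PB N (\<lambda>s. b)"
  unfolding PB_def by (rule PF_const)

lemma PF_if:
  assumes "PB N P" "PF N f" "PF N g"
  shows "PF N (\<lambda>s. if P s then f s else g s)"
  by (rule PF_cong[OF PF_add[OF PF_mult[OF PF_of_bool[OF assms(1)] assms(2)]
      PF_mult[OF PF_of_bool[OF PB_not[OF assms(1)]] assms(3)]]]) auto

lemma PB_if:
  assumes "PB N P" "PB N f" "PB N g"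
  shows "PB N (\<lambda>s. if P s then f s else g s)"
  using PF_if[OF assms(1) PF_of_bool[OF assms(2)] PF_of_bool[OF assms(3)]]
  unfolding PB_def by (rule PF_cong) auto

lemma PB_iff:
  assumes "PB N P" "PB N Q"
  shows "PB N (\<lambda>s. P s = Q s)"
  using PB_if[OF assms PB_not[OF assms(2)]] by (rule back_subst[where P = "PB N"]) auto

lemma PB_ex:
  assumes "PF N f" "\<And>M v. N \<le> M \<Longrightarrow> PF M v \<Longrightarrow> PB M (\<lambda>s. P (v s) s)"
  shows "PB N (\<lambda>s. \<exists>i<f s. P i s)"
proof -
  have "PB N (\<lambda>s. 0 < (\<Sum>i<f s. of_bool (P i s) :: nat))"
    by (intro PB_less PF_const PF_sum assms PF_of_bool)
  moreover have "(0 < (\<Sum>i<f s. of_bool (P i s) :: nat)) = (\<exists>i<f s. P i s)" for s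
  proof -
    have "((\<Sum>i<f s. of_bool (P i s) :: nat) = 0) = (\<forall>i<f s. \<not> P i s)" by auto
    then show ?thesis by (metis (no_types, lifting) gr0I not_less0)
  qed
  ultimately show ?thesis by simp
qed

lemma PB_all:
  assumes "PF N f" "\<And>M v. N \<le> M \<Longrightarrow> PF M v \<Longrightarrow> PB M (\<lambda>s. P (v s) s)"
  shows "PB N (\<lambda>s. \<forall>i<f s. P i s)"
  using PB_not[OF PB_ex[OF assms(1), of "\<lambda>i s. \<not> P i s"]] PB_not[OF assms(2)] by simp

text \<open>The quotient counts the indices \<open>i\<close> with
  \<open>(i + 1) * b \<le> a\<close>; the test \<open>0 < b\<close> matches the convention that
  division by zero gives zero.\<close>

lemma PF_div:
  assumes "PF N f" "PF N g"
  shows "PF N (\<lambda>s. f s div g s)"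
proof -
  have *: "a div b = (\<Sum>i<a. of_bool (0 < b \<and> (i + 1) * b \<le> a))" for a b :: nat
  proof (cases "b = 0")
    case False
    have "(\<Sum>i<a. of_bool (0 < b \<and> (i + 1) * b \<le> a)) = (\<Sum>i<a. of_bool (i < a div b) :: nat)"
      using False by (intro sum.cong) (auto simp: less_eq_div_iff_mult_less_eq Suc_le_eq[symmetric] simp del: mult_Suc)
    also have "\<dots> = (\<Sum>i\<in>{..<a div b}. 1)"
      by (rule sum.mono_neutral_cong_right) (auto dest: less_le_trans[OF _ div_le_dividend])
    finally show ?thesis by simp
  qed simp
  show ?thesis
    unfolding *
    by (intro PF_sum PF_of_bool PB_conj PB_le PB_less PF_mult PF_add PF_const assms
        PF_weaken[OF assms(1)] PF_weaken[OF assms(2)])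
qed

lemma PF_mod:
  assumes "PF N f" "PF N g"
  shows "PF N (\<lambda>s. f s mod g s)"
  by (rule PF_cong[OF PF_diff[OF assms(1) PF_mult[OF PF_div[OF assms] assms(2)]]])
    (simp add: minus_div_mult_eq_mod)

lemma PF_poly: "PF N f \<Longrightarrow> PF N (\<lambda>s. poly q (f s))"
  by (induction q) (auto intro!: PF_const PF_add PF_mult)

lemma PF_finite_sum: "(\<And>i. i < (n :: nat) \<Longrightarrow> PF N (F i)) \<Longrightarrow> PF N (\<lambda>s. \<Sum>i<n. F i s)"
  by (induction n) (auto intro!: PF_const PF_add)

text \<open>The table \<open>F\<close> has a fixed number of entries that are built into the
  program, so nothing is assumed about how \<open>F i\<close> varies with \<open>i\<close>.\<close>

lemma PF_select:
  assumes "PF N j" "\<And>i. i < n \<Longrightarrow> PF N (F i)" "\<And>s. j s < n"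
  shows "PF N (\<lambda>s. F (j s) s)"
proof -
  have "PF N (\<lambda>s. \<Sum>i<n. if j s = i then F i s else 0)"
    by (intro PF_finite_sum PF_if PB_eq PF_const assms(1,2))
  then show ?thesis using assms(3) by simp
qed

lemma PB_bit: "PF N f \<Longrightarrow> PB N (\<lambda>s. bit_at (fst s) (f s))"
  using PF_bit_on[of N f 0] unfolding PB_def word_on_def by simp

lemma PB_bit_cert: "PF N f \<Longrightarrow> PB N (\<lambda>s. bit_at (fst (snd s)) (f s))"
  using PF_bit_on[of N f 1] unfolding PB_def word_on_def by simp

section \<open>Machines from programs\<close>

text \<open>A blank tape with its head on cell 0 becomes a counter of value 0.\<close>

definition mark_tapes :: "nat \<Rightarrow> com" where
  "mark_tapes m = foldr (\<lambda>i. Seq (Op i (Some 1) Stay)) [2..<m] skip"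

definition blank_above :: "nat \<Rightarrow> (nat \<Rightarrow> int \<Rightarrow> nat) \<Rightarrow> bool" where
  "blank_above n W \<longleftrightarrow> (\<forall>i\<ge>n. W i = (\<lambda>_. 0))"

lemma runs_mark:
  assumes "p i = 0"
  shows "runs (Op i (Some 1) Stay) (cfg W p) 1 (cfg (W(i := (W i)(0 := 1))) p)"
proof -
  have "(cfg W p)(i := act (written (Some 1) (scanned (cfg W p) i), Stay) (cfg W p i)) =
      cfg (W(i := (W i)(0 := 1))) p"
    using assms by (auto simp: cfg_def written_def)
  then show ?thesis using runs_Op[of i "Some 1" Stay "cfg W p"] by simp
qed

lemma runs_mark_tapes:
  assumes "blank_above 2 W"
  shows "runs (mark_tapes m) (cfg W (\<lambda>_. 0)) (m + 1)
    (cfg (\<lambda>i. if 2 \<le> i \<and> i < m then counter else W i) (\<lambda>_. 0))"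
proof -
  have "runs (foldr (\<lambda>i. Seq (Op i (Some 1) Stay)) is skip) (cfg V (\<lambda>_. 0)) (length is + 1)
      (cfg (\<lambda>i. if i \<in> set is then (V i)(0 := 1) else V i) (\<lambda>_. 0))" for V "is"
  proof (induction "is" arbitrary: V)
    case Nil
    then show ?case using runs_skip by simp
  next
    case (Cons i "is")
    have "runs (foldr (\<lambda>i. Seq (Op i (Some 1) Stay)) (i # is) skip) (cfg V (\<lambda>_. 0)) (1 + (length is + 1))
       (cfg (\<lambda>j. if j \<in> set is then ((V(i := (V i)(0 := 1))) j)(0 := 1) else (V(i := (V i)(0 := 1))) j) (\<lambda>_. 0))"
      unfolding foldr.simps comp_def by (rule runs_Seq[OF runs_mark Cons.IH]) simp
    moreover have "(\<lambda>j. if j \<in> set is then ((V(i := (V i)(0 := 1))) j)(0 := 1) else (V(i := (V i)(0 := 1))) j) =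
        (\<lambda>j. if j \<in> set (i # is) then (V j)(0 := 1) else V j)"
      by (auto simp: fun_eq_iff)
    ultimately show ?case by simp
  qed
  from this[of "[2..<m]" W]
  have "runs (mark_tapes m) (cfg W (\<lambda>_. 0)) (m - 2 + 1)
      (cfg (\<lambda>i. if i \<in> set [2..<m] then (W i)(0 := 1) else W i) (\<lambda>_. 0))"
    by (simp add: mark_tapes_def)
  moreover have "(\<lambda>i. if i \<in> set [2..<m] then (W i)(0 := 1) else W i) =
      (\<lambda>i. if 2 \<le> i \<and> i < m then counter else W i)"
    using assms by (auto simp: blank_above_def counter_def fun_eq_iff)
  ultimately show ?thesis by (auto elim: runs_mono)
qed

lemma wf_mark_tapes: "m \<le> K \<Longrightarrow> 0 < K \<Longrightarrow> wf_com K (mark_tapes m)"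
proof -
  assume "m \<le> K" "0 < K"
  then have "set is \<subseteq> {2..<m} \<Longrightarrow> wf_com K (foldr (\<lambda>i. Seq (Op i (Some 1) Stay)) is skip)" for "is"
    by (induction "is") auto
  then show ?thesis unfolding mark_tapes_def by simp
qed

definition input_on :: "bool list list \<Rightarrow> nat \<Rightarrow> int \<Rightarrow> nat" where
  "input_on xs i = word_contents (if i < length xs then xs ! i else [])"

lemma word_contents_Nil: "word_contents [] = (\<lambda>_. 0)"
  by (simp add: word_contents_def fun_eq_iff)

lemma blank_above_input: "length xs \<le> n \<Longrightarrow> blank_above n (input_on xs)"
  by (simp add: blank_above_def input_on_def word_contents_Nil)

lemma tm_init_tm_of: "tm_init (tm_of K code) xs = (Work 0, map (cfg (input_on xs) (\<lambda>_. 0)) [0..<K])"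
  by (simp add: tm_init_def tm_of_def cfg_def input_on_def)

lemma tm_step_halted: "fst c \<in> {Accept, Reject} \<Longrightarrow> tm_step M c = c"
  by (cases c) (auto simp: tm_step.simps)

lemma tm_run_halted:
  assumes "fst (tm_run M xs t) \<in> {Accept, Reject}" "t \<le> t'"
  shows "tm_run M xs t' = tm_run M xs t"
  using assms(2)
proof (induction rule: dec_induct)
  case (step n)
  then show ?case using tm_step_halted[of "tm_run M xs t" M] assms(1) by (simp add: tm_run_def)
qed simp

lemma tm_run_prog:
  assumes "runs c (cfg (input_on xs) (\<lambda>_. 0)) B T'" "wf_com K c" "code = compile 0 c @ ys"
  obtains n where "n \<le> B"
    "tm_run (tm_of K code) xs n = (Work (length (compile 0 c)), map T' [0..<K])"
proof -
  obtain n where n: "n \<le> B" "exec c (cfg (input_on xs) (\<lambda>_. 0)) n T'"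
    using assms(1) unfolding runs_def by auto
  show thesis
    using that[OF n(1)] exec_tm_of[OF n(2) assms(2), of code "[]" ys] assms(3)
    by (simp add: tm_run_def tm_init_tm_of)
qed

text \<open>Tape 2 is meant to be a counter, whose mark is scanned exactly at value 0; hence the
  appended test rejects on symbol 1.\<close>

lemma decider:
  assumes "wf_com K c" "3 \<le> K"
  obtains M where "wf_tm M" "num_tapes M = K"
    "\<And>xs B T'. runs c (cfg (input_on xs) (\<lambda>_. 0)) B T' \<Longrightarrow>
       halts_within M xs (B + 2) \<and> (accepts_within M xs (B + 2) \<longleftrightarrow> scanned T' 2 \<noteq> 1)"
proof -
  let ?L = "length (compile 0 c)"
  let ?code = "compile 0 c @ [IBr 2 1 (?L + 2), IHalt True, IHalt False]"
  let ?M = "tm_of K ?code"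
  have "wf_instr K (length ?code) I" if "I \<in> set ?code" for I
    using that assms wf_instr_compile[OF assms(1), of 0 "length ?code" I] by auto
  then have "wf_tm ?M" using assms(2) by (intro wf_tm_of[where b = False]) auto
  moreover have "num_tapes ?M = K" by (simp add: tm_of_def)
  moreover have "halts_within ?M xs (B + 2) \<and> (accepts_within ?M xs (B + 2) \<longleftrightarrow> scanned T' 2 \<noteq> 1)"
    if run: "runs c (cfg (input_on xs) (\<lambda>_. 0)) B T'" for xs B T'
  proof -
    obtain n where n: "n \<le> B" "tm_run ?M xs n = (Work ?L, map T' [0..<K])"
      using tm_run_prog[OF run assms(1), of ?code] by blast
    have "tm_step ?M (Work ?L, map T' [0..<K]) = (Work (if scanned T' 2 = 1 then ?L + 2 else ?L + 1), map T' [0..<K])"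
      using assms(2) by (subst tm_step_IBr[of _ _ 2 1]) auto
    moreover have "tm_step ?M (Work (?L + 2), map T' [0..<K]) = (Reject, map T' [0..<K])"
      by (subst tm_step_IHalt[of _ _ False]) (auto simp: nth_append)
    moreover have "tm_step ?M (Work (?L + 1), map T' [0..<K]) = (Accept, map T' [0..<K])"
      by (subst tm_step_IHalt[of _ _ True]) (auto simp: nth_append)
    ultimately have "tm_run ?M xs (n + 2) = ((if scanned T' 2 = 1 then Reject else Accept), map T' [0..<K])"
      using n(2) by (simp add: tm_run_def split: if_splits)
    moreover from this have "tm_run ?M xs (B + 2) = tm_run ?M xs (n + 2)"
      using n(1) by (intro tm_run_halted) auto
    ultimately show ?thesis by (simp add: halts_within_def accepts_within_def)
  qed
  ultimately show thesis using that[of ?M] by blast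
qed

abbreviation (input) "env0 \<equiv> (\<lambda>_. 0 :: nat)"

lemma NP_I:
  assumes "PB 0 P" and L: "\<And>x. x \<in> L \<longleftrightarrow> (\<exists>u. length u \<le> poly q (length x) \<and> P (x, u, env0))"
  shows "L \<in> NP"
proof -
  obtain K B where f: "\<And>\<rho> r b. (\<And>i. i < 0 \<Longrightarrow> 2 \<le> \<rho> i \<and> \<rho> i < b \<and> \<rho> i \<noteq> r) \<Longrightarrow> 2 \<le> r \<Longrightarrow> r < b \<Longrightarrow>
        \<exists>c. realizes K B 0 (\<lambda>s. of_bool (P s)) \<rho> r b c"
    using assms(1) unfolding PB_def by (rule PFE) blast
  \<comment> \<open>There are no variables, so the allocation is arbitrary; the result goes to
    counter 2 and scratch space starts at 3.\<close>
  obtain c where c: "realizes K B 0 (\<lambda>s. of_bool (P s)) (\<lambda>_. 1) 2 3 c"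
    using f[where \<rho> = "\<lambda>_. 1" and r = 2 and b = 3] by auto
  let ?c = "Seq (mark_tapes (3 + K)) c"
  have "wf_com (3 + K) ?c" using realizes_wf[OF c] by (simp add: wf_mark_tapes)
  then obtain M where M: "wf_tm M" "num_tapes M = 3 + K" and run:
    "\<And>xs B T'. runs ?c (cfg (input_on xs) (\<lambda>_. 0)) B T' \<Longrightarrow>
       halts_within M xs (B + 2) \<and> (accepts_within M xs (B + 2) \<longleftrightarrow> scanned T' 2 \<noteq> 1)"
    using decider[of "3 + K" ?c] by (auto simp del: wf_com.simps)
  \<comment> \<open>Marking takes at most \<open>3 + K + 1\<close> steps and the final test two; the
    certificate adds at most \<open>q\<close> to the size of the state.\<close>
  let ?t = "pcompose B ([:0, 1:] + q) + [:3 + K + 1 + 2:]"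
  have *: "halts_within M [x, u] (poly ?t (length x)) \<and>
      (accepts_within M [x, u] (poly ?t (length x)) \<longleftrightarrow> P (x, u, env0))"
    if u: "length u \<le> poly q (length x)" for x u
  proof -
    let ?W = "\<lambda>i. if 2 \<le> i \<and> i < 3 + K then counter else input_on [x, u] i"
    have r1: "runs (mark_tapes (3 + K)) (cfg (input_on [x, u]) env0) (3 + K + 1) (cfg ?W env0)"
      by (intro runs_mark_tapes blank_above_input) simp
    have "runs c (cfg ?W env0) (poly B (st_size 0 (x, u, \<lambda>i. 0)))
        (cfg ?W (env0(2 := 0 + of_bool (P (x, u, \<lambda>i. 0)))))"
      by (rule realizesD[OF c]) (auto simp: input_on_def)
    then have r2: "runs c (cfg ?W env0) (poly B (length x + poly q (length x)))
        (cfg ?W (env0(2 := of_bool (P (x, u, env0)))))"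
      using u by (auto simp: st_size_def elim!: runs_mono intro!: poly_nat_mono)
    show ?thesis
      using run[OF runs_Seq[OF r1 r2]] by (auto simp: poly_pcompose sym_cfg counter_def add_ac)
  qed
  show ?thesis
    unfolding NP_def mem_Collect_eq
    by (rule exI[of _ M], rule exI[of _ q], rule exI[of _ ?t]) (use M * L in auto)
qed

lemma word_contents_take:
  assumes "i < length y"
  shows "word_contents (take (Suc i) y) = (word_contents (take i y))(int i := if y ! i then 2 else 1)"
  using assms by (auto simp: word_contents_def fun_eq_iff nat_less_iff)

lemma runs_write:
  assumes "p i = k" "i < K"
  shows "runs (Op i (Some a) MoveRight) (cfg W p) 1 (cfg (W(i := (W i)(int k := a))) (p(i := k + 1)))"
proof -
  have "(cfg W p)(i := act (written (Some a) (scanned (cfg W p) i), MoveRight) (cfg W p i)) =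
      cfg (W(i := (W i)(int k := a))) (p(i := k + 1))"
    using assms by (auto simp: cfg_def written_def)
  then show ?thesis using runs_Op[of i "Some a" MoveRight "cfg W p"] by simp
qed

text \<open>The output is never stored before it is printed: each bit is recomputed from the input
  by the program for \<open>P\<close>.\<close>

lemma polytime_I:
  assumes "PF 0 len" "\<And>M v. PF M v \<Longrightarrow> PB M (\<lambda>s. P (v s) s)"
    and f: "\<And>x. f x = map (\<lambda>i. P i (x, [], env0)) [0..<len (x, [], env0)]"
  shows "polytime_computable f"
proof -
  obtain K1 B1 where 1: "depends 0 len" "\<And>s. len s \<le> poly B1 (st_size 0 s)"
    "\<And>\<rho> r b. (\<And>i. i < 0 \<Longrightarrow> 2 \<le> \<rho> i \<and> \<rho> i < b \<and> \<rho> i \<noteq> r) \<Longrightarrow> 2 \<le> r \<Longrightarrow> r < b \<Longrightarrow>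
        \<exists>c. realizes K1 B1 0 len \<rho> r b c"
    using assms(1) by (rule PFE) blast
  define g where "g = (\<lambda>s. of_bool (P ((\<lambda>(x, u, e). e 0) s) s) :: nat)"
  have "PF 1 g" using assms(2)[OF PF_var[of 0 1]] unfolding PB_def g_def by simp
  then obtain K2 B2 where 2: "depends 1 g"
    "\<And>\<rho> r b. (\<And>i. i < 1 \<Longrightarrow> 2 \<le> \<rho> i \<and> \<rho> i < b \<and> \<rho> i \<noteq> r) \<Longrightarrow> 2 \<le> r \<Longrightarrow> r < b \<Longrightarrow>
        \<exists>c. realizes K2 B2 1 g \<rho> r b c"
    by (rule PFE) blast
  have P_env: "P i (x, u, e) = P i (x, u, env0)" for i x u e
  proof -
    have "PB 0 (\<lambda>s. P i s)" using assms(2)[OF PF_const, of 0 i] by simp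
    then have "depends 0 (\<lambda>s. of_bool (P i s))" unfolding PB_def PF_def by blast
    then have "(of_bool (P i (x, u, e)) :: nat) = of_bool (P i (x, u, env0))" by (rule dependsD) simp
    then show ?thesis by (simp only: of_bool_eq_iff)
  qed
  \<comment> \<open>Counter 2 holds the number of bits still to print, counter 3 the index of the
    current bit, which is variable 0 of \<open>g\<close>, and counter 4 its value.\<close>
  obtain c1 where c1: "realizes K1 B1 0 len (\<lambda>_. 3) 2 5 c1"
    using 1(3)[where \<rho> = "\<lambda>_. 3" and r = 2 and b = 5] by auto
  obtain c2 where c2: "realizes K2 B2 1 g (\<lambda>_. 3) 4 5 c2"
    using 2(2)[where \<rho> = "\<lambda>_. 3" and r = 4 and b = 5] by auto
  \<comment> \<open>The output has to be on the last tape: the one above all counters, which stays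
    unmarked.\<close>
  define out where "out = 5 + max K1 K2"
  let ?emit = "IfEq 4 1 (Op out (Some 1) MoveRight) (Seq (Op out (Some 2) MoveRight) (clear 4))"
  let ?body = "Seq c2 (Seq ?emit (Seq (inc 3) (dec 2)))"
  let ?c = "Seq (mark_tapes out) (Seq c1 (UntilEq 2 1 ?body))"
  let ?code = "compile 0 ?c @ [IHalt True]"
  let ?M = "tm_of (out + 1) ?code"
  have wf: "wf_com (out + 1) ?c"
    using realizes_wf[OF c1] realizes_wf[OF c2]
    by (auto simp: out_def intro!: wf_mark_tapes elim!: wf_com_mono)
  have "wf_instr (out + 1) (length ?code) I" if "I \<in> set ?code" for I
    using that wf_instr_compile[OF wf, of 0 "length ?code" I] by auto
  then have M: "wf_tm ?M" by (intro wf_tm_of[where b = True]) auto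
  let ?t = "[:out + 1:] + (B1 + (B1 * (pcompose B2 ([:0, 1:] + B1) + [:11:]) + [:1:])) + [:1:]"
  have "outputs_within ?M [x] (poly ?t (length x)) (f x)" for x
  proof -
    define y where "y = f x"
    let ?n = "len (x, [], env0)"
    have y: "length y = ?n" "\<And>i. i < ?n \<Longrightarrow> y ! i = P i (x, [], env0)" by (auto simp: y_def f)
    have n_le: "?n \<le> poly B1 (length x)" using 1(2)[of "(x, [], env0)"] by (simp add: st_size_def)
    let ?W = "\<lambda>i. \<lambda>j. if 2 \<le> j \<and> j < out then counter else if j = out then word_contents (take i y) else input_on [x] j"
    have "runs (mark_tapes out) (cfg (input_on [x]) env0) (out + 1)
        (cfg (\<lambda>i. if 2 \<le> i \<and> i < out then counter else input_on [x] i) env0)"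
      by (intro runs_mark_tapes blank_above_input) simp
    moreover have "(\<lambda>i. if 2 \<le> i \<and> i < out then counter else input_on [x] i) = ?W 0"
      by (auto simp: fun_eq_iff input_on_def out_def word_contents_Nil)
    ultimately have r1: "runs (mark_tapes out) (cfg (input_on [x]) env0) (out + 1) (cfg (?W 0) env0)" by simp
    have r2: "runs c1 (cfg (?W 0) env0) (poly B1 (length x)) (cfg (?W 0) (env0(2 := ?n)))"
    proof -
      have "runs c1 (cfg (?W 0) env0) (poly B1 (st_size 0 (x, [], \<lambda>i. 0)))
          (cfg (?W 0) (env0(2 := 0 + len (x, [], \<lambda>i. 0))))"
        by (rule realizesD[OF c1]) (auto simp: out_def input_on_def)
      then show ?thesis by (simp add: st_size_def)
    qed
    let ?P = "\<lambda>i. env0(2 := ?n - i, 3 := i, out := i)"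
    let ?b = "poly (pcompose B2 ([:0, 1:] + B1)) (length x)"
    have r3: "runs (UntilEq 2 1 ?body) (cfg (?W 0) (?P 0)) ((\<Sum>i<?n. ?b + (7 + (1 + 1)) + 2) + 1) (cfg (?W ?n) (?P ?n))"
    proof (rule runs_UntilEq[where T = "\<lambda>i. cfg (?W i) (?P i)"])
      have c2_2: "?W i 2 = counter" for i by (auto simp: out_def)
      show "scanned (cfg (?W ?n) (?P ?n)) 2 = 1"
        using sym_counter[of "?W ?n" 2 "?P ?n", OF c2_2] by (simp add: out_def)
      fix i assume i: "i < ?n"
      show "scanned (cfg (?W i) (?P i)) 2 \<noteq> 1"
        using sym_counter[of "?W i" 2 "?P i", OF c2_2] i by (simp add: out_def)
      have Pi: "P i (x, [], \<lambda>k. ?P i 3) = y ! i" using y(2)[OF i] P_env by metis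
      have g: "g (x, [], \<lambda>k. ?P i 3) = of_bool (y ! i)" using Pi by (simp add: g_def out_def)
      have "runs c2 (cfg (?W i) (?P i)) (poly B2 (st_size 1 (x, [], \<lambda>k. ?P i 3)))
          (cfg (?W i) ((?P i)(4 := ?P i 4 + g (x, [], \<lambda>k. ?P i 3))))"
        by (rule realizesD[OF c2]) (auto simp: out_def input_on_def)
      moreover have "poly B2 (st_size 1 (x, [], \<lambda>k. ?P i 3)) \<le> ?b"
        using i n_le by (auto simp: st_size_def poly_pcompose out_def intro!: poly_nat_mono)
      ultimately have b1: "runs c2 (cfg (?W i) (?P i)) ?b (cfg (?W i) ((?P i)(4 := of_bool (y ! i))))"
        unfolding g by (auto simp: out_def elim!: runs_mono)
      let ?Q = "(?P i)(out := i + 1)"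
      have W: "(?W i)(out := (?W i out)(int i := if y ! i then 2 else 1)) = ?W (Suc i)"
        using word_contents_take[of i y] i y(1) by (auto simp: fun_eq_iff)
      have b2: "runs ?emit (cfg (?W i) ((?P i)(4 := of_bool (y ! i)))) 7 (cfg (?W (Suc i)) ?Q)"
      proof (cases "y ! i")
        case True
        let ?R = "((?P i)(4 := 1))(out := i + 1)"
        have w: "runs (Op out (Some 2) MoveRight) (cfg (?W i) ((?P i)(4 := 1))) 1 (cfg (?W (Suc i)) ?R)"
          using runs_write[of "(?P i)(4 := 1)" out i "out + 1" 2 "?W i"] W True by (simp add: out_def)
        have "runs (clear 4) (cfg (?W (Suc i)) ?R) (3 * ?R 4 + 1) (cfg (?W (Suc i)) (?R(4 := 0)))"
          by (rule runs_clear) (auto simp: out_def)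
        moreover have "?R(4 := 0) = ?Q" "?R 4 = 1" by (auto simp: out_def)
        ultimately have "runs (clear 4) (cfg (?W (Suc i)) ?R) 4 (cfg (?W (Suc i)) ?Q)" by simp
        from runs_Seq[OF w this]
        have "runs ?emit (cfg (?W i) ((?P i)(4 := 1))) (1 + 4 + 2) (cfg (?W (Suc i)) ?Q)"
          by (rule runs_IfF[rotated]) (auto simp: sym_cfg out_def counter_def)
        then show ?thesis using True by simp
      next
        case False
        have e: "(?P i)(4 := 0) = ?P i" by (auto simp: out_def)
        have w: "runs (Op out (Some 1) MoveRight) (cfg (?W i) (?P i)) 1 (cfg (?W (Suc i)) ?Q)"
          using runs_write[of "?P i" out i "out + 1" 1 "?W i"] W False by (simp add: out_def)
        then have "runs ?emit (cfg (?W i) (?P i)) (1 + 2) (cfg (?W (Suc i)) ?Q)"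
          by (rule runs_IfT[rotated]) (auto simp: sym_cfg out_def counter_def)
        then have "runs ?emit (cfg (?W i) (?P i)) 7 (cfg (?W (Suc i)) ?Q)" by (rule runs_mono) simp
        then show ?thesis using False e by simp
      qed
      let ?Q1 = "?Q(3 := ?Q 3 + 1)"
      have "?Q1(2 := ?Q1 2 - 1) = ?P (Suc i)" by (auto simp: out_def)
      moreover have "runs (Seq (inc 3) (dec 2)) (cfg (?W (Suc i)) ?Q) (1 + 1) (cfg (?W (Suc i)) (?Q1(2 := ?Q1 2 - 1)))"
        by (rule runs_Seq[OF runs_inc runs_dec]) (use i in \<open>auto simp: out_def\<close>)
      ultimately have b3: "runs (Seq (inc 3) (dec 2)) (cfg (?W (Suc i)) ?Q) (1 + 1) (cfg (?W (Suc i)) (?P (Suc i)))"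
        by simp
      show "runs ?body (cfg (?W i) (?P i)) (?b + (7 + (1 + 1))) (cfg (?W (Suc i)) (?P (Suc i)))"
        by (rule runs_Seq[OF b1 runs_Seq[OF b2 b3]])
    qed
    have "?P 0 = env0(2 := ?n)" by (auto simp: out_def)
    then have r3': "runs (UntilEq 2 1 ?body) (cfg (?W 0) (env0(2 := ?n))) ((\<Sum>i<?n. ?b + (7 + (1 + 1)) + 2) + 1) (cfg (?W ?n) (?P ?n))"
      using r3 by simp
    have "?n * (?b + 11) \<le> poly B1 (length x) * (?b + 11)" using n_le by (rule mult_right_mono) simp
    then have "(\<Sum>i<?n. ?b + (7 + (1 + 1)) + 2) + 1 \<le> poly (B1 * (pcompose B2 ([:0, 1:] + B1) + [:11:]) + [:1:]) (length x)"
      by (simp add: algebra_simps)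
    from runs_Seq[OF r1 runs_Seq[OF r2 runs_mono[OF r3' this]]]
    have run: "runs ?c (cfg (input_on [x]) env0) (poly ?t (length x) - 1) (cfg (?W ?n) (?P ?n))"
      by (rule runs_mono) simp
    let ?L = "length (compile 0 ?c)"
    let ?T = "cfg (?W ?n) (?P ?n)"
    obtain n where n: "n \<le> poly ?t (length x) - 1" "tm_run ?M [x] n = (Work ?L, map ?T [0..<out + 1])"
      using tm_run_prog[OF run wf, of ?code] by blast
    have "tm_step ?M (Work ?L, map ?T [0..<out + 1]) = (Accept, map ?T [0..<out + 1])"
      by (subst tm_step_IHalt[of _ _ True]) (auto simp: nth_append simp del: compile.simps)
    then have fin: "tm_run ?M [x] (n + 1) = (Accept, map ?T [0..<out + 1])"
      using n(2) unfolding tm_run_def by (simp del: compile.simps)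
    then have "tm_run ?M [x] (poly ?t (length x)) = tm_run ?M [x] (n + 1)"
    proof (intro tm_run_halted)
      have "poly ?t (length x) \<ge> 1" by simp
      then show "n + 1 \<le> poly ?t (length x)" using n(1) by linarith
    qed simp
    moreover have "fst (last (map ?T [0..<out + 1])) = word_contents y"
      using y(1) by (simp add: cfg_def)
    ultimately show ?thesis
      using fin unfolding outputs_within_def halts_within_def y_def by (simp del: compile.simps)
  qed
  then show ?thesis unfolding polytime_computable_def using M by blast
qed

text \<open>The bits read so far are stored in the position within the program, so \<open>A\<close>
  may be any predicate: its finitely many relevant values are built into the leaves.\<close>

fun prefix_tree :: "(bool list \<Rightarrow> bool) \<Rightarrow> nat \<Rightarrow> bool list \<Rightarrow> com" where
  "prefix_tree A 0 w = (if A w then inc 2 else skip)"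
| "prefix_tree A (Suc n) w = IfEq 0 0 (if A w then inc 2 else skip)
    (IfEq 0 1 (Seq (inc 0) (prefix_tree A n (w @ [False]))) (Seq (inc 0) (prefix_tree A n (w @ [True]))))"

lemma runs_prefix_tree:
  assumes "W 0 = word_contents x" "w = take (length w) x" "p 0 = length w" "p 2 = 0" "length w + n = t"
  shows "\<exists>p'. runs (prefix_tree A n w) (cfg W p) (5 * n + 1) (cfg W p') \<and>
    p' 2 = of_bool (A (take t x))"
  using assms(2-)
proof (induction n arbitrary: w p)
  case 0
  have "runs (if A w then inc 2 else skip) (cfg W p) 1 (cfg W (if A w then p(2 := p 2 + 1) else p))"
    using runs_inc runs_skip by simp
  moreover have "(if A w then p(2 := p 2 + 1) else p) 2 = of_bool (A (take t x))" using 0 by (metis (full_types) add_0_right fun_upd_same of_bool_eq(1,2) add_0)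
  ultimately show ?case unfolding prefix_tree.simps by (simp only: mult_0_right add_0) blast
next
  case (Suc n)
  show ?case
  proof (cases "length w < length x")
    case False
    then have w: "w = x" using Suc.prems(1) by (metis not_less take_all)
    have "runs (if A w then inc 2 else skip) (cfg W p) 1 (cfg W (if A w then p(2 := p 2 + 1) else p))"
      using runs_inc runs_skip by simp
    then have "runs (prefix_tree A (Suc n) w) (cfg W p) (1 + 2) (cfg W (if A w then p(2 := p 2 + 1) else p))"
      unfolding prefix_tree.simps
      by (rule runs_IfT[rotated]) (use False Suc.prems(2-) assms(1) in \<open>simp add: sym_cfg word_contents_def\<close>)
    then have "runs (prefix_tree A (Suc n) w) (cfg W p) (5 * Suc n + 1) (cfg W (if A w then p(2 := p 2 + 1) else p))"
      by (rule runs_mono) simp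
    moreover have "(if A w then p(2 := p 2 + 1) else p) 2 = of_bool (A (take t x))"
      using w Suc.prems(2-) by auto
    ultimately show ?thesis by blast
  next
    case True
    let ?b = "x ! length w"
    have scanned: "scanned (cfg W p) 0 = (if ?b then 2 else 1)"
      using Suc.prems(2-) True assms(1) by (simp add: sym_cfg word_contents_def)
    have "w @ [?b] = take (length (w @ [?b])) x"
      using take_Suc_conv_app_nth[OF True] Suc.prems(1) by (metis length_append_singleton)
    from Suc.IH[OF this, of "p(0 := p 0 + 1)"]
    obtain p' where p': "runs (prefix_tree A n (w @ [?b])) (cfg W (p(0 := p 0 + 1))) (5 * n + 1) (cfg W p')"
        "p' 2 = of_bool (A (take t x))"
      using Suc.prems(2-) by (auto simp del: fun_upd_apply simp: fun_upd_same fun_upd_other)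
    have seq: "runs (Seq (inc 0) (prefix_tree A n (w @ [?b]))) (cfg W p) (1 + (5 * n + 1)) (cfg W p')"
      by (rule runs_Seq[OF runs_inc p'(1)])
    have "runs (IfEq 0 1 (Seq (inc 0) (prefix_tree A n (w @ [False]))) (Seq (inc 0) (prefix_tree A n (w @ [True]))))
        (cfg W p) (1 + (5 * n + 1) + 2) (cfg W p')"
    proof (cases ?b)
      case b: True
      show ?thesis by (rule runs_IfF) (use scanned b seq in auto)
    next
      case b: False
      show ?thesis by (rule runs_IfT) (use scanned b seq in auto)
    qed
    then have "runs (prefix_tree A (Suc n) w) (cfg W p) (1 + (5 * n + 1) + 2 + 2) (cfg W p')"
      unfolding prefix_tree.simps by (rule runs_IfF[rotated]) (use scanned in auto)
    then have "runs (prefix_tree A (Suc n) w) (cfg W p) (5 * Suc n + 1) (cfg W p')"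
      by (rule runs_mono) simp
    then show ?thesis using p'(2) by blast
  qed
qed

text \<open>Admissible inputs with equal prefixes get equal answers, so it suffices to hard-wire the
  set of prefixes of yes-inputs.\<close>

lemma constant_time_I:
  assumes "\<And>x y. x \<in> Inst \<Longrightarrow> y \<in> Inst \<Longrightarrow> take t x = take t y \<Longrightarrow> x \<in> Yes \<Longrightarrow> y \<in> Yes"
  shows "constant_time_solvable (Inst, Yes)"
proof -
  let ?A = "\<lambda>w. \<exists>y\<in>Inst \<inter> Yes. take t y = w"
  let ?c = "Seq (mark_tapes 3) (prefix_tree ?A t [])"
  have "wf_com 3 (prefix_tree A n w)" for A n w
    by (induction n arbitrary: w) auto
  then have "wf_com 3 ?c" by (simp add: wf_mark_tapes)
  then obtain M where M: "wf_tm M" and run: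
    "\<And>xs B T'. runs ?c (cfg (input_on xs) (\<lambda>_. 0)) B T' \<Longrightarrow>
       halts_within M xs (B + 2) \<and> (accepts_within M xs (B + 2) \<longleftrightarrow> scanned T' 2 \<noteq> 1)"
    by (rule decider) auto
  have "halts_within M [x] (5 * t + 7) \<and> (accepts_within M [x] (5 * t + 7) \<longleftrightarrow> x \<in> Yes)" if x: "x \<in> Inst" for x
  proof -
    let ?W = "\<lambda>i. if 2 \<le> i \<and> i < 3 then counter else input_on [x] i"
    have r1: "runs (mark_tapes 3) (cfg (input_on [x]) env0) (3 + 1) (cfg ?W env0)"
      by (intro runs_mark_tapes blank_above_input) simp
    obtain p' where r2: "runs (prefix_tree ?A t []) (cfg ?W env0) (5 * t + 1) (cfg ?W p')"
      and p': "p' 2 = of_bool (?A (take t x))"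
      using runs_prefix_tree[of ?W x "[]" env0 t t ?A] by (auto simp: input_on_def)
    have "?A (take t x) \<longleftrightarrow> x \<in> Yes" using assms x by auto
    then have "scanned (cfg ?W p') 2 \<noteq> 1 \<longleftrightarrow> x \<in> Yes" using p' by (simp add: sym_cfg counter_def)
    then show ?thesis using run[OF runs_Seq[OF r1 r2]] by (simp add: add_ac)
  qed
  then show ?thesis unfolding constant_time_solvable_def using M by auto
qed

section \<open>Claw-free graphs of small maximum degree\<close>

lemma simple_edge: "simple_graph G \<Longrightarrow> {u, v} \<in> edges G \<Longrightarrow> u \<noteq> v \<and> u \<in> verts G \<and> v \<in> verts G"
  unfolding simple_graph_def by fastforce

lemma claw_free_iff:
  assumes G: "simple_graph G"
  shows "claw_free G \<longleftrightarrow> (\<forall>v a b c. {v, a} \<in> edges G \<longrightarrow> {v, b} \<in> edges G \<longrightarrow> {v, c} \<in> edges G \<longrightarrow>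
    a \<noteq> b \<longrightarrow> a \<noteq> c \<longrightarrow> b \<noteq> c \<longrightarrow> {a, b} \<in> edges G \<or> {a, c} \<in> edges G \<or> {b, c} \<in> edges G)"
    (is "_ \<longleftrightarrow> ?R")
proof
  assume cf: "claw_free G"
  show ?R
  proof (intro allI impI, rule ccontr)
    fix v a b c
    assume e: "{v, a} \<in> edges G" "{v, b} \<in> edges G" "{v, c} \<in> edges G" and d: "a \<noteq> b" "a \<noteq> c" "b \<noteq> c"
      and n: "\<not> ({a, b} \<in> edges G \<or> {a, c} \<in> edges G \<or> {b, c} \<in> edges G)"
    have v: "v \<noteq> a" "v \<noteq> b" "v \<noteq> c" using e simple_edge[OF G] by blast+
    have loop: "{u} \<notin> edges G" for u using simple_edge[OF G, of u u] by auto
    define f where "f = (\<lambda>u. if u = v then 0 else if u = a then 1 else if u = b then 2 else 3 :: nat)"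
    have f: "f v = 0" "f a = 1" "f b = 2" "f c = 3" using v d by (auto simp: f_def)
    have "bij_betw f {v, a, b, c} {0, 1, 2, 3}"
      using f unfolding bij_betw_def inj_on_def by auto
    moreover have "\<forall>u\<in>{v, a, b, c}. \<forall>w\<in>{v, a, b, c}.
        {u, w} \<in> {e \<in> edges G. e \<subseteq> {v, a, b, c}} \<longleftrightarrow> {f u, f w} \<in> edges claw"
      using e n loop f by (simp add: claw_def insert_commute doubleton_eq_iff)
    ultimately have "isomorphic (induced_subgraph G {v, a, b, c}) claw"
      unfolding isomorphic_def induced_subgraph_def by (intro exI[of _ f]) (simp add: claw_def)
    moreover have "{v, a, b, c} \<subseteq> verts G" using e simple_edge[OF G] by blast
    ultimately show False using cf unfolding claw_free_def by blast
  qed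
next
  assume R: ?R
  show "claw_free G"
    unfolding claw_free_def
  proof
    assume "\<exists>S\<subseteq>verts G. isomorphic (induced_subgraph G S) claw"
    then obtain S f where S: "bij_betw f S {0, 1, 2, 3}"
      and f: "\<forall>u\<in>S. \<forall>w\<in>S. {u, w} \<in> {e \<in> edges G. e \<subseteq> S} \<longleftrightarrow> {f u, f w} \<in> edges claw"
      unfolding isomorphic_def induced_subgraph_def by (auto simp: claw_def)
    have im: "f ` S = {0, 1, 2, 3}" using S by (simp add: bij_betw_def)
    obtain v where v: "v \<in> S" "f v = 0" using im by (metis imageE insertI1)
    obtain a where a: "a \<in> S" "f a = 1" using im by (metis imageE insertI1 insertI2)
    obtain b where b: "b \<in> S" "f b = 2" using im by (metis imageE insertI1 insertI2)
    obtain c where c: "c \<in> S" "f c = 3" using im by (metis imageE insertI1 insertI2)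
    note vs = v(1) a(1) b(1) c(1) and fs = v(2) a(2) b(2) c(2)
    have e: "{u, w} \<in> edges G \<longleftrightarrow> {f u, f w} \<in> edges claw" if "u \<in> S" "w \<in> S" for u w
      using f that by blast
    have "{v, a} \<in> edges G" "{v, b} \<in> edges G" "{v, c} \<in> edges G"
      "{a, b} \<notin> edges G" "{a, c} \<notin> edges G" "{b, c} \<notin> edges G" "a \<noteq> b" "a \<noteq> c" "b \<noteq> c"
      using fs vs e by (auto simp: claw_def doubleton_eq_iff)
    then show False using R by blast
  qed
qed

lemma neighbours_subset: "simple_graph G \<Longrightarrow> neighbours G v \<subseteq> verts G"
  unfolding neighbours_def using simple_edge by fast

lemma finite_neighbours: "simple_graph G \<Longrightarrow> finite (neighbours G v)"
  using neighbours_subset finite_subset unfolding simple_graph_def by metis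

lemma neighbours_sym: "w \<in> neighbours G v \<longleftrightarrow> v \<in> neighbours G w"
  by (simp add: neighbours_def insert_commute)

lemma not_self_neighbour: "simple_graph G \<Longrightarrow> v \<notin> neighbours G v"
  using simple_edge[of G v v] by (auto simp: neighbours_def)

lemma degree_le_max_degree:
  "simple_graph G \<Longrightarrow> v \<in> verts G \<Longrightarrow> card (neighbours G v) \<le> max_degree G"
  unfolding max_degree_def simple_graph_def by (intro Max_ge) auto

lemma is_d_cutI:
  assumes "B \<subseteq> verts G" "B \<noteq> {}" "B \<noteq> verts G"
    and "\<And>v. v \<in> B \<Longrightarrow> card (neighbours G v \<inter> (verts G - B)) \<le> d"
    and "\<And>v. v \<in> verts G - B \<Longrightarrow> card (neighbours G v \<inter> B) \<le> d"
  shows "\<exists>M. is_d_cut d G M"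
  unfolding is_d_cut_def
  by (rule exI[of _ "{e \<in> edges G. \<exists>b\<in>B. \<exists>r\<in>verts G - B. e = {b, r}}"], rule conjI, blast,
      rule exI[of _ B], rule exI[of _ "verts G - B"]) (use assms in auto)

lemma is_d_cutE:
  assumes "is_d_cut d G M"
  obtains B where "B \<subseteq> verts G" "B \<noteq> {}" "B \<noteq> verts G"
    "\<And>v. v \<in> B \<Longrightarrow> card (neighbours G v \<inter> (verts G - B)) \<le> d"
    "\<And>v. v \<in> verts G - B \<Longrightarrow> card (neighbours G v \<inter> B) \<le> d"
proof -
  obtain B R where BR: "B \<union> R = verts G" "B \<inter> R = {}" "B \<noteq> {}" "R \<noteq> {}"
    "\<forall>v\<in>B. card (neighbours G v \<inter> R) \<le> d" "\<forall>v\<in>R. card (neighbours G v \<inter> B) \<le> d"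
    using assms unfolding is_d_cut_def by blast
  then have "R = verts G - B" by blast
  then show thesis using that[of B] BR by auto
qed

text \<open>Moving an outside vertex with more than \<open>d\<close> neighbours in \<open>B\<close> into \<open>B\<close> strictly decreases the number
  of edges leaving \<open>B\<close>, since its degree is at most \<open>2d+1\<close>.\<close>

lemma grow_side:
  assumes G: "simple_graph G" and deg: "\<And>v. v \<in> verts G \<Longrightarrow> card (neighbours G v) \<le> 2 * d + 1"
    and "B \<subseteq> verts G" "\<And>v. v \<in> B \<Longrightarrow> card (neighbours G v - B) \<le> d"
  shows "\<exists>C. B \<subseteq> C \<and> C \<subseteq> verts G \<and> card C \<le> card B + (\<Sum>v\<in>B. card (neighbours G v - B)) \<and>
    (\<forall>v\<in>C. card (neighbours G v - C) \<le> d) \<and> (\<forall>v\<in>verts G - C. card (neighbours G v \<inter> C) \<le> d)"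
  using assms(3,4)
proof (induction "\<Sum>v\<in>B. card (neighbours G v - B)" arbitrary: B rule: less_induct)
  case less
  let ?N = "neighbours G"
  have fin: "finite B" using less.prems(1) G finite_subset unfolding simple_graph_def by blast
  show ?case
  proof (cases "\<forall>v\<in>verts G - B. card (?N v \<inter> B) \<le> d")
    case True
    then show ?thesis using less.prems by (intro exI[of _ B]) auto
  next
    case False
    then obtain w where w: "w \<in> verts G" "w \<notin> B" "card (?N w \<inter> B) \<ge> d + 1" by fastforce
    let ?B = "insert w B"
    have "card (?N w) = card (?N w \<inter> B) + card (?N w - B)"
      using card_Un_disjoint[of "?N w \<inter> B" "?N w - B"] finite_neighbours[OF G]
      by (metis Diff_disjoint Int_Diff Int_Diff_Un finite_Diff finite_Int inf_assoc inf_bot_right)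
    then have wd: "card (?N w - B) \<le> d" using deg[OF w(1)] w(3) by simp
    have wB: "?N w - ?B = ?N w - B" using not_self_neighbour[OF G] by blast
    \<comment> \<open>Absorbing \<open>w\<close> removes one boundary edge from each neighbour of
      \<open>w\<close> in \<open>B\<close>, at least \<open>d + 1\<close> in total, and creates at
      most \<open>d\<close> new ones.\<close>
    have step: "card (?N v - ?B) + of_bool (v \<in> ?N w) = card (?N v - B)" for v
    proof (cases "v \<in> ?N w")
      case True
      then have "w \<in> ?N v - B" using neighbours_sym w(2) by fast
      moreover have "?N v - ?B = (?N v - B) - {w}" by blast
      ultimately show ?thesis using True finite_neighbours[OF G, of v]
        by (metis Suc_eq_plus1 card_Suc_Diff1 finite_Diff of_bool_eq(2))
    next
      case False
      then have "?N v - ?B = ?N v - B" using neighbours_sym by fast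
      then show ?thesis using False by simp
    qed
    have "(\<Sum>v\<in>B. card (?N v - ?B)) + (\<Sum>v\<in>B. of_bool (v \<in> ?N w)) = (\<Sum>v\<in>B. card (?N v - B))"
      unfolding sum.distrib[symmetric] using step by simp
    moreover have "(\<Sum>v\<in>B. of_bool (v \<in> ?N w) :: nat) = card (?N w \<inter> B)"
      using fin by (simp add: Int_def conj_commute)
    ultimately have dec: "(\<Sum>v\<in>?B. card (?N v - ?B)) < (\<Sum>v\<in>B. card (?N v - B))"
      using w(2,3) fin wd wB by simp
    have "card (?N v - ?B) \<le> d" if "v \<in> ?B" for v
      using that step[of v] less.prems(2)[of v] wd wB by fastforce
    then obtain C where C: "?B \<subseteq> C" "C \<subseteq> verts G" "card C \<le> card ?B + (\<Sum>v\<in>?B. card (?N v - ?B))"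
      "\<forall>v\<in>C. card (?N v - C) \<le> d" "\<forall>v\<in>verts G - C. card (?N v \<inter> C) \<le> d"
      using less.hyps[OF dec] less.prems(1) w(1) by blast
    \<comment> \<open>Each absorbed vertex is paid for by at least one lost boundary edge.\<close>
    have "card C \<le> card B + (\<Sum>v\<in>B. card (?N v - B))"
      using C(3) dec w(2) fin by simp
    then show ?thesis using C by (intro exI[of _ C]) auto
  qed
qed

lemma closed_start:
  assumes G: "simple_graph G" and deg: "\<And>v. v \<in> verts G \<Longrightarrow> card (neighbours G v) \<le> 2 * d + 1"
    and cf: "claw_free G" and v: "v \<in> verts G"
  shows "\<exists>B. B \<noteq> {} \<and> B \<subseteq> verts G \<and> card B \<le> 2 * d + 2 \<and> (\<forall>v\<in>B. card (neighbours G v - B) \<le> d)"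
proof -
  let ?N = "neighbours G"
  let ?B = "insert v (?N v)"
  have sub: "?N u \<subseteq> verts G" and fin: "finite (?N u)" for u
    using neighbours_subset[OF G] finite_neighbours[OF G] by auto
  show ?thesis
  proof (cases "\<forall>u\<in>?N v. card (?N u - ?B) \<le> d")
    case True
    moreover have "?N v - ?B = {}" by blast
    moreover have "card ?B \<le> 2 * d + 2" using deg[OF v] card_insert_le_m1[of "2 * d + 2" "?N v" v] by simp
    ultimately show ?thesis using sub v by (intro exI[of _ ?B]) auto
  next
    case False
    then obtain u where u: "u \<in> ?N v" "card (?N u - ?B) \<ge> d + 1" by fastforce
    let ?K = "insert u (?N u - ?B)"
    have uV: "u \<in> verts G" using u(1) sub by blast
    have clique: "b \<in> ?N a" if a: "a \<in> ?K" and b: "b \<in> ?K" and ab: "a \<noteq> b" for a b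
    proof -
      have "b \<in> ?N a" if a: "a \<in> ?N u - ?B" and b: "b \<in> ?N u - ?B"
      proof -
        \<comment> \<open>Centre \<open>u\<close> with leaves \<open>v\<close>, \<open>a\<close>,
          \<open>b\<close> would be a claw unless \<open>a\<close> and \<open>b\<close> are
          adjacent.\<close>
        have "{u, v} \<in> edges G" "{u, a} \<in> edges G" "{u, b} \<in> edges G" "v \<noteq> a" "v \<noteq> b"
          "{v, a} \<notin> edges G" "{v, b} \<notin> edges G"
          using u a b by (auto simp: neighbours_def insert_commute)
        then show ?thesis using cf ab unfolding claw_free_iff[OF G] neighbours_def by blast
      qed
      then show ?thesis using a b ab neighbours_sym by (metis DiffD1 insert_iff)
    qed
    have "u \<notin> ?N u" using not_self_neighbour[OF G] .
    then have cK: "card ?K = Suc (card (?N u - ?B))" using fin by simp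
    have "card (?N k - ?K) \<le> d" if k: "k \<in> ?K" for k
    proof -
      have "?K - {k} \<subseteq> ?N k" using clique k by blast
      then have "card (?N k - (?K - {k})) = card (?N k) - card (?K - {k})"
        by (intro card_Diff_subset) (use fin in auto)
      moreover have "card (?K - {k}) \<ge> d + 1" using cK u(2) k fin by simp
      moreover have "?N k - ?K \<subseteq> ?N k - (?K - {k})" by blast
      then have "card (?N k - ?K) \<le> card (?N k - (?K - {k}))" using fin by (intro card_mono) auto
      moreover have "k \<in> verts G" using k sub uV by blast
      ultimately show ?thesis using deg[of k] by simp
    qed
    moreover have "card ?K \<le> 2 * d + 2"
      using cK card_mono[of "?N u" "?N u - ?B"] fin deg[OF uV] by fastforce
    ultimately show ?thesis using sub uV by (intro exI[of _ ?K]) auto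
  qed
qed

text \<open>The product \<open>(2 * d + 2) * (d + 1)\<close> bounds the grown side: it starts with
  at most \<open>2 * d + 2\<close> vertices having at most \<open>d\<close> boundary edges each, and
  gains at most one vertex per such edge. A larger graph leaves the other side non-empty.\<close>

lemma large_claw_free_d_cut:
  assumes G: "simple_graph G" and cf: "claw_free G" and deg: "max_degree G \<le> 2 * d + 1"
    and large: "card (verts G) > (2 * d + 2) * (d + 1)"
  shows "\<exists>M. is_d_cut d G M"
proof -
  have deg': "\<And>v. v \<in> verts G \<Longrightarrow> card (neighbours G v) \<le> 2 * d + 1"
    using degree_le_max_degree[OF G] deg le_trans by blast
  obtain v where v: "v \<in> verts G" using large by fastforce
  from closed_start[OF G _ cf v] deg'
  obtain B where B: "B \<noteq> {}" "B \<subseteq> verts G" "card B \<le> 2 * d + 2" "\<forall>v\<in>B. card (neighbours G v - B) \<le> d"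
    by (metis (no_types, lifting))
  from grow_side[OF G _ B(2) bspec[OF B(4)]] deg'
  obtain C where C: "B \<subseteq> C" "C \<subseteq> verts G" "card C \<le> card B + (\<Sum>v\<in>B. card (neighbours G v - B))"
    "\<forall>v\<in>C. card (neighbours G v - C) \<le> d" "\<forall>v\<in>verts G - C. card (neighbours G v \<inter> C) \<le> d"
    by (metis (no_types, lifting))
  have "(\<Sum>v\<in>B. card (neighbours G v - B)) \<le> card B * d"
    using sum_bounded_above[of B "\<lambda>v. card (neighbours G v - B)" d] B(4) by simp
  then have "card C \<le> card B * (d + 1)" using C(3) by simp
  also have "\<dots> \<le> (2 * d + 2) * (d + 1)" using B(3) by (rule mult_right_mono) simp
  finally have "C \<noteq> verts G" using large by auto
  moreover have "neighbours G v \<inter> (verts G - C) = neighbours G v - C" for v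
    using neighbours_subset[OF G] by blast
  ultimately show ?thesis using C B(1) by (intro is_d_cutI[of C]) auto
qed

lemma length_concat_same: "(\<And>xs. xs \<in> set xss \<Longrightarrow> length xs = n) \<Longrightarrow> length (concat xss) = length xss * n"
  by (induction xss) auto

lemma length_encode_graph: "length (encode_graph G) = card (verts G) + 1 + card (verts G) * card (verts G)"
proof -
  have "length (concat (map (\<lambda>i. map (\<lambda>j. {i, j} \<in> edges G) [0..<card (verts G)]) [0..<card (verts G)])) =
      card (verts G) * card (verts G)"
    by (subst length_concat_same[where n = "card (verts G)"]) auto
  then show ?thesis unfolding encode_graph_def Let_def by simp
qed

lemma constant_time_small_degree:
  "constant_time_solvable (d_Cut d (\<lambda>G. claw_free G \<and> max_degree G \<le> 2 * d + 1))"
proof -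
  let ?In = "d_Cut_inputs (\<lambda>G. claw_free G \<and> max_degree G \<le> 2 * d + 1)"
  let ?n = "(2 * d + 2) * (d + 1)"
  \<comment> \<open>One more than the code length of a graph with \<open>?n\<close> vertices, so
    that equal prefixes also show where the code of a small graph ends. Larger graphs are yes-inputs
    anyway.\<close>
  let ?t = "?n + 2 + ?n * ?n"
  show ?thesis
    unfolding d_Cut_def
  proof (rule constant_time_I[where t = ?t])
    fix x y
    assume x: "x \<in> encode_graph ` ?In" and y: "y \<in> encode_graph ` ?In" and eq: "take ?t x = take ?t y"
      and yes: "x \<in> encode_graph ` {G \<in> ?In. \<exists>M. is_d_cut d G M}"
    obtain H where H: "H \<in> ?In" "y = encode_graph H" using y by blast
    show "y \<in> encode_graph ` {G \<in> ?In. \<exists>M. is_d_cut d G M}"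
    proof (cases "card (verts H) > ?n")
      case True
      then have "\<exists>M. is_d_cut d H M" using H(1) by (intro large_claw_free_d_cut) (auto simp: d_Cut_inputs_def)
      then show ?thesis using H by blast
    next
      case False
      then have "card (verts H) * card (verts H) \<le> ?n * ?n" by (intro mult_mono) auto
      then have "length y < ?t" using False unfolding H(2) length_encode_graph by linarith
      then have "take ?t y = y" by simp
      then have "take ?t x = y" using eq by simp
      then have "min (length x) ?t = length y" by (metis length_take)
      then have "length x \<le> ?t" using \<open>length y < ?t\<close> by linarith
      then have "x = y" using \<open>take ?t x = y\<close> by simp
      then show ?thesis using yes by simp
    qed
  qed
qed

section \<open>Graphs given by a relation\<close>

definition draw :: "'v set \<Rightarrow> ('v \<Rightarrow> 'v \<Rightarrow> bool) \<Rightarrow> ('v \<Rightarrow> nat) \<Rightarrow> nat ugraph" where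
  "draw V A enc = \<lparr>verts = enc ` V, edges = {{enc a, enc b} | a b. a \<in> V \<and> b \<in> V \<and> A a b}\<rparr>"

locale drawing =
  fixes V :: "'v set" and A :: "'v \<Rightarrow> 'v \<Rightarrow> bool" and enc :: "'v \<Rightarrow> nat"
  assumes fin: "finite V" and sym: "A a b \<Longrightarrow> A b a" and irr: "\<not> A a a" and inj: "inj_on enc V"
begin

abbreviation "G \<equiv> draw V A enc"

definition nbrs :: "'v \<Rightarrow> 'v set" where
  "nbrs a = {b \<in> V. A a b}"

lemma finite_nbrs: "finite (nbrs a)"
  using fin by (simp add: nbrs_def)

lemma verts_G: "verts G = enc ` V"
  by (simp add: draw_def)

lemma edge_G: "a \<in> V \<Longrightarrow> b \<in> V \<Longrightarrow> {enc a, enc b} \<in> edges G \<longleftrightarrow> A a b"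
  using sym inj unfolding draw_def by (auto simp: doubleton_eq_iff inj_on_eq_iff)

lemma simple_G: "simple_graph G"
proof -
  have "card {enc a, enc b} = 2" if "a \<in> V" "b \<in> V" "A a b" for a b
  proof -
    have "a \<noteq> b" using that irr by blast
    then have "enc a \<noteq> enc b" using that inj by (simp add: inj_on_eq_iff)
    then show ?thesis by simp
  qed
  then show ?thesis unfolding simple_graph_def draw_def using fin by auto
qed

lemma edge_GE:
  assumes "{u, w} \<in> edges G"
  obtains a b where "u = enc a" "w = enc b" "a \<in> V" "b \<in> V" "A a b"
  using assms sym unfolding draw_def by (auto simp: doubleton_eq_iff)

lemma neighbours_G: "a \<in> V \<Longrightarrow> neighbours G (enc a) = enc ` nbrs a"
proof (intro set_eqI iffI)
  fix w assume a: "a \<in> V" and "w \<in> neighbours G (enc a)"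
  then have "{enc a, w} \<in> edges G" by (simp add: neighbours_def)
  then obtain a' b where "enc a = enc a'" "w = enc b" "a' \<in> V" "b \<in> V" "A a' b" by (rule edge_GE)
  then show "w \<in> enc ` nbrs a" using a inj by (auto simp: nbrs_def inj_on_eq_iff)
next
  fix w assume "a \<in> V" "w \<in> enc ` nbrs a"
  then show "w \<in> neighbours G (enc a)" using edge_G by (auto simp: nbrs_def neighbours_def)
qed

lemma card_nbrs_inter: "a \<in> V \<Longrightarrow> S \<subseteq> V \<Longrightarrow> card (neighbours G (enc a) \<inter> enc ` S) = card (nbrs a \<inter> S)"
proof -
  assume a: "a \<in> V" and S: "S \<subseteq> V"
  have "nbrs a \<subseteq> V" by (auto simp: nbrs_def)
  then have "neighbours G (enc a) \<inter> enc ` S = enc ` (nbrs a \<inter> S)"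
    unfolding neighbours_G[OF a] using inj S by (simp add: inj_on_image_Int)
  moreover have "inj_on enc (nbrs a \<inter> S)" by (rule inj_on_subset[OF inj]) (use S in auto)
  ultimately show ?thesis by (simp add: card_image)
qed

lemma max_degree_G:
  assumes "V \<noteq> {}" "\<And>a. a \<in> V \<Longrightarrow> card (nbrs a) \<le> k" "a \<in> V" "card (nbrs a) = k"
  shows "max_degree G = k"
proof -
  have card: "card (neighbours G (enc a)) = card (nbrs a)" if "a \<in> V" for a
  proof -
    have "inj_on enc (nbrs a)" by (rule inj_on_subset[OF inj]) (auto simp: nbrs_def)
    then show ?thesis unfolding neighbours_G[OF that] by (rule card_image)
  qed
  show ?thesis
    unfolding max_degree_def verts_G using fin assms card
    by (intro Max_eqI) (auto intro!: image_eqI[of _ _ "enc a"])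
qed

text \<open>Two of any three neighbours fall into the same one of the two cliques.\<close>

lemma claw_free_G:
  assumes "\<And>a. a \<in> V \<Longrightarrow> \<exists>Q1 Q2. nbrs a \<subseteq> Q1 \<union> Q2 \<and>
    (\<forall>b\<in>Q1 \<inter> V. \<forall>c\<in>Q1 \<inter> V. b \<noteq> c \<longrightarrow> A b c) \<and> (\<forall>b\<in>Q2 \<inter> V. \<forall>c\<in>Q2 \<inter> V. b \<noteq> c \<longrightarrow> A b c)"
  shows "claw_free G"
  unfolding claw_free_iff[OF simple_G]
proof (intro allI impI)
  fix v' a' b' c'
  assume e: "{v', a'} \<in> edges G" "{v', b'} \<in> edges G" "{v', c'} \<in> edges G" and d: "a' \<noteq> b'" "a' \<noteq> c'" "b' \<noteq> c'"
  obtain v a where va: "v' = enc v" "a' = enc a" "v \<in> V" "a \<in> V" "A v a" using e(1) by (rule edge_GE)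
  have "enc v \<in> verts G" using va by (simp add: verts_G)
  obtain b where b: "b' = enc b" "b \<in> V" "A v b"
    using e(2) va inj by (metis edge_GE inj_onD)
  obtain c where c: "c' = enc c" "c \<in> V" "A v c"
    using e(3) va inj by (metis edge_GE inj_onD)
  obtain Q1 Q2 where Q: "nbrs v \<subseteq> Q1 \<union> Q2" "\<forall>b\<in>Q1 \<inter> V. \<forall>c\<in>Q1 \<inter> V. b \<noteq> c \<longrightarrow> A b c"
    "\<forall>b\<in>Q2 \<inter> V. \<forall>c\<in>Q2 \<inter> V. b \<noteq> c \<longrightarrow> A b c"
    using assms[OF va(3)] by blast
  have ne: "a \<noteq> b" "a \<noteq> c" "b \<noteq> c" using d va b c by auto
  have "a \<in> Q1 \<union> Q2" "b \<in> Q1 \<union> Q2" "c \<in> Q1 \<union> Q2" using Q(1) va b c by (auto simp: nbrs_def)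
  then have "A a b \<or> A a c \<or> A b c" using Q(2,3) ne va b c by (metis IntI UnE)
  then show "{a', b'} \<in> edges G \<or> {a', c'} \<in> edges G \<or> {b', c'} \<in> edges G"
    using va b c edge_G by blast
qed

definition reach :: "('v \<times> 'v) set" where
  "reach = {(a, b). a \<in> V \<and> b \<in> V \<and> A a b}\<^sup>*"

lemma reach_edge: "a \<in> V \<Longrightarrow> b \<in> V \<Longrightarrow> A a b \<Longrightarrow> (a, b) \<in> reach"
  unfolding reach_def by blast

lemma reach_trans: "(a, b) \<in> reach \<Longrightarrow> (b, c) \<in> reach \<Longrightarrow> (a, c) \<in> reach"
  unfolding reach_def by (rule rtrancl_trans)

lemma reach_refl: "(a, a) \<in> reach"
  unfolding reach_def by blast

lemma reach_sym: "(a, b) \<in> reach \<Longrightarrow> (b, a) \<in> reach"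
  unfolding reach_def by (rule symD[OF sym_rtrancl]) (auto simp: Relation.sym_def intro: sym)

lemma connected_G:
  assumes "r \<in> V" "\<And>a. a \<in> V \<Longrightarrow> (a, r) \<in> reach"
  shows "connected_graph G"
proof -
  have "(enc a, enc b) \<in> {(x, y). {x, y} \<in> edges G}\<^sup>*" if "(a, b) \<in> reach" for a b
    using that unfolding reach_def
  proof (induction rule: rtrancl_induct)
    case (step y z)
    then show ?case using edge_G by (metis (no_types, lifting) case_prodD case_prodI mem_Collect_eq rtrancl.rtrancl_into_rtrancl)
  qed simp
  then show ?thesis
    unfolding connected_graph_def verts_G using assms reach_trans[OF _ reach_sym] by blast
qed

definition balanced :: "nat \<Rightarrow> ('v \<Rightarrow> bool) \<Rightarrow> bool" where
  "balanced d col \<longleftrightarrow> (\<forall>a\<in>V. card {b \<in> nbrs a. col b \<noteq> col a} \<le> d) \<and> (\<exists>a\<in>V. \<exists>b\<in>V. col a \<noteq> col b)"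

lemma d_cut_iff: "(\<exists>M. is_d_cut d G M) \<longleftrightarrow> (\<exists>col. balanced d col)"
proof
  assume "\<exists>M. is_d_cut d G M"
  then obtain B where B: "B \<subseteq> verts G" "B \<noteq> {}" "B \<noteq> verts G"
    "\<And>v. v \<in> B \<Longrightarrow> card (neighbours G v \<inter> (verts G - B)) \<le> d"
    "\<And>v. v \<in> verts G - B \<Longrightarrow> card (neighbours G v \<inter> B) \<le> d"
    using is_d_cutE by metis
  let ?col = "\<lambda>a. enc a \<in> B"
  have "card {b \<in> nbrs a. ?col b \<noteq> ?col a} \<le> d" if a: "a \<in> V" for a
  proof (cases "enc a \<in> B")
    case True
    have "verts G - B = enc ` {b \<in> V. enc b \<notin> B}" by (auto simp: verts_G)
    moreover have "{b \<in> nbrs a. ?col b \<noteq> ?col a} = nbrs a \<inter> {b \<in> V. enc b \<notin> B}"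
      using True by (auto simp: nbrs_def)
    ultimately show ?thesis using card_nbrs_inter[OF a, of "{b \<in> V. enc b \<notin> B}"] B(4)[OF True] by auto
  next
    case False
    have "B = enc ` {b \<in> V. enc b \<in> B}" using B(1) by (auto simp: verts_G)
    moreover have "{b \<in> nbrs a. ?col b \<noteq> ?col a} = nbrs a \<inter> {b \<in> V. enc b \<in> B}"
      using False by (auto simp: nbrs_def)
    ultimately show ?thesis
      using card_nbrs_inter[OF a, of "{b \<in> V. enc b \<in> B}"] B(5)[of "enc a"] False a by (auto simp: verts_G)
  qed
  moreover have "\<exists>a\<in>V. \<exists>b\<in>V. ?col a \<noteq> ?col b" using B(1-3) by (auto simp: verts_G)
  ultimately have "balanced d ?col" unfolding balanced_def by (intro conjI ballI)
  then show "\<exists>col. balanced d col" by (rule exI[of _ ?col])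
next
  assume "\<exists>col. balanced d col"
  then obtain col where "balanced d col" by blast
  then have col: "\<And>a. a \<in> V \<Longrightarrow> card {b \<in> nbrs a. col b \<noteq> col a} \<le> d"
    and nc: "\<exists>a\<in>V. \<exists>b\<in>V. col a \<noteq> col b" by (simp_all add: balanced_def)
  let ?B = "enc ` {a \<in> V. col a}"
  have compl: "verts G - ?B = enc ` {a \<in> V. \<not> col a}"
    using inj by (auto simp: verts_G inj_on_eq_iff)
  show "\<exists>M. is_d_cut d G M"
  proof (rule is_d_cutI[of ?B])
    show "?B \<subseteq> verts G" by (auto simp: verts_G)
    show "?B \<noteq> {}" using nc by auto
    show "?B \<noteq> verts G" using nc compl by blast
  next
    fix v assume "v \<in> ?B"
    then obtain a where a: "a \<in> V" "col a" "v = enc a" by blast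
    have "{b \<in> nbrs a. col b \<noteq> col a} = nbrs a \<inter> {a \<in> V. \<not> col a}" using a by (auto simp: nbrs_def)
    then show "card (neighbours G v \<inter> (verts G - ?B)) \<le> d"
      using col[OF a(1)] card_nbrs_inter[OF a(1), of "{a \<in> V. \<not> col a}"] a compl by auto
  next
    fix v assume "v \<in> verts G - ?B"
    then obtain a where a: "a \<in> V" "\<not> col a" "v = enc a" using compl by blast
    have "{b \<in> nbrs a. col b \<noteq> col a} = nbrs a \<inter> {a \<in> V. col a}" using a by (auto simp: nbrs_def)
    then show "card (neighbours G v \<inter> ?B) \<le> d"
      using col[OF a(1)] card_nbrs_inter[OF a(1), of "{a \<in> V. col a}"] a by auto
  qed
qed

text \<open>If \<open>a\<close> and \<open>b\<close> differ in colour, every member of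
  \<open>Q\<close> disagrees with one of them, and each of them tolerates only \<open>d\<close>
  disagreements.\<close>

lemma balanced_clique:
  assumes "balanced d col" "Q \<subseteq> V" "\<And>a b. a \<in> Q \<Longrightarrow> b \<in> Q \<Longrightarrow> a \<noteq> b \<Longrightarrow> A a b" "card Q > 2 * d"
    and a: "a \<in> Q" and b: "b \<in> Q"
  shows "col a = col b"
proof (rule ccontr)
  assume ne: "col a \<noteq> col b"
  let ?o = "\<lambda>a. {b \<in> nbrs a. col b \<noteq> col a}"
  have "Q \<subseteq> ?o a \<union> ?o b"
  proof
    fix c assume c: "c \<in> Q"
    then have "c \<in> V" using assms(2) by blast
    moreover have "A a c" if "col c \<noteq> col a" using assms(3)[OF a c] that by metis
    moreover have "A b c" if "col c \<noteq> col b" using assms(3)[OF b c] that by metis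
    ultimately show "c \<in> ?o a \<union> ?o b" using ne by (cases "col c = col a") (auto simp: nbrs_def)
  qed
  then have "card Q \<le> card (?o a) + card (?o b)"
    using card_mono[of "?o a \<union> ?o b" Q] card_Un_le[of "?o a" "?o b"] finite_nbrs by (simp add: finite_subset)
  moreover have "card (?o a) \<le> d" "card (?o b) \<le> d"
    using assms(1,2) a b unfolding balanced_def by blast+
  ultimately show False using assms(4) by simp
qed

lemma balanced_majority:
  assumes "balanced d col" "a \<in> V" "S \<subseteq> nbrs a" "card S > d" "\<And>b. b \<in> S \<Longrightarrow> col b = k"
  shows "col a = k"
proof (rule ccontr)
  assume "col a \<noteq> k"
  then have "S \<subseteq> {b \<in> nbrs a. col b \<noteq> col a}" using assms(3,5) by auto
  then have "card S \<le> card {b \<in> nbrs a. col b \<noteq> col a}" by (intro card_mono) (auto simp: finite_nbrs)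
  then show False using assms(1,2,4) unfolding balanced_def by fastforce
qed

end

section \<open>The gadget graph of a gate system\<close>

datatype vtx = Sl nat nat | Gt nat

text \<open>Gate \<open>g\<close> constrains the colours of its variables: if \<open>vx g\<close> and \<open>vy g\<close> differ, then \<open>vp g\<close> differs
  from \<open>vb g\<close>.  Its \<open>2d+1\<close> slots hold \<open>vx, vy\<close>, then \<open>d-1\<close> times \<open>vb\<close>, then \<open>d\<close> times \<open>vp\<close>.  A slot consists of
  a monochromatic clique of size \<open>2d+2\<close>, whose lower half \<open>0..d\<close> also determines the colours of a link vertex
  (number \<open>2d+2\<close>) and of a literal vertex (number \<open>2d+3\<close>).  The link vertex is joined to the upper half of the
  next slot with the same variable; the literals of the first \<open>d+1\<close> slots and those of the last \<open>d\<close> slots of a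
  gate form cliques, both completely joined to the vertex \<open>Gt g\<close>.\<close>

locale gadget =
  fixes d m :: nat and vx vy vb vp :: "nat \<Rightarrow> nat" and T F :: nat
  assumes d2: "d \<ge> 2" and m1: "m \<ge> 1"
    and vb: "g < m \<Longrightarrow> vb g \<in> {T, F}"
    and cover: "g < m \<Longrightarrow> v \<in> {vx g, vy g, vb g, vp g} \<Longrightarrow>
      \<exists>h<m. vx h = v \<and> vy h = T \<and> vb h = T \<and> vp h = F"
begin

definition D :: nat where "D = 2 * d + 1"
definition R :: nat where "R = 2 * d + 4"

definition slots :: nat where "slots = m * D"

definition vr :: "nat \<Rightarrow> nat" where
  "vr \<sigma> = (if \<sigma> mod D = 0 then vx (\<sigma> div D) else if \<sigma> mod D = 1 then vy (\<sigma> div D)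
     else if \<sigma> mod D \<le> d then vb (\<sigma> div D) else vp (\<sigma> div D))"

text \<open>Linking only consecutive occurrences of a variable leaves every slot with at most one
  link in and one link out, which bounds the degree.\<close>

definition nxt :: "nat \<Rightarrow> nat \<Rightarrow> bool" where
  "nxt \<sigma> \<tau> \<longleftrightarrow> \<sigma> < \<tau> \<and> vr \<sigma> = vr \<tau> \<and> \<not> (\<exists>k<\<tau>. \<sigma> < k \<and> vr k = vr \<sigma>)"

text \<open>The disjunct \<open>2 * d + 2 \<le> r\<close> is the edge between the link vertex and
  the literal vertex of a slot. Without it these two and an upper vertex would be the leaves of a
  claw centred at a lower vertex.\<close>

fun half :: "vtx \<Rightarrow> vtx \<Rightarrow> bool" where
  "half (Sl \<sigma> r) (Sl \<tau> q) \<longleftrightarrow>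
     \<sigma> = \<tau> \<and> r < q \<and> (q < 2 * d + 2 \<or> r \<le> d \<or> 2 * d + 2 \<le> r) \<or>
     r = 2 * d + 2 \<and> d < q \<and> q < 2 * d + 2 \<and> nxt \<sigma> \<tau> \<or>
     r = 2 * d + 3 \<and> q = 2 * d + 3 \<and> \<sigma> < \<tau> \<and> \<sigma> div D = \<tau> div D \<and> (\<sigma> mod D \<le> d \<longleftrightarrow> \<tau> mod D \<le> d)"
| "half (Sl \<sigma> r) (Gt g) \<longleftrightarrow> r = 2 * d + 3 \<and> \<sigma> div D = g"
| "half (Gt g) b \<longleftrightarrow> False"

definition adj :: "vtx \<Rightarrow> vtx \<Rightarrow> bool" where
  "adj a b \<longleftrightarrow> half a b \<or> half b a"

definition V :: "vtx set" where
  "V = (\<lambda>(\<sigma>, r). Sl \<sigma> r) ` ({..<slots} \<times> {..<R}) \<union> Gt ` {..<m}"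

fun enc :: "vtx \<Rightarrow> nat" where
  "enc (Sl \<sigma> r) = \<sigma> * R + r"
| "enc (Gt g) = slots * R + g"

lemma Sl_in_V [simp]: "Sl \<sigma> r \<in> V \<longleftrightarrow> \<sigma> < slots \<and> r < R"
  by (auto simp: V_def)

lemma Gt_in_V [simp]: "Gt g \<in> V \<longleftrightarrow> g < m"
  by (auto simp: V_def)

lemma enc_less: "\<sigma> < k \<Longrightarrow> r < R \<Longrightarrow> \<sigma> * R + r < k * R"
proof -
  assume "\<sigma> < k" "r < R"
  then have "\<sigma> * R + r < Suc \<sigma> * R" by simp
  also have "\<dots> \<le> k * R" using \<open>\<sigma> < k\<close> by (intro mult_right_mono) auto
  finally show ?thesis .
qed

lemma inj_enc: "inj_on enc V"
proof (rule inj_onI)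
  fix a b assume ab: "a \<in> V" "b \<in> V" "enc a = enc b"
  show "a = b"
  proof (cases a)
    case a: (Sl \<sigma> r)
    show ?thesis
    proof (cases b)
      case (Sl \<tau> q)
      then have "(\<sigma> * R + r) div R = (\<tau> * R + q) div R" "(\<sigma> * R + r) mod R = (\<tau> * R + q) mod R"
        using ab a by auto
      then show ?thesis using ab a Sl by simp
    next
      case (Gt h)
      then show ?thesis using ab a enc_less[of \<sigma> slots r] by auto
    qed
  next
    case a: (Gt g)
    show ?thesis
    proof (cases b)
      case (Sl \<tau> q)
      then show ?thesis using ab a enc_less[of \<tau> slots q] by auto
    qed (use ab a in auto)
  qed
qed

sublocale drawing V adj enc
proof
  show "finite V" by (simp add: V_def)
  show "adj a b \<Longrightarrow> adj b a" for a b by (auto simp: adj_def)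
  show "\<not> adj a a" for a by (cases a) (auto simp: adj_def nxt_def)
  show "inj_on enc V" by (rule inj_enc)
qed

lemma nxt_unique: "nxt \<sigma> \<tau> \<Longrightarrow> nxt \<sigma> \<tau>' \<Longrightarrow> \<tau> = \<tau>'" "nxt \<sigma> \<tau> \<Longrightarrow> nxt \<sigma>' \<tau> \<Longrightarrow> \<sigma> = \<sigma>'"
  unfolding nxt_def by (metis linorder_neqE_nat)+

text \<open>Stepping to the least later occurrence again and again leads from
  \<open>\<sigma>\<close> to \<open>\<tau>\<close>. The relation \<open>Q\<close> is arbitrary in
  order to serve both reachability and equality of colours.\<close>

lemma nxt_chain:
  assumes "\<And>\<rho>. Q \<rho> \<rho>" "\<And>\<rho> k l. Q \<rho> k \<Longrightarrow> Q k l \<Longrightarrow> Q \<rho> l" "\<And>\<rho> k. nxt \<rho> k \<Longrightarrow> k \<le> \<tau> \<Longrightarrow> Q \<rho> k"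
    and "\<sigma> \<le> \<tau>" "vr \<sigma> = vr \<tau>"
  shows "Q \<sigma> \<tau>"
  using assms(4,5)
proof (induction "\<tau> - \<sigma>" arbitrary: \<sigma> rule: less_induct)
  case less
  show ?case
  proof (cases "\<sigma> = \<tau>")
    case False
    define k where "k = (LEAST k. \<sigma> < k \<and> vr k = vr \<sigma>)"
    have \<tau>: "\<sigma> < \<tau> \<and> vr \<tau> = vr \<sigma>" using less.prems False by simp
    then have k: "\<sigma> < k" "vr k = vr \<sigma>" "k \<le> \<tau>"
      unfolding k_def by (metis (mono_tags, lifting) LeastI, metis (mono_tags, lifting) LeastI, metis (mono_tags, lifting) Least_le)
    have "nxt \<sigma> k" unfolding nxt_def using k not_less_Least[of _ "\<lambda>k. \<sigma> < k \<and> vr k = vr \<sigma>"] unfolding k_def by metis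
    moreover have "Q k \<tau>" using less.hyps[of k] k less.prems by auto
    ultimately show ?thesis using assms(2,3) k(3) by blast
  qed (simp add: assms(1))
qed

lemma D_pos: "0 < D" by (simp add: D_def)

lemma div_mod_slot [simp]: "s < D \<Longrightarrow> (g * D + s) div D = g" "s < D \<Longrightarrow> (g * D + s) mod D = s"
  by auto

lemma slot_less: "g < m \<Longrightarrow> s < D \<Longrightarrow> g * D + s < slots"
proof -
  assume "g < m" "s < D"
  then have "g * D + s < Suc g * D" by simp
  also have "\<dots> \<le> m * D" using \<open>g < m\<close> by (intro mult_right_mono) auto
  finally show ?thesis by (simp add: slots_def)
qed

lemma slot_cases:
  assumes "\<sigma> < slots"
  obtains g s where "\<sigma> = g * D + s" "g < m" "s < D"
  using that[of "\<sigma> div D" "\<sigma> mod D"] assms D_pos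
  by (metis div_mult_mod_eq mod_less_divisor less_mult_imp_div_less slots_def)

lemma vr_slot:
  assumes "s < D"
  shows "vr (g * D + s) = (if s = 0 then vx g else if s = 1 then vy g else if s \<le> d then vb g else vp g)"
  by (simp only: vr_def div_mod_slot[OF assms])

abbreviation lit :: "nat \<Rightarrow> nat \<Rightarrow> vtx" where
  "lit g s \<equiv> Sl (g * D + s) (2 * d + 3)"

lemma adj_Sl_Sl: "adj (Sl \<sigma> r) (Sl \<tau> q) \<longleftrightarrow>
     \<sigma> = \<tau> \<and> r \<noteq> q \<and> (r < 2 * d + 2 \<and> q < 2 * d + 2 \<or> \<not> (d < r \<and> r < 2 * d + 2) \<and> \<not> (d < q \<and> q < 2 * d + 2)) \<or>
     r = 2 * d + 2 \<and> d < q \<and> q < 2 * d + 2 \<and> nxt \<sigma> \<tau> \<or>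
     q = 2 * d + 2 \<and> d < r \<and> r < 2 * d + 2 \<and> nxt \<tau> \<sigma> \<or>
     r = 2 * d + 3 \<and> q = 2 * d + 3 \<and> \<sigma> \<noteq> \<tau> \<and> \<sigma> div D = \<tau> div D \<and> (\<sigma> mod D \<le> d \<longleftrightarrow> \<tau> mod D \<le> d)"
  by (rule linorder_cases[of \<sigma> \<tau>]; rule linorder_cases[of r q]) (auto simp: adj_def nxt_def)

lemma adj_Sl_Gt: "adj (Sl \<sigma> r) (Gt g) \<longleftrightarrow> r = 2 * d + 3 \<and> \<sigma> div D = g"
  "adj (Gt g) (Sl \<sigma> r) \<longleftrightarrow> r = 2 * d + 3 \<and> \<sigma> div D = g" "\<not> adj (Gt g) (Gt h)"
  by (auto simp: adj_def)

lemma adj_lit: "s < D \<Longrightarrow> s' < D \<Longrightarrow> adj (lit g s) (lit g s') \<longleftrightarrow> s \<noteq> s' \<and> (s \<le> d \<longleftrightarrow> s' \<le> d)"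
  by (auto simp: adj_Sl_Sl)

lemma low_less_D: "s \<le> d \<Longrightarrow> s < D"
  by (simp add: D_def)

lemma mem_nbrs: "b \<in> nbrs a \<longleftrightarrow> b \<in> V \<and> adj a b"
  by (simp add: nbrs_def)

lemma nbrs_low: "r \<le> d \<Longrightarrow> \<sigma> < slots \<Longrightarrow> nbrs (Sl \<sigma> r) = Sl \<sigma> ` ({..<R} - {r})"
proof -
  assume r: "r \<le> d" "\<sigma> < slots"
  have "b \<in> nbrs (Sl \<sigma> r) \<longleftrightarrow> b \<in> Sl \<sigma> ` ({..<R} - {r})" for b
    using r by (cases b) (auto simp: mem_nbrs adj_Sl_Sl adj_Sl_Gt)
  then show ?thesis by blast
qed

lemma nbrs_high:
  "d < r \<Longrightarrow> r < 2 * d + 2 \<Longrightarrow> nbrs (Sl \<sigma> r) \<subseteq> Sl \<sigma> ` ({..<2 * d + 2} - {r}) \<union> (\<lambda>\<rho>. Sl \<rho> (2 * d + 2)) ` {\<rho>. nxt \<rho> \<sigma>}"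
proof
  fix b assume "d < r" "r < 2 * d + 2" "b \<in> nbrs (Sl \<sigma> r)"
  then show "b \<in> Sl \<sigma> ` ({..<2 * d + 2} - {r}) \<union> (\<lambda>\<rho>. Sl \<rho> (2 * d + 2)) ` {\<rho>. nxt \<rho> \<sigma>}"
    by (cases b) (auto simp: mem_nbrs adj_Sl_Sl adj_Sl_Gt)
qed

lemma nbrs_link:
  "nbrs (Sl \<sigma> (2 * d + 2)) \<subseteq> Sl \<sigma> ` ({..d} \<union> {2 * d + 3}) \<union> (\<lambda>(\<tau>, q). Sl \<tau> q) ` ({\<tau>. nxt \<sigma> \<tau>} \<times> {d<..<2 * d + 2})"
proof
  fix b assume "b \<in> nbrs (Sl \<sigma> (2 * d + 2))"
  then show "b \<in> Sl \<sigma> ` ({..d} \<union> {2 * d + 3}) \<union> (\<lambda>(\<tau>, q). Sl \<tau> q) ` ({\<tau>. nxt \<sigma> \<tau>} \<times> {d<..<2 * d + 2})"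
    by (cases b) (auto simp: mem_nbrs adj_Sl_Sl adj_Sl_Gt R_def)
qed

lemma nbrs_lit:
  assumes "s < D"
  shows "nbrs (lit g s) \<subseteq> Sl (g * D + s) ` ({..d} \<union> {2 * d + 2}) \<union>
    (lit g ` {s'. s' < D \<and> s' \<noteq> s \<and> (s' \<le> d \<longleftrightarrow> s \<le> d)} \<union> {Gt g})"
proof
  fix b assume b: "b \<in> nbrs (lit g s)"
  show "b \<in> Sl (g * D + s) ` ({..d} \<union> {2 * d + 2}) \<union> (lit g ` {s'. s' < D \<and> s' \<noteq> s \<and> (s' \<le> d \<longleftrightarrow> s \<le> d)} \<union> {Gt g})"
  proof (cases b)
    case (Sl \<tau> q)
    show ?thesis
    proof (cases "\<tau> = g * D + s")
      case True
      then show ?thesis using b Sl assms by (auto simp: mem_nbrs adj_Sl_Sl R_def)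
    next
      case False
      then have *: "q = 2 * d + 3" "\<tau> div D = g" "\<tau> mod D \<le> d \<longleftrightarrow> s \<le> d"
        using b Sl assms by (auto simp: mem_nbrs adj_Sl_Sl)
      then have "\<tau> = g * D + \<tau> mod D" by (metis div_mult_mod_eq)
      then have "b = lit g (\<tau> mod D)" "\<tau> mod D \<noteq> s" "\<tau> mod D < D"
        using Sl *(1) False D_pos by auto
      then show ?thesis using *(3) by auto
    qed
  next
    case (Gt h)
    then show ?thesis using b assms by (auto simp: mem_nbrs adj_Sl_Gt)
  qed
qed

lemma nbrs_Gt: "nbrs (Gt g) \<subseteq> lit g ` {..<D}"
proof
  fix b assume b: "b \<in> nbrs (Gt g)"
  show "b \<in> lit g ` {..<D}"
  proof (cases b)
    case (Sl \<tau> q)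
    then have "q = 2 * d + 3" "\<tau> div D = g" using b by (auto simp: mem_nbrs adj_Sl_Gt)
    then have "b = lit g (\<tau> mod D)" using Sl by (metis div_mult_mod_eq)
    then show ?thesis using D_pos by auto
  qed (use b in \<open>auto simp: mem_nbrs adj_Sl_Gt\<close>)
qed

lemma V_cases:
  assumes "a \<in> V"
  obtains (low) \<sigma> r where "a = Sl \<sigma> r" "\<sigma> < slots" "r \<le> d"
  | (high) \<sigma> r where "a = Sl \<sigma> r" "\<sigma> < slots" "d < r" "r < 2 * d + 2"
  | (link) \<sigma> where "a = Sl \<sigma> (2 * d + 2)" "\<sigma> < slots"
  | (lit) g s where "a = lit g s" "g < m" "s < D"
  | (gate) g where "a = Gt g" "g < m"
proof (cases a)
  case (Sl \<sigma> r)
  then have "r \<le> d \<or> d < r \<and> r < 2 * d + 2 \<or> r = 2 * d + 2 \<or> r = 2 * d + 3"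
    using assms by (auto simp: R_def)
  then show ?thesis
  proof (elim disjE)
    assume "r = 2 * d + 3"
    then show thesis using Sl assms lit slot_cases[of \<sigma>] by auto
  qed (use Sl assms low high link in auto)
next
  case (Gt g)
  then show ?thesis using assms gate by auto
qed

text \<open>The two cliques are: for a lower vertex the core and the link-literal edge; for an upper
  vertex the core and the link vertex of the previous slot; for a link vertex its own side and the
  upper half of the next slot; for a literal its slot and its group with the gate vertex; for a gate
  vertex the two groups of literals.\<close>

lemma claw_free_gadget: "claw_free G"
proof (rule claw_free_G)
  fix a assume "a \<in> V"
  then show "\<exists>Q1 Q2. nbrs a \<subseteq> Q1 \<union> Q2 \<and>
    (\<forall>b\<in>Q1 \<inter> V. \<forall>c\<in>Q1 \<inter> V. b \<noteq> c \<longrightarrow> adj b c) \<and> (\<forall>b\<in>Q2 \<inter> V. \<forall>c\<in>Q2 \<inter> V. b \<noteq> c \<longrightarrow> adj b c)"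
  proof (cases rule: V_cases)
    case (low \<sigma> r)
    have "nbrs a \<subseteq> Sl \<sigma> ` {..<2 * d + 2} \<union> Sl \<sigma> ` {2 * d + 2, 2 * d + 3}"
      unfolding low(1) nbrs_low[OF low(3,2)] by (auto simp: R_def)
    moreover have "\<forall>b\<in>Sl \<sigma> ` {..<2 * d + 2} \<inter> V. \<forall>c\<in>Sl \<sigma> ` {..<2 * d + 2} \<inter> V. b \<noteq> c \<longrightarrow> adj b c"
      "\<forall>b\<in>Sl \<sigma> ` {2 * d + 2, 2 * d + 3} \<inter> V. \<forall>c\<in>Sl \<sigma> ` {2 * d + 2, 2 * d + 3} \<inter> V. b \<noteq> c \<longrightarrow> adj b c"
      by (auto simp: adj_Sl_Sl)
    ultimately show ?thesis by blast
  next
    case (high \<sigma> r)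
    show ?thesis
      unfolding high(1)
      by (intro exI conjI, rule subset_trans[OF nbrs_high[OF high(3,4)] subset_refl])
        (auto simp: adj_Sl_Sl dest: nxt_unique)
  next
    case (link \<sigma>)
    show ?thesis
      unfolding link(1)
      by (intro exI conjI, rule subset_trans[OF nbrs_link subset_refl])
        (auto simp: adj_Sl_Sl dest: nxt_unique)
  next
    case (lit g s)
    show ?thesis
      unfolding lit(1)
      by (intro exI conjI, rule subset_trans[OF nbrs_lit[OF lit(3)] subset_refl])
        (use lit(3) in \<open>auto simp: adj_Sl_Sl adj_Sl_Gt\<close>)
  next
    case (gate g)
    have "nbrs a \<subseteq> lit g ` {..d} \<union> lit g ` {d<..<D}"
      using subset_trans[OF nbrs_Gt[of g], of "lit g ` {..d} \<union> lit g ` {d<..<D}"] gate(1) by fastforce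
    moreover have "\<forall>b\<in>lit g ` {..d} \<inter> V. \<forall>c\<in>lit g ` {..d} \<inter> V. b \<noteq> c \<longrightarrow> adj b c"
      "\<forall>b\<in>lit g ` {d<..<D} \<inter> V. \<forall>c\<in>lit g ` {d<..<D} \<inter> V. b \<noteq> c \<longrightarrow> adj b c"
      by (auto simp: adj_lit low_less_D)
    ultimately show ?thesis by blast
  qed
qed

lemma card_nxt: "card {\<rho>. nxt \<rho> \<sigma>} \<le> 1" "finite {\<rho>. nxt \<rho> \<sigma>}" "card {\<tau>. nxt \<sigma> \<tau>} \<le> 1" "finite {\<tau>. nxt \<sigma> \<tau>}"
proof -
  have *: "card S \<le> 1 \<and> finite S" if "\<And>x y. x \<in> S \<Longrightarrow> y \<in> S \<Longrightarrow> x = y" for S :: "nat set"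
  proof (cases "S = {}")
    case False
    then obtain x where "x \<in> S" by blast
    then have "S = {x}" using that by blast
    then show ?thesis by simp
  qed simp
  show "card {\<rho>. nxt \<rho> \<sigma>} \<le> 1" "finite {\<rho>. nxt \<rho> \<sigma>}"
    using *[of "{\<rho>. nxt \<rho> \<sigma>}"] nxt_unique(2)[of _ \<sigma>] by simp_all
  show "card {\<tau>. nxt \<sigma> \<tau>} \<le> 1" "finite {\<tau>. nxt \<sigma> \<tau>}"
    using *[of "{\<tau>. nxt \<sigma> \<tau>}"] nxt_unique(1)[of \<sigma>] by simp_all
qed

lemma card_two_images:
  assumes "S \<subseteq> f ` X \<union> g ` Y" "finite X" "finite Y" "card X + card Y \<le> k"
  shows "card S \<le> k"
proof -
  have "card S \<le> card (f ` X \<union> g ` Y)" using assms by (intro card_mono) auto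
  also have "\<dots> \<le> card X + card Y"
    by (rule order_trans[OF card_Un_le add_mono]) (auto intro: card_image_le assms)
  finally show ?thesis using assms(4) by simp
qed

text \<open>Core, link and literal give a lower vertex \<open>2 * d + 1 + 2\<close> neighbours. A
  link vertex has \<open>d + 2\<close> in its slot and at most \<open>d + 1\<close> in the next; a
  literal has \<open>d + 2\<close> in its slot, at most \<open>d\<close> other literals and its
  gate. Upper and gate vertices have fewer than \<open>2 * d + 3\<close>.\<close>

lemma degree_le:
  assumes "a \<in> V"
  shows "card (nbrs a) \<le> 2 * d + 3"
  using assms
proof (cases rule: V_cases)
  case (low \<sigma> r)
  have "card (nbrs a) \<le> card ({..<R} - {r})"
    unfolding low(1) nbrs_low[OF low(3,2)] by (rule card_image_le) simp
  then show ?thesis using low(3) by (simp add: R_def)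
next
  case (high \<sigma> r)
  have "card (nbrs (Sl \<sigma> r)) \<le> 2 * d + 3"
    by (rule card_two_images[OF nbrs_high[OF high(3,4)]]) (use high card_nxt(1,2)[of \<sigma>] in auto)
  then show ?thesis using high(1) by simp
next
  case (link \<sigma>)
  have "card ({\<tau>. nxt \<sigma> \<tau>} \<times> {d<..<2 * d + 2}) \<le> 1 * (d + 1)"
    unfolding card_cartesian_product using card_nxt(3)[of \<sigma>] by (intro mult_mono) auto
  moreover have "card ({..d} \<union> {2 * d + 3}) = d + 2" by (subst card_Un_disjoint) auto
  ultimately have "card (nbrs (Sl \<sigma> (2 * d + 2))) \<le> 2 * d + 3"
    by (intro card_two_images[OF nbrs_link]) (use card_nxt(4)[of \<sigma>] in auto)
  then show ?thesis using link(1) by simp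
next
  case (lit g s)
  let ?S = "{s'. s' < D \<and> s' \<noteq> s \<and> (s' \<le> d \<longleftrightarrow> s \<le> d)}"
  have "card ?S \<le> d"
  proof (cases "s \<le> d")
    case True
    then have "?S \<subseteq> {..d} - {s}" by auto
    then show ?thesis using card_mono[of "{..d} - {s}" ?S] True by simp
  next
    case False
    then have "?S \<subseteq> {d<..<D}" by auto
    then show ?thesis using card_mono[of "{d<..<D}" ?S] by (simp add: D_def)
  qed
  moreover have "card (insert (Gt g) (lit g ` ?S)) \<le> Suc (card ?S)"
    using card_image_le[of ?S "lit g"] by (intro order_trans[OF card_insert_le_m1[of "Suc (card ?S)"]]) auto
  moreover have "card ({..d} \<union> {2 * d + 2}) = d + 2" by (subst card_Un_disjoint) auto
  ultimately have "card (nbrs (lit g s)) \<le> 2 * d + 3"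
    by (intro card_two_images[where f = "Sl (g * D + s)" and X = "{..d} \<union> {2 * d + 2}" and g = id and Y = "insert (Gt g) (lit g ` ?S)"])
      (use nbrs_lit[OF lit(3), of g] in auto)
  then show ?thesis using lit(1) by simp
next
  case (gate g)
  have "card (nbrs a) \<le> card (lit g ` {..<D})" unfolding gate(1) using nbrs_Gt by (intro card_mono) auto
  also have "\<dots> \<le> D" using card_image_le[of "{..<D}" "lit g"] by simp
  finally show ?thesis by (simp add: D_def)
qed

lemma slots_pos: "0 < slots"
  using m1 by (simp add: slots_def D_def)

lemma max_degree_gadget: "max_degree G = 2 * d + 3"
proof (rule max_degree_G[of _ "Sl 0 0"])
  show "Sl 0 0 \<in> V" using slots_pos by (simp add: R_def)
  then show "V \<noteq> {}" by blast
  have "card (Sl 0 ` ({..<R} - {0})) = card ({..<R} - {0})" by (rule card_image) (auto simp: inj_on_def)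
  then show "card (nbrs (Sl 0 0)) = 2 * d + 3" using slots_pos by (simp add: nbrs_low R_def)
qed (rule degree_le)

lemma verts_gadget: "verts G = {..<slots * R + m}"
proof -
  have "enc ` V \<subseteq> {..<slots * R + m}" using enc_less by (force simp: V_def)
  moreover have "x \<in> enc ` V" if "x < slots * R + m" for x
  proof (cases "x < slots * R")
    case True
    then have "x div R < slots" by (simp add: less_mult_imp_div_less)
    then have "Sl (x div R) (x mod R) \<in> V" by (simp add: R_def)
    moreover have "enc (Sl (x div R) (x mod R)) = x" by simp
    ultimately show ?thesis by (metis imageI)
  next
    case False
    then have "Gt (x - slots * R) \<in> V" "enc (Gt (x - slots * R)) = x" using that by auto
    then show ?thesis by (metis imageI)
  qed
  ultimately show ?thesis unfolding verts_G by blast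
qed

end

section \<open>Connectivity of the gadget graph; colourings versus assignments\<close>

context gadget
begin

lemma one_less_D: "0 < D" "1 < D" "2 < D" "2 * d < D"
  using d2 by (auto simp: D_def)

lemma lit_in_V: "g < m \<Longrightarrow> s < D \<Longrightarrow> lit g s \<in> V"
  using slot_less by (simp add: R_def)

lemma R_greater: "2 * d + 2 < R" "2 * d + 3 < R" "d + 1 < R"
  by (auto simp: R_def)

lemma reach_slot:
  assumes "\<sigma> < slots" "r < R"
  shows "(Sl \<sigma> r, Sl \<sigma> 0) \<in> reach"
proof (cases "r = 0")
  case False
  then have "adj (Sl \<sigma> r) (Sl \<sigma> 0)" by (auto simp: adj_Sl_Sl)
  then show ?thesis using assms by (intro reach_edge) (auto simp: R_def)
qed (simp add: reach_refl)

lemma reach_same_var: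
  assumes "\<sigma> \<le> \<tau>" "\<tau> < slots" "vr \<sigma> = vr \<tau>"
  shows "(Sl \<sigma> 0, Sl \<tau> 0) \<in> reach"
proof (rule nxt_chain[where Q = "\<lambda>\<sigma> \<tau>. (Sl \<sigma> 0, Sl \<tau> 0) \<in> reach", OF reach_refl reach_trans _ assms(1,3)])
  fix \<rho> k assume k: "nxt \<rho> k" "k \<le> \<tau>"
  then have "\<rho> < slots" "k < slots" using assms(2) by (auto simp: nxt_def)
  moreover have "adj (Sl \<rho> (2 * d + 2)) (Sl k (d + 1))" using k d2 by (auto simp: adj_Sl_Sl)
  ultimately have "(Sl \<rho> (2 * d + 2), Sl k (d + 1)) \<in> reach" by (intro reach_edge) (auto simp: R_def)
  then show "(Sl \<rho> 0, Sl k 0) \<in> reach"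
    using reach_slot[OF \<open>\<rho> < slots\<close>, of "2 * d + 2"] reach_slot[OF \<open>k < slots\<close>, of "d + 1"] R_greater
    by (meson reach_trans reach_sym)
qed

lemma reach_var:
  assumes "\<sigma> < slots" "\<tau> < slots" "vr \<sigma> = vr \<tau>"
  shows "(Sl \<sigma> 0, Sl \<tau> 0) \<in> reach"
  using reach_same_var[of \<sigma> \<tau>] reach_same_var[of \<tau> \<sigma>] assms reach_sym by (metis nle_le)

lemma reach_gate:
  assumes "g < m" "s < D"
  shows "(Sl (g * D + s) 0, Gt g) \<in> reach"
proof -
  have "(lit g s, Gt g) \<in> reach"
    using assms lit_in_V by (intro reach_edge) (auto simp: adj_Sl_Gt)
  then show ?thesis
    using reach_slot[OF slot_less[OF assms] R_greater(2)] by (meson reach_trans reach_sym)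
qed

lemma reach_gates:
  assumes "g < m" "h < m" "s < D" "t < D" "vr (g * D + s) = vr (h * D + t)"
  shows "(Gt g, Gt h) \<in> reach"
  using reach_gate[OF assms(1,3)] reach_gate[OF assms(2,4)]
    reach_var[OF slot_less[OF assms(1,3)] slot_less[OF assms(2,4)] assms(5)]
  by (meson reach_trans reach_sym)

lemma cover_gate:
  assumes "\<sigma> < slots"
  obtains h where "h < m" "vx h = vr \<sigma>" "vy h = T" "vb h = T" "vp h = F"
proof -
  obtain g s where g: "\<sigma> = g * D + s" "g < m" "s < D" using assms by (rule slot_cases)
  then have "vr \<sigma> \<in> {vx g, vy g, vb g, vp g}" by (simp add: vr_slot)
  then show thesis using cover[OF g(2)] that by blast
qed

lemma slot_b: "vr (g * D + 2) = vb g" and slot_p: "vr (g * D + 2 * d) = vp g"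
  using vr_slot[OF one_less_D(3), of g] vr_slot[OF one_less_D(4), of g] d2 by auto

text \<open>Every gate has a slot with base \<open>T\<close> or \<open>F\<close>, and a gate
  \<open>h\<close> provided by \<open>cover\<close> has slots for both, so the chains of these two
  variables join all gates to \<open>Gt h\<close>.\<close>

lemma connected_gadget: "connected_graph G"
proof -
  obtain h where h: "h < m" "vb h = T" "vp h = F" using cover_gate[OF slots_pos] by metis
  have gate: "(Gt g, Gt h) \<in> reach" if g: "g < m" for g
  proof -
    consider "vb g = vb h" | "vb g = vp h" using vb[OF g] h by auto
    then show ?thesis
    proof cases
      case 1
      then show ?thesis using reach_gates[OF g h(1) one_less_D(3) one_less_D(3)] by (simp only: slot_b)
    next
      case 2
      then show ?thesis using reach_gates[OF g h(1) one_less_D(3) one_less_D(4)] by (simp only: slot_b slot_p)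
    qed
  qed
  show ?thesis
  proof (rule connected_G)
    show "Gt h \<in> V" using h by simp
    fix a assume "a \<in> V"
    show "(a, Gt h) \<in> reach"
    proof (cases a)
      case (Sl \<sigma> r)
      then have \<sigma>: "\<sigma> < slots" "r < R" using \<open>a \<in> V\<close> by auto
      obtain g s where g: "\<sigma> = g * D + s" "g < m" "s < D" using \<sigma>(1) by (rule slot_cases)
      show ?thesis
        using reach_slot[OF \<sigma>] reach_gate[OF g(2,3)] gate[OF g(2)] Sl g(1) by (meson reach_trans)
    next
      case (Gt g)
      then show ?thesis using \<open>a \<in> V\<close> gate by simp
    qed
  qed
qed

definition gate_holds :: "(nat \<Rightarrow> bool) \<Rightarrow> nat \<Rightarrow> bool" where
  "gate_holds \<alpha> g \<longleftrightarrow> (\<alpha> (vx g) \<noteq> \<alpha> (vy g) \<longrightarrow> \<alpha> (vp g) \<noteq> \<alpha> (vb g))"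

text \<open>For \<open>d = 2\<close> a single slot with base \<open>vb g\<close> may be in the minority of its group, so colourings are only
  constructed from assignments with the following stronger property.\<close>

definition gate_strict :: "(nat \<Rightarrow> bool) \<Rightarrow> nat \<Rightarrow> bool" where
  "gate_strict \<alpha> g \<longleftrightarrow> \<alpha> (vx g) \<noteq> \<alpha> (vy g) \<and> \<alpha> (vp g) \<noteq> \<alpha> (vb g) \<or>
     \<alpha> (vx g) = \<alpha> (vy g) \<and> (\<alpha> (vx g) = \<alpha> (vb g) \<or> \<alpha> (vp g) = \<alpha> (vb g))"

lemma card_image_lit: "card (lit g ` S) = card S"
  by (rule card_image) (auto simp: inj_on_def)

lemma card_image_Sl: "card (Sl \<sigma> ` S) = card S"
  by (rule card_image) (auto simp: inj_on_def)

text \<open>The core has more than \<open>2 * d\<close> vertices and is monochromatic; the link and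
  the literal vertex see all \<open>d + 1\<close> lower vertices and would be outvoted.\<close>

lemma colour_slot:
  assumes bal: "balanced d col" and \<sigma>: "\<sigma> < slots" and r: "r < R"
  shows "col (Sl \<sigma> r) = col (Sl \<sigma> 0)"
proof -
  have core: "col (Sl \<sigma> q) = col (Sl \<sigma> 0)" if "q < 2 * d + 2" for q
    by (rule balanced_clique[OF bal, of "Sl \<sigma> ` {..<2 * d + 2}"])
      (use \<sigma> that in \<open>auto simp: card_image_Sl adj_Sl_Sl R_def\<close>)
  show ?thesis
  proof (cases "r < 2 * d + 2")
    case False
    show ?thesis
    proof (rule balanced_majority[OF bal, of _ "Sl \<sigma> ` {..d}"])
      fix b assume "b \<in> Sl \<sigma> ` {..d}"
      then obtain q where "b = Sl \<sigma> q" "q \<le> d" by blast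
      then show "col b = col (Sl \<sigma> 0)" using core[of q] by simp
    qed (use \<sigma> r False in \<open>auto simp: card_image_Sl adj_Sl_Sl mem_nbrs R_def\<close>)
  qed (rule core)
qed

text \<open>The link vertex is also outvoted by the \<open>d + 1\<close> upper vertices of the next
  slot, so both slots have its colour.\<close>

lemma colour_nxt:
  assumes bal: "balanced d col" and "nxt \<sigma> \<tau>" "\<tau> < slots"
  shows "col (Sl \<sigma> 0) = col (Sl \<tau> 0)"
proof -
  have \<sigma>: "\<sigma> < slots" using assms(2,3) by (auto simp: nxt_def)
  have "col (Sl \<sigma> (2 * d + 2)) = col (Sl \<tau> 0)"
  proof (rule balanced_majority[OF bal, of _ "Sl \<tau> ` {d<..<2 * d + 2}"])
    fix b assume "b \<in> Sl \<tau> ` {d<..<2 * d + 2}"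
    then obtain q where "b = Sl \<tau> q" "q < R" by (auto simp: R_def)
    then show "col b = col (Sl \<tau> 0)" using colour_slot[OF bal assms(3), of q] by simp
  qed (use assms(2,3) \<sigma> in \<open>auto simp: card_image_Sl adj_Sl_Sl mem_nbrs R_def\<close>)
  then show ?thesis using colour_slot[OF bal \<sigma> R_greater(1)] by simp
qed

lemma colour_var:
  assumes bal: "balanced d col" and "\<sigma> < slots" "\<tau> < slots" "vr \<sigma> = vr \<tau>"
  shows "col (Sl \<sigma> 0) = col (Sl \<tau> 0)"
proof -
  have le: "col (Sl \<sigma> 0) = col (Sl \<tau> 0)" if "\<sigma> \<le> \<tau>" "\<tau> < slots" "vr \<sigma> = vr \<tau>" for \<sigma> \<tau>
    by (rule nxt_chain[where Q = "\<lambda>\<sigma> \<tau>. col (Sl \<sigma> 0) = col (Sl \<tau> 0)", OF _ _ _ that(1,3)])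
      (use colour_nxt[OF bal] that(2) in auto)
  show ?thesis using le[of \<sigma> \<tau>] le[of \<tau> \<sigma>] assms by (metis nle_le)
qed

lemma balanced_gate:
  assumes bal: "balanced d col" and g: "g < m"
    and lits: "\<And>s. s < D \<Longrightarrow> col (lit g s) = \<alpha> (vr (g * D + s))"
  shows "gate_holds \<alpha> g"
  unfolding gate_holds_def
proof (intro impI notI)
  assume ne: "\<alpha> (vx g) \<noteq> \<alpha> (vy g)" and p: "\<alpha> (vp g) = \<alpha> (vb g)"
  \<comment> \<open>\<open>i\<close> is the slot among 0 and 1 whose value differs from the base. If
    \<open>vp g\<close> had the base value, so would the other \<open>2 * d\<close> literals: they
    outvote the gate vertex, and this with the \<open>d\<close> remaining literals of the first
    clique outvotes literal \<open>i\<close>.\<close>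
  define i where "i = (if \<alpha> (vx g) = \<alpha> (vb g) then 1 else 0 :: nat)"
  have i: "i \<le> d" "i < D" using d2 by (auto simp: i_def D_def)
  have coli: "col (lit g i) \<noteq> \<alpha> (vb g)" using lits[OF i(2)] ne d2 i by (auto simp: i_def vr_slot)
  have colb: "col (lit g s) = \<alpha> (vb g)" if "s < D" "s \<noteq> i" for s
    using lits[OF that(1)] that ne p by (auto simp: i_def vr_slot split: if_splits)
  have "lit g ` ({..<D} - {i}) \<subseteq> nbrs (Gt g)"
    using lit_in_V[OF g] by (auto simp: mem_nbrs adj_Sl_Gt)
  moreover have "card (lit g ` ({..<D} - {i})) > d"
    unfolding card_image_lit using i d2 by (simp add: D_def)
  ultimately have Gt: "col (Gt g) = \<alpha> (vb g)"
    by (rule balanced_majority[OF bal, rotated]) (use colb g in auto)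
  let ?S = "insert (Gt g) (lit g ` ({..d} - {i}))"
  have "?S \<subseteq> nbrs (lit g i)"
    using lit_in_V[OF g] g i low_less_D R_greater(2) by (auto simp: mem_nbrs adj_Sl_Gt adj_lit)
  moreover have "card ?S = Suc (card (lit g ` ({..d} - {i})))" by (rule card_insert_disjoint) auto
  then have "card ?S > d" using i by (simp add: card_image_lit)
  ultimately have "col (lit g i) = \<alpha> (vb g)"
    by (rule balanced_majority[OF bal lit_in_V[OF g i(2)]]) (use colb Gt low_less_D in auto)
  then show False using coli by simp
qed

text \<open>All slots of a variable share a colour, which defines \<open>\<alpha>\<close>. The
  inequality of \<open>T\<close> and \<open>F\<close> is the only place where the colouring has to
  be non-constant.\<close>

lemma balanced_sound:
  assumes bal: "balanced d col"
  shows "\<exists>\<alpha>. \<alpha> T \<noteq> \<alpha> F \<and> (\<forall>g<m. gate_holds \<alpha> g)"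
proof -
  define \<alpha> where "\<alpha> v = col (Sl (SOME \<sigma>. \<sigma> < slots \<and> vr \<sigma> = v) 0)" for v
  have \<alpha>: "col (Sl \<sigma> r) = \<alpha> (vr \<sigma>)" if \<sigma>: "\<sigma> < slots" "r < R" for \<sigma> r
  proof -
    let ?\<tau> = "SOME \<tau>. \<tau> < slots \<and> vr \<tau> = vr \<sigma>"
    have "?\<tau> < slots \<and> vr ?\<tau> = vr \<sigma>" by (rule someI[of _ \<sigma>]) (use \<sigma> in simp)
    then show ?thesis using colour_var[OF bal \<sigma>(1), of ?\<tau>] colour_slot[OF bal \<sigma>] by (simp add: \<alpha>_def)
  qed
  have gates: "gate_holds \<alpha> g" if g: "g < m" for g
    by (rule balanced_gate[OF bal g]) (use \<alpha> slot_less[OF g] R_greater in auto)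
  have "\<alpha> T \<noteq> \<alpha> F"
  proof
    \<comment> \<open>If \<open>T\<close> and \<open>F\<close> agree, the gate that
      \<open>cover\<close> provides for a variable forces it to the colour of \<open>T\<close>; then
      all slots, and by majority all gate vertices, have one colour.\<close>
    assume TF: "\<alpha> T = \<alpha> F"
    have slot: "col (Sl \<sigma> r) = \<alpha> T" if \<sigma>: "\<sigma> < slots" "r < R" for \<sigma> r
    proof -
      obtain h where h: "h < m" "vx h = vr \<sigma>" "vy h = T" "vb h = T" "vp h = F"
        using \<sigma>(1) by (rule cover_gate)
      then show ?thesis using gates[OF h(1)] TF \<alpha>[OF \<sigma>] unfolding gate_holds_def by auto
    qed
    have "col (Gt g) = \<alpha> T" if g: "g < m" for g
    proof (rule balanced_majority[OF bal, of _ "lit g ` {..<D}"])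
      show "lit g ` {..<D} \<subseteq> nbrs (Gt g)" using lit_in_V[OF g] by (auto simp: mem_nbrs adj_Sl_Gt)
      show "card (lit g ` {..<D}) > d" unfolding card_image_lit by (simp add: D_def)
    qed (use g slot slot_less[OF g] R_greater in auto)
    then have "col a = \<alpha> T" if "a \<in> V" for a using that slot by (cases a) auto
    then show False using bal unfolding balanced_def by blast
  qed
  then show ?thesis using gates by blast
qed

text \<open>If \<open>vx g\<close> and \<open>vy g\<close> differ, exactly one of the first
  \<open>d + 1\<close> literals opposes the base. The gate vertex sides with it, so that this
  literal faces \<open>d\<close> opponents and not \<open>d + 1\<close>.\<close>

fun gate_colour :: "(nat \<Rightarrow> bool) \<Rightarrow> vtx \<Rightarrow> bool" where
  "gate_colour \<alpha> (Sl \<sigma> r) = \<alpha> (vr \<sigma>)"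
| "gate_colour \<alpha> (Gt g) = (if \<alpha> (vx g) \<noteq> \<alpha> (vy g) then \<not> \<alpha> (vb g) else \<alpha> (vb g))"

lemma card_le_subset: "S \<subseteq> S' \<Longrightarrow> card S' \<le> k \<Longrightarrow> finite S' \<Longrightarrow> card S \<le> k"
  using card_mono le_trans by blast

lemma nbrs_lit_colour:
  assumes "s < D" "b \<in> nbrs (lit g s)" "gate_colour \<alpha> b \<noteq> gate_colour \<alpha> (lit g s)"
  shows "b = Gt g \<or> (\<exists>s'<D. s' \<noteq> s \<and> (s' \<le> d \<longleftrightarrow> s \<le> d) \<and> b = lit g s')"
  using nbrs_lit[OF assms(1), of g] assms(2,3) by auto

text \<open>Conflicts occur only at literals and gate vertices, since all other edges join copies of
  one variable. Whenever two vertices oppose a third, \<open>d \<ge> 2\<close> is what tolerates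
  them.\<close>

lemma strict_balanced:
  assumes TF: "\<alpha> T \<noteq> \<alpha> F" and strict: "\<And>g. g < m \<Longrightarrow> gate_strict \<alpha> g"
  shows "balanced d (gate_colour \<alpha>)"
  unfolding balanced_def
proof
  obtain h where h: "h < m" "vb h = T" "vp h = F" using cover_gate[OF slots_pos] by metis
  have "gate_colour \<alpha> (lit h 2) \<noteq> gate_colour \<alpha> (lit h (2 * d))" using h TF slot_b[of h] slot_p[of h] by simp
  then show "\<exists>a\<in>V. \<exists>b\<in>V. gate_colour \<alpha> a \<noteq> gate_colour \<alpha> b"
    using lit_in_V[OF h(1) one_less_D(3)] lit_in_V[OF h(1) one_less_D(4)] by blast
  show "\<forall>a\<in>V. card {b \<in> nbrs a. gate_colour \<alpha> b \<noteq> gate_colour \<alpha> a} \<le> d"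
  proof
    fix a assume "a \<in> V"
    let ?o = "{b \<in> nbrs a. gate_colour \<alpha> b \<noteq> gate_colour \<alpha> a}"
    from \<open>a \<in> V\<close> show "card ?o \<le> d"
    proof (cases rule: V_cases)
      case (low \<sigma> r)
      then have "?o = {}" by (auto simp: nbrs_low)
      then show ?thesis by (simp only: card.empty)
    next
      case (high \<sigma> r)
      then have "?o = {}" using nbrs_high[OF high(3,4), of \<sigma>] by (auto simp: nxt_def)
      then show ?thesis by (simp only: card.empty)
    next
      case (link \<sigma>)
      then have "?o = {}" using nbrs_link[of \<sigma>] by (auto simp: nxt_def)
      then show ?thesis by (simp only: card.empty)
    next
      case (lit g s)
      define k where "k t = gate_colour \<alpha> (lit g t)" for t
      define kg where "kg = gate_colour \<alpha> (Gt g)"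
      have o: "b = Gt g \<and> kg \<noteq> k s \<or> (\<exists>t<D. t \<noteq> s \<and> (t \<le> d \<longleftrightarrow> s \<le> d) \<and> b = lit g t \<and> k t \<noteq> k s)"
        if "b \<in> ?o" for b
        using nbrs_lit_colour[OF lit(3), of b g \<alpha>] that unfolding lit(1) k_def kg_def by blast
      have c: "k t = \<alpha> (if t = 0 then vx g else if t = 1 then vy g else if t \<le> d then vb g else vp g)"
        if "t < D" for t using that by (simp add: vr_slot k_def)
      show ?thesis
      proof (cases "s \<le> d")
        case False
        have "k t = k s" if "t < D" "\<not> t \<le> d" for t
          using c[OF that(1)] c[OF lit(3)] that False d2 by auto
        then have "?o \<subseteq> {Gt g}" using o False by blast
        then show ?thesis by (rule card_le_subset) (use d2 in auto)
      next
        case s: True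
        show ?thesis
        proof (cases "\<alpha> (vx g) = \<alpha> (vy g)")
          case False
          define i where "i = (if \<alpha> (vx g) = \<alpha> (vb g) then 1 else 0 :: nat)"
          have ci: "k t \<longleftrightarrow> (if t = i then \<not> \<alpha> (vb g) else \<alpha> (vb g))" if "t \<le> d" for t
            using c[OF low_less_D[OF that]] that False by (auto simp: i_def)
          have cg: "kg = (\<not> \<alpha> (vb g))" using False by (simp add: kg_def)
          show ?thesis
          proof (cases "s = i")
            case True
            have "?o \<subseteq> lit g ` ({..d} - {i})"
              using o s True ci[OF s] cg unfolding lit(1) by (auto)
            then show ?thesis
              by (rule card_le_subset) (use True s in \<open>simp_all add: card_image_lit\<close>)
          next
            case False
            have "?o \<subseteq> {lit g i, Gt g}"
            proof
              fix b assume "b \<in> ?o"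
              then show "b \<in> {lit g i, Gt g}" using o[of b] s False ci ci[OF s] by (auto split: if_splits)
            qed
            moreover have "card {lit g i, Gt g} \<le> d" using d2 by simp
            ultimately show ?thesis by (rule card_le_subset) simp
          qed
        next
          case eq: True
          show ?thesis
          proof (cases "\<alpha> (vx g) = \<alpha> (vb g)")
            case True
            have "k t = \<alpha> (vb g)" if "t \<le> d" for t
              using c[OF low_less_D[OF that]] that eq True by (auto)
            moreover have "kg = \<alpha> (vb g)" using eq by (simp add: kg_def)
            ultimately have "?o = {}" using o s unfolding lit(1) by (auto)
            then show ?thesis by (simp only: card.empty)
          next
            case False
            have ci: "k t \<longleftrightarrow> (if t < 2 then \<not> \<alpha> (vb g) else \<alpha> (vb g))" if "t \<le> d" for t
              using c[OF low_less_D[OF that]] that False eq by (auto)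
            have cg: "kg = \<alpha> (vb g)" using eq by (simp add: kg_def)
            show ?thesis
            proof (cases "s < 2")
              case True
              \<comment> \<open>The \<open>d - 1\<close> base literals and the gate vertex make
                exactly \<open>d\<close> opponents.\<close>
              have "?o \<subseteq> insert (Gt g) (lit g ` {2..d})"
              proof
                fix b assume "b \<in> ?o"
                then show "b \<in> insert (Gt g) (lit g ` {2..d})"
                  using o[of b] s True ci ci[OF s] by (auto simp: image_iff split: if_splits)
              qed
              moreover have "card (insert (Gt g) (lit g ` {2..d})) = Suc (card (lit g ` {2..d}))"
                by (rule card_insert_disjoint) auto
              then have "card (insert (Gt g) (lit g ` {2..d})) \<le> d"
                using d2 by (simp add: card_image_lit)
              ultimately show ?thesis by (rule card_le_subset) simp
            next
              case False
              have "?o \<subseteq> lit g ` {..<2}"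
              proof
                fix b assume "b \<in> ?o"
                then show "b \<in> lit g ` {..<2}"
                  using o[of b] s False ci ci[OF s] cg by (force split: if_splits)
              qed
              then show ?thesis
                by (rule card_le_subset) (use d2 in \<open>simp_all add: card_image_lit\<close>)
            qed
          qed
        qed
      qed
    next
      case (gate g)
      have st: "gate_strict \<alpha> g" by (rule strict[OF gate(2)])
      have c: "gate_colour \<alpha> (lit g t) = \<alpha> (if t = 0 then vx g else if t = 1 then vy g else if t \<le> d then vb g else vp g)"
        if "t < D" for t using that by (simp add: vr_slot)
      have o: "?o \<subseteq> lit g ` {t. t < D \<and> gate_colour \<alpha> (lit g t) \<noteq> gate_colour \<alpha> (Gt g)}"
        using nbrs_Gt[of g] unfolding gate(1) by (auto simp del: gate_colour.simps)
      have "card {t. t < D \<and> gate_colour \<alpha> (lit g t) \<noteq> gate_colour \<alpha> (Gt g)} \<le> d" (is "card ?S \<le> d")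
      proof (cases "\<alpha> (vx g) = \<alpha> (vy g)")
        case False
        define i where "i = (if \<alpha> (vx g) = \<alpha> (vb g) then 1 else 0 :: nat)"
        have i: "i \<le> d" using d2 by (auto simp: i_def)
        have "gate_colour \<alpha> (lit g i) = gate_colour \<alpha> (Gt g)"
          using False c[of 0] c[of 1] one_less_D by (auto simp: i_def simp del: gate_colour.simps(1))
        \<comment> \<open>Strictness puts all copies of \<open>vp g\<close> on the side of the gate
          vertex; only the first clique without literal \<open>i\<close> opposes it.\<close>
        moreover have "gate_colour \<alpha> (lit g t) = gate_colour \<alpha> (Gt g)" if "t < D" "d < t" for t
          using c[OF that(1)] that(2) st False d2 by (auto simp: gate_strict_def simp del: gate_colour.simps(1))
        ultimately have "?S \<subseteq> {..d} - {i}" by (auto simp del: gate_colour.simps) (meson not_le)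
        then show ?thesis by (rule card_le_subset) (use i in simp_all)
      next
        case eq: True
        then have cg: "gate_colour \<alpha> (Gt g) = \<alpha> (vb g)" by simp
        show ?thesis
        proof (cases "\<alpha> (vx g) = \<alpha> (vb g)")
          case True
          have "?S \<subseteq> {d<..<D}"
            using c cg eq True by (auto simp del: gate_colour.simps split: if_splits)
          then show ?thesis by (rule card_le_subset) (simp_all add: D_def)
        next
          case False
          \<comment> \<open>Strictness gives \<open>vp g\<close> the base value here; otherwise
            \<open>d + 2\<close> literals would oppose the gate vertex.\<close>
          have "?S \<subseteq> {..<2}"
            using c cg eq False st by (auto simp: gate_strict_def simp del: gate_colour.simps split: if_splits)
          then show ?thesis by (rule card_le_subset) (use d2 in simp_all)
        qed
      qed
      then have "card (lit g ` ?S) \<le> d" by (simp only: card_image_lit)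
      from o this show ?thesis by (rule card_le_subset) simp
    qed
  qed
qed

end

definition slot_var :: "nat \<Rightarrow> (nat \<Rightarrow> nat) \<Rightarrow> (nat \<Rightarrow> nat) \<Rightarrow> (nat \<Rightarrow> nat) \<Rightarrow> (nat \<Rightarrow> nat) \<Rightarrow> nat \<Rightarrow> nat" where
  "slot_var d vx vy vb vp \<sigma> = (let s = \<sigma> mod (2 * d + 1); g = \<sigma> div (2 * d + 1) in
     if s = 0 then vx g else if s = 1 then vy g else if s \<le> d then vb g else vp g)"

text \<open>\<open>half\<close> and \<open>nxt\<close> in arithmetic on vertex codes, outside the
  locale and with bounded quantifiers only, so that the closure rules for \<open>PB\<close>
  apply.\<close>

definition half_edge :: "nat \<Rightarrow> nat \<Rightarrow> (nat \<Rightarrow> nat) \<Rightarrow> nat \<Rightarrow> nat \<Rightarrow> bool" where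
  "half_edge d m vr i j \<longleftrightarrow> (let D = 2 * d + 1; R = 2 * d + 4; S = m * D * R in i < S \<and>
     (if j < S then
        i div R = j div R \<and> i mod R < j mod R \<and> (j mod R < 2 * d + 2 \<or> i mod R \<le> d \<or> 2 * d + 2 \<le> i mod R) \<or>
        i mod R = 2 * d + 2 \<and> d < j mod R \<and> j mod R < 2 * d + 2 \<and> i div R < j div R \<and>
          vr (i div R) = vr (j div R) \<and> \<not> (\<exists>k<j div R. i div R < k \<and> vr k = vr (i div R)) \<or>
        i mod R = 2 * d + 3 \<and> j mod R = 2 * d + 3 \<and> i div R < j div R \<and> i div R div D = j div R div D \<and>
          (i div R mod D \<le> d) = (j div R mod D \<le> d)
      else i mod R = 2 * d + 3 \<and> i div R div D = j - S))"

context gadget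
begin

lemma edge_nat:
  assumes "i < slots * R + m" "j < slots * R + m"
  shows "{i, j} \<in> edges G \<longleftrightarrow> half_edge d m (slot_var d vx vy vb vp) i j \<or> half_edge d m (slot_var d vx vy vb vp) j i"
proof -
  define dec where "dec k = (if k < slots * R then Sl (k div R) (k mod R) else Gt (k - slots * R))" for k
  have R: "0 < R" by (simp add: R_def)
  have dec: "dec k \<in> V" "enc (dec k) = k" if "k < slots * R + m" for k
    using that R by (auto simp: dec_def less_mult_imp_div_less)
  have vr: "slot_var d vx vy vb vp = vr"
    by (auto simp: fun_eq_iff slot_var_def vr_def D_def Let_def)
  have half: "half_edge d m vr k l \<longleftrightarrow> half (dec k) (dec l)" for k l
    unfolding half_edge_def Let_def D_def[symmetric] R_def[symmetric] slots_def[symmetric] nxt_def[symmetric]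
    by (cases "k < slots * R"; cases "l < slots * R") (simp_all add: dec_def nxt_def)
  have "{enc (dec i), enc (dec j)} \<in> edges G \<longleftrightarrow> adj (dec i) (dec j)"
    by (rule edge_G) (use dec assms in auto)
  then show ?thesis using dec(2) assms half unfolding adj_def vr by simp
qed

lemma gadget_input: "G \<in> d_Cut_inputs (\<lambda>G. claw_free G \<and> max_degree G = 2 * d + 3)"
  using simple_G verts_gadget connected_gadget claw_free_gadget max_degree_gadget
  unfolding d_Cut_inputs_def by blast

end

section \<open>Rule systems\<close>

text \<open>Variable 0 is true and variable 1 is false.  With base \<open>kb = 1\<close> the rule reads
  \<open>a1 \<longrightarrow> a2 \<or> a3\<close>, with base \<open>kb = 0\<close> it reads \<open>a2 \<and> a3 \<longrightarrow> a1\<close>.\<close>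

definition rule_holds :: "(nat \<Rightarrow> bool) \<Rightarrow> nat \<Rightarrow> nat \<Rightarrow> nat \<Rightarrow> nat \<Rightarrow> bool" where
  "rule_holds \<alpha> b x y z \<longleftrightarrow> (\<alpha> x \<noteq> \<alpha> b \<longrightarrow> \<alpha> y \<noteq> \<alpha> b \<or> \<alpha> z \<noteq> \<alpha> b)"

definition satisfies :: "nat \<Rightarrow> (nat \<Rightarrow> nat) \<Rightarrow> (nat \<Rightarrow> nat) \<Rightarrow> (nat \<Rightarrow> nat) \<Rightarrow> (nat \<Rightarrow> nat) \<Rightarrow> (nat \<Rightarrow> bool) \<Rightarrow> bool" where
  "satisfies n kb a1 a2 a3 \<alpha> \<longleftrightarrow> \<alpha> 0 \<and> \<not> \<alpha> 1 \<and> (\<forall>r<n. rule_holds \<alpha> (kb r) (a1 r) (a2 r) (a3 r))"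

text \<open>Rule \<open>r\<close> becomes ten gates.  Its variables are multiplied by 3 to make room for two fresh variables
  \<open>t = 3r+1\<close> and \<open>p = 3r+2\<close>: the first three gates say that \<open>a1 \<noteq> b\<close> implies \<open>t \<noteq> b\<close>, that \<open>t \<noteq> a2\<close>
  implies \<open>p \<noteq> b\<close>, and that \<open>p \<noteq> b\<close> implies \<open>a3 \<noteq> b\<close>.  The other seven guarantee that a colouring which
  identifies true and false is constant.\<close>

definition rule_x :: "(nat \<Rightarrow> nat) \<Rightarrow> (nat \<Rightarrow> nat) \<Rightarrow> (nat \<Rightarrow> nat) \<Rightarrow> nat \<Rightarrow> nat" where
  "rule_x a1 a2 a3 g = (let r = g div 10; j = g mod 10 in
     if j = 0 \<or> j = 3 then 3 * a1 r else if j = 1 \<or> j = 6 then 3 * r + 1 else if j = 2 \<or> j = 7 then 3 * r + 2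
     else if j = 4 then 3 * a2 r else if j = 5 then 3 * a3 r else if j = 8 then 0 else 3)"

definition rule_y :: "(nat \<Rightarrow> nat) \<Rightarrow> (nat \<Rightarrow> nat) \<Rightarrow> nat \<Rightarrow> nat" where
  "rule_y kb a2 g = (let r = g div 10; j = g mod 10 in
     if j = 0 \<or> j = 2 then 3 * kb r else if j = 1 then 3 * a2 r else 0)"

definition rule_b :: "(nat \<Rightarrow> nat) \<Rightarrow> nat \<Rightarrow> nat" where
  "rule_b kb g = (if g mod 10 \<le> 2 then 3 * kb (g div 10) else 0)"

definition rule_p :: "(nat \<Rightarrow> nat) \<Rightarrow> nat \<Rightarrow> nat" where
  "rule_p a3 g = (let r = g div 10; j = g mod 10 in
     if j = 0 then 3 * r + 1 else if j = 1 then 3 * r + 2 else if j = 2 then 3 * a3 r else 3)"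

locale rule_system =
  fixes d n :: nat and kb a1 a2 a3 :: "nat \<Rightarrow> nat"
  assumes d2: "d \<ge> 2" and n1: "n \<ge> 1" and kb: "kb r \<in> {0, 1}"
begin

abbreviation "gx \<equiv> rule_x a1 a2 a3"
abbreviation "gy \<equiv> rule_y kb a2"
abbreviation "gb \<equiv> rule_b kb"
abbreviation "gp \<equiv> rule_p a3"

lemma gate_simps:
  assumes "j < 10"
  shows "gx (10 * r + j) = (if j = 0 \<or> j = 3 then 3 * a1 r else if j = 1 \<or> j = 6 then 3 * r + 1
     else if j = 2 \<or> j = 7 then 3 * r + 2
     else if j = 4 then 3 * a2 r else if j = 5 then 3 * a3 r else if j = 8 then 0 else 3)"
    "gy (10 * r + j) = (if j = 0 \<or> j = 2 then 3 * kb r else if j = 1 then 3 * a2 r else 0)"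
    "gb (10 * r + j) = (if j \<le> 2 then 3 * kb r else 0)"
    "gp (10 * r + j) = (if j = 0 then 3 * r + 1 else if j = 1 then 3 * r + 2 else if j = 2 then 3 * a3 r else 3)"
  using assms by (simp_all add: rule_x_def rule_y_def rule_b_def rule_p_def Let_def)

lemma gate_index: "g < 10 * n \<Longrightarrow> \<exists>r j. g = 10 * r + j \<and> r < n \<and> j < 10"
  by (intro exI[of _ "g div 10"] exI[of _ "g mod 10"]) auto

sublocale gadget d "10 * n" gx gy gb gp 0 3
proof
  show "2 \<le> d" by (rule d2)
  show "1 \<le> 10 * n" using n1 by simp
  fix g assume g: "g < 10 * n"
  obtain r j where rj: "g = 10 * r + j" "r < n" "j < 10" using gate_index[OF g] by blast
  show "gb g \<in> {0, 3}" using kb[of r] rj by (auto simp: gate_simps)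
  fix v assume v: "v \<in> {gx g, gy g, gb g, gp g}"
  let ?S = "{3 * a1 r, 3 * a2 r, 3 * a3 r, 3 * r + 1, 3 * r + 2, 0, 3}"
  have "gx g \<in> ?S" "gp g \<in> ?S" unfolding rj(1) gate_simps[OF rj(3)] by simp_all
  moreover have "3 * kb r \<in> ?S" using kb[of r] by auto
  then have "gy g \<in> ?S" "gb g \<in> ?S" unfolding rj(1) gate_simps[OF rj(3)] by simp_all
  ultimately have "v \<in> ?S" using v by blast
  then have "\<exists>k\<in>{3..<10}. v = gx (10 * r + k)"
  proof -
    assume "v \<in> {3 * a1 r, 3 * a2 r, 3 * a3 r, 3 * r + 1, 3 * r + 2, 0, 3}"
    then consider "v = gx (10 * r + 3)" | "v = gx (10 * r + 4)" | "v = gx (10 * r + 5)" | "v = gx (10 * r + 6)"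
      | "v = gx (10 * r + 7)" | "v = gx (10 * r + 8)" | "v = gx (10 * r + 9)"
      by (auto simp: gate_simps)
    then show ?thesis by cases (auto intro: bexI[rotated])
  qed
  then obtain k where k: "3 \<le> k" "k < 10" "v = gx (10 * r + k)" by auto
  then show "\<exists>h<10 * n. gx h = v \<and> gy h = 0 \<and> gb h = 0 \<and> gp h = 3"
    using rj(2) by (intro exI[of _ "10 * r + k"]) (auto simp: gate_simps(2-4))
qed

lemma sound:
  assumes "balanced d col"
  shows "\<exists>\<alpha>. satisfies n kb a1 a2 a3 \<alpha>"
proof -
  obtain \<beta> where TF: "\<beta> 0 \<noteq> \<beta> 3" and gates: "\<And>g. g < 10 * n \<Longrightarrow> gate_holds \<beta> g"
    using balanced_sound[OF assms] by blast
  \<comment> \<open>Colours are determined only up to exchange; the colour of variable 0 is read as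
    true.\<close>
  let ?\<alpha> = "\<lambda>v. \<beta> (3 * v) = \<beta> 0"
  have "rule_holds ?\<alpha> (kb r) (a1 r) (a2 r) (a3 r)" if r: "r < n" for r
  proof -
    have g: "gate_holds \<beta> (10 * r + 0)" "gate_holds \<beta> (10 * r + 1)" "gate_holds \<beta> (10 * r + 2)"
      using r by (auto intro!: gates)
    have "\<beta> (3 * a1 r) \<noteq> \<beta> (3 * kb r) \<longrightarrow> \<beta> (3 * r + 1) \<noteq> \<beta> (3 * kb r)"
      "\<beta> (3 * r + 1) \<noteq> \<beta> (3 * a2 r) \<longrightarrow> \<beta> (3 * r + 2) \<noteq> \<beta> (3 * kb r)"
      "\<beta> (3 * r + 2) \<noteq> \<beta> (3 * kb r) \<longrightarrow> \<beta> (3 * a3 r) \<noteq> \<beta> (3 * kb r)"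
      using g(1) g(2) g(3) gate_simps[of 0 r] gate_simps[of 1 r] gate_simps[of 2 r]
      unfolding gate_holds_def by simp_all
    then show ?thesis unfolding rule_holds_def by argo
  qed
  then have "satisfies n kb a1 a2 a3 ?\<alpha>" using TF by (auto simp: satisfies_def)
  then show ?thesis by blast
qed

lemma complete:
  assumes "satisfies n kb a1 a2 a3 \<alpha>"
  shows "\<exists>col. balanced d col"
proof -
  \<comment> \<open>\<open>t\<close> equals \<open>a2\<close>, and \<open>p\<close> equals the base,
    unless a gate forces otherwise; thus gates whose first two variables agree are strict as
    well.\<close>
  define t where "t r = (if \<alpha> (a1 r) \<noteq> \<alpha> (kb r) then \<not> \<alpha> (kb r) else \<alpha> (a2 r))" for r
  define p where "p r = (if t r \<noteq> \<alpha> (a2 r) then \<not> \<alpha> (kb r) else \<alpha> (kb r))" for r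
  define \<beta> where "\<beta> v = (if v mod 3 = 0 then \<alpha> (v div 3) else if v mod 3 = 1 then t (v div 3) else p (v div 3))" for v
  have \<beta>: "\<beta> (3 * v) = \<alpha> v" "\<beta> (3 * v + 1) = t v" "\<beta> (3 * v + 2) = p v" for v
  proof -
    have "(3 * v + 1) mod 3 = 1" "(3 * v + 2) mod 3 = 2" "(3 * v + 1) div 3 = v" "(3 * v + 2) div 3 = v" by presburger+
    then show "\<beta> (3 * v) = \<alpha> v" "\<beta> (3 * v + 1) = t v" "\<beta> (3 * v + 2) = p v" by (simp_all add: \<beta>_def)
  qed
  have \<beta>01: "\<beta> 0" "\<not> \<beta> 3" using assms \<beta>(1)[of 0] \<beta>(1)[of 1] by (auto simp: satisfies_def)
  have "gate_strict \<beta> g" if g: "g < 10 * n" for g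
  proof -
    obtain r j where rj: "g = 10 * r + j" "r < n" "j < 10" using gate_index[OF g] by blast
    have rule: "rule_holds \<alpha> (kb r) (a1 r) (a2 r) (a3 r)" using assms rj(2) by (simp add: satisfies_def)
    consider "j = 0" | "j = 1" | "j = 2" | "3 \<le> j" by linarith
    then show ?thesis
    proof cases
      case 4
      then show ?thesis
        unfolding gate_strict_def rj(1) gate_simps[OF rj(3)] using \<beta>01 by auto
    qed (use rule \<beta>[of r] \<beta>(1)[of "a1 r"] \<beta>(1)[of "a2 r"] \<beta>(1)[of "a3 r"] \<beta>(1)[of "kb r"] gate_simps[OF rj(3), of r] in
        \<open>auto simp: gate_strict_def rj(1) t_def p_def rule_holds_def\<close>)
  qed
  then show ?thesis using strict_balanced \<beta>01 by blast
qed

lemma d_cut_iff_satisfiable: "(\<exists>M. is_d_cut d G M) \<longleftrightarrow> (\<exists>\<alpha>. satisfies n kb a1 a2 a3 \<alpha>)"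
  using d_cut_iff sound complete by blast

end

section \<open>Encodings of graphs\<close>

lemma nth_concat_same:
  assumes "\<And>xs. xs \<in> set xss \<Longrightarrow> length xs = n" "k < length xss * n"
  shows "concat xss ! k = xss ! (k div n) ! (k mod n)"
  using assms
proof (induction xss arbitrary: k)
  case (Cons xs xss)
  have len: "length xs = n" using Cons.prems by simp
  show ?case
  proof (cases "k < n")
    case False
    have n: "0 < n" using Cons.prems(2) by (cases n) auto
    have "concat xss ! (k - n) = xss ! ((k - n) div n) ! ((k - n) mod n)"
      by (rule Cons.IH) (use Cons.prems False in auto)
    moreover have "k div n = Suc ((k - n) div n)" "(k - n) mod n = k mod n"
      using False n by (auto simp: div_if le_mod_geq)
    ultimately show ?thesis using False len by (simp add: nth_append)
  qed (use len in \<open>simp add: nth_append\<close>)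
qed simp

text \<open>Bit \<open>k\<close> in closed form, the shape that \<open>polytime_I\<close> can
  print.\<close>

lemma encode_graph_alt:
  assumes "verts G = {..<n}"
  shows "encode_graph G = map (\<lambda>k. k < n \<or> n < k \<and> {(k - n - 1) div n, (k - n - 1) mod n} \<in> edges G) [0..<n + 1 + n * n]"
proof (rule nth_equalityI)
  show "length (encode_graph G) = length (map (\<lambda>k. k < n \<or> n < k \<and> {(k - n - 1) div n, (k - n - 1) mod n} \<in> edges G) [0..<n + 1 + n * n])"
    using length_encode_graph[of G] assms by simp
  fix k assume "k < length (encode_graph G)"
  then have k: "k < n + 1 + n * n" using length_encode_graph[of G] assms by simp
  let ?rows = "map (\<lambda>i. map (\<lambda>j. {i, j} \<in> edges G) [0..<n]) [0..<n]"
  have enc: "encode_graph G = replicate n True @ [False] @ concat ?rows"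
    using assms by (simp add: encode_graph_def Let_def)
  have "encode_graph G ! k = (k < n \<or> n < k \<and> {(k - n - 1) div n, (k - n - 1) mod n} \<in> edges G)"
  proof (cases "n < k")
    case True
    let ?l = "k - n - 1"
    have l: "?l < n * n" using True k by simp
    then have n: "0 < n" by (cases n) auto
    have "concat ?rows ! ?l = ?rows ! (?l div n) ! (?l mod n)"
      by (rule nth_concat_same) (use l in auto)
    moreover have "?l div n < n" "?l mod n < n" using l n by (auto simp: less_mult_imp_div_less)
    ultimately have "concat ?rows ! ?l = ({?l div n, ?l mod n} \<in> edges G)" by simp
    then show ?thesis using True unfolding enc by (simp add: nth_append)
  qed (auto simp: enc nth_append)
  then show "encode_graph G ! k = map (\<lambda>k. k < n \<or> n < k \<and> {(k - n - 1) div n, (k - n - 1) mod n} \<in> edges G) [0..<n + 1 + n * n] ! k"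
    using k by (simp del: upt_Suc)
qed

lemma encode_graph_edge:
  assumes "verts G = {..<n}" "i < n" "j < n"
  shows "n + 1 + (i * n + j) < n + 1 + n * n" "encode_graph G ! (n + 1 + (i * n + j)) = ({i, j} \<in> edges G)"
proof -
  have "i * n + j < Suc i * n" using assms(3) by simp
  also have "\<dots> \<le> n * n" using assms(2) by (intro mult_right_mono) auto
  finally show l: "n + 1 + (i * n + j) < n + 1 + n * n" by simp
  have "(i * n + j) div n = i" "(i * n + j) mod n = j" using assms(3) by auto
  then show "encode_graph G ! (n + 1 + (i * n + j)) = ({i, j} \<in> edges G)"
    unfolding encode_graph_alt[OF assms(1)] using l by (simp del: upt_Suc)
qed

text \<open>Yes-inputs are an image under \<open>encode_graph\<close>, so a reduction needs that its
  output is not also the code of another graph. The length \<open>n + 1 + n * n\<close> already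
  determines \<open>n\<close>.\<close>

lemma encode_graph_inj:
  assumes "G \<in> d_Cut_inputs C" "H \<in> d_Cut_inputs C'" "encode_graph G = encode_graph H"
  shows "G = H"
proof -
  obtain n k where n: "verts G = {..<n}" "simple_graph G" and k: "verts H = {..<k}" "simple_graph H"
    using assms unfolding d_Cut_inputs_def by blast
  have "n + 1 + n * n = k + 1 + k * k"
    using length_encode_graph[of G] length_encode_graph[of H] n k assms(3) by simp
  moreover have "a * a < b * b" if "a < b" for a b :: nat using that by (intro mult_strict_mono) auto
  ultimately have "n = k" by (metis add_less_mono add_mono_thms_linordered_field(2) less_irrefl linorder_neqE_nat add_less_cancel_right)
  have e: "{i, j} \<in> edges G \<longleftrightarrow> {i, j} \<in> edges H" if "i < n" "j < n" for i j
    using encode_graph_edge(2)[OF n(1) that] encode_graph_edge(2)[of H n i j] k(1) that assms(3) \<open>n = k\<close> by auto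
  have pair: "\<exists>i j. e = {i, j} \<and> i < n \<and> j < n" if "e \<in> edges G \<or> e \<in> edges H" for e
  proof -
    have "e \<subseteq> {..<n}" "card e = 2" using that n k \<open>n = k\<close> unfolding simple_graph_def by auto
    then show ?thesis by (auto simp: card_2_iff)
  qed
  have "edges G = edges H" using e pair by blast
  then show ?thesis using n(1) k(1) \<open>n = k\<close> by simp
qed

section \<open>Polynomial-time reduction from rule systems\<close>

lemmas PF_PB_intros = PF_const PF_add PF_diff PF_mult PF_div PF_mod PF_if PF_of_bool PF_poly
  PB_const PB_conj PB_disj PB_not PB_imp PB_iff PB_less PB_le PB_eq PB_if PB_ex PB_all

text \<open>Rules are computed from their number, so the graph is never stored: each bit of its
  encoding is decided directly from the input.\<close>

lemma reduction_I:
  fixes n :: "st \<Rightarrow> nat" and kb a1 a2 a3 :: "nat \<Rightarrow> st \<Rightarrow> nat"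
  assumes d2: "d \<ge> 2" and n: "\<And>M. PF M n"
    and kb: "\<And>M v. PF M v \<Longrightarrow> PF M (\<lambda>s. kb (v s) s)"
    and a1: "\<And>M v. PF M v \<Longrightarrow> PF M (\<lambda>s. a1 (v s) s)"
    and a2: "\<And>M v. PF M v \<Longrightarrow> PF M (\<lambda>s. a2 (v s) s)"
    and a3: "\<And>M v. PF M v \<Longrightarrow> PF M (\<lambda>s. a3 (v s) s)"
    and n1: "\<And>s. n s \<ge> 1" and kb01: "\<And>r s. kb r s \<in> {0, 1}"
    and L: "\<And>x. x \<in> L \<longleftrightarrow> (\<exists>\<alpha>. satisfies (n (x, [], env0)) (\<lambda>r. kb r (x, [], env0)) (\<lambda>r. a1 r (x, [], env0))
         (\<lambda>r. a2 r (x, [], env0)) (\<lambda>r. a3 r (x, [], env0)) \<alpha>)"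
  defines "C \<equiv> \<lambda>G. claw_free G \<and> max_degree G = 2 * d + 3"
  shows "\<exists>f. polytime_computable f \<and> (\<forall>x. f x \<in> encode_graph ` d_Cut_inputs C \<and>
    (x \<in> L \<longleftrightarrow> f x \<in> encode_graph ` {G \<in> d_Cut_inputs C. \<exists>M. is_d_cut d G M}))"
proof -
  let ?kb = "\<lambda>s r. kb r s" and ?a1 = "\<lambda>s r. a1 r s" and ?a2 = "\<lambda>s r. a2 r s" and ?a3 = "\<lambda>s r. a3 r s"
  define sv where "sv \<sigma> s = slot_var d (rule_x (?a1 s) (?a2 s) (?a3 s)) (rule_y (?kb s) (?a2 s))
    (rule_b (?kb s)) (rule_p (?a3 s)) \<sigma>" for \<sigma> s
  define edge where "edge i j s \<longleftrightarrow> half_edge d (10 * n s) (\<lambda>\<sigma>. sv \<sigma> s) i j \<or> half_edge d (10 * n s) (\<lambda>\<sigma>. sv \<sigma> s) j i" for i j s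
  define N where "N s = 10 * n s * (2 * d + 1) * (2 * d + 4) + 10 * n s" for s
  have graph: "\<exists>G. G \<in> d_Cut_inputs C \<and> verts G = {..<N s} \<and>
      (\<forall>i<N s. \<forall>j<N s. {i, j} \<in> edges G \<longleftrightarrow> edge i j s) \<and>
      ((\<exists>M. is_d_cut d G M) \<longleftrightarrow> (\<exists>\<alpha>. satisfies (n s) (?kb s) (?a1 s) (?a2 s) (?a3 s) \<alpha>))" for s
  proof -
    interpret rule_system d "n s" "?kb s" "?a1 s" "?a2 s" "?a3 s"
      using d2 n1 kb01 by unfold_locales auto
    have N: "N s = slots * R + 10 * n s" by (simp add: N_def slots_def D_def R_def)
    show ?thesis
    proof (intro exI[of _ G] conjI allI impI)
      show "G \<in> d_Cut_inputs C" unfolding C_def by (rule gadget_input)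
      show "verts G = {..<N s}" unfolding N by (rule verts_gadget)
      show "{i, j} \<in> edges G \<longleftrightarrow> edge i j s" if "i < N s" "j < N s" for i j
        using edge_nat[of i j] that unfolding N edge_def sv_def by simp
    qed (rule d_cut_iff_satisfiable)
  qed
  have PF_sv: "PF M (\<lambda>s. sv (v s) s)" if "PF M v" for M v
    unfolding sv_def slot_var_def rule_x_def rule_y_def rule_b_def rule_p_def Let_def
    by (intro PF_PB_intros kb a1 a2 a3 that)
  have PB_half: "PB M (\<lambda>s. half_edge d (10 * n s) (\<lambda>\<sigma>. sv \<sigma> s) (v s) (w s))" if "PF M v" "PF M w" for M v w
    unfolding half_edge_def Let_def
    by (intro PF_PB_intros PF_sv that n PF_weaken[OF that(1)] PF_weaken[OF that(2)])
  have PF_N: "PF M N" for M unfolding N_def by (intro PF_PB_intros n)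
  have PB_edge: "PB M (\<lambda>s. edge (v s) (w s) s)" if "PF M v" "PF M w" for M v w
    unfolding edge_def by (intro PB_disj PB_half that)
  define f where "f x = map (\<lambda>k. let s = (x, [], env0) in k < N s \<or> N s < k \<and> edge ((k - N s - 1) div N s) ((k - N s - 1) mod N s) s)
    [0..<N (x, [], env0) + 1 + N (x, [], env0) * N (x, [], env0)]" for x
  have "polytime_computable f"
  proof (rule polytime_I)
    show "PF 0 (\<lambda>s. N s + 1 + N s * N s)" by (intro PF_PB_intros PF_N)
    show "PB M (\<lambda>s. v s < N s \<or> N s < v s \<and> edge ((v s - N s - 1) div N s) ((v s - N s - 1) mod N s) s)"
      if "PF M v" for M v
      by (intro PF_PB_intros PF_N PB_edge that)
  qed (simp add: f_def Let_def)
  moreover have "f x \<in> encode_graph ` d_Cut_inputs C \<and>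
    (x \<in> L \<longleftrightarrow> f x \<in> encode_graph ` {G \<in> d_Cut_inputs C. \<exists>M. is_d_cut d G M})" for x
  proof -
    let ?s = "(x, [], env0)"
    obtain G where G: "G \<in> d_Cut_inputs C" "verts G = {..<N ?s}"
      "\<And>i j. i < N ?s \<Longrightarrow> j < N ?s \<Longrightarrow> {i, j} \<in> edges G \<longleftrightarrow> edge i j ?s"
      "(\<exists>M. is_d_cut d G M) \<longleftrightarrow> x \<in> L"
      using graph[of ?s] L[of x] by auto
    have "f x = encode_graph G"
      unfolding f_def encode_graph_alt[OF G(2)] Let_def
    proof (rule map_cong[OF refl])
      fix k assume "k \<in> set [0..<N ?s + 1 + N ?s * N ?s]"
      then have k: "k < N ?s + 1 + N ?s * N ?s" by (simp only: set_upt atLeastLessThan_iff)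
      have "(k - N ?s - 1) div N ?s < N ?s" "(k - N ?s - 1) mod N ?s < N ?s" if "N ?s < k"
      proof -
        have *: "k - N ?s - 1 < N ?s * N ?s" using that k by simp
        then have "0 < N ?s" by (cases "N ?s") auto
        then show "(k - N ?s - 1) div N ?s < N ?s" "(k - N ?s - 1) mod N ?s < N ?s"
          using * by (auto simp: less_mult_imp_div_less)
      qed
      then show "(k < N ?s \<or> N ?s < k \<and> edge ((k - N ?s - 1) div N ?s) ((k - N ?s - 1) mod N ?s) ?s) =
          (k < N ?s \<or> N ?s < k \<and> {(k - N ?s - 1) div N ?s, (k - N ?s - 1) mod N ?s} \<in> edges G)"
        using G(3) by blast
    qed
    then have f: "f x = encode_graph G" .
    have "encode_graph G \<in> encode_graph ` {G \<in> d_Cut_inputs C. \<exists>M. is_d_cut d G M} \<longleftrightarrow> (\<exists>M. is_d_cut d G M)"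
    proof
      assume "encode_graph G \<in> encode_graph ` {G \<in> d_Cut_inputs C. \<exists>M. is_d_cut d G M}"
      then obtain H where "encode_graph G = encode_graph H" "H \<in> d_Cut_inputs C" "\<exists>M. is_d_cut d H M" by blast
      then show "\<exists>M. is_d_cut d G M" using encode_graph_inj[OF G(1)] by blast
    qed (use G(1) in blast)
    then show ?thesis unfolding f G(4)[symmetric] using G(1) by simp
  qed
  ultimately show ?thesis by blast
qed

section \<open>Rule schemas\<close>

text \<open>A schema stands for the rules obtained by instantiating a time \<open>t\<close> and a column \<open>c\<close>.\<close>

record schema =
  grd :: "st \<Rightarrow> nat \<Rightarrow> nat \<Rightarrow> bool"
  base :: nat
  ref1 :: "st \<Rightarrow> nat \<Rightarrow> nat \<Rightarrow> nat"
  ref2 :: "st \<Rightarrow> nat \<Rightarrow> nat \<Rightarrow> nat"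
  ref3 :: "st \<Rightarrow> nat \<Rightarrow> nat \<Rightarrow> nat"

definition computable_ref :: "(st \<Rightarrow> nat \<Rightarrow> nat \<Rightarrow> nat) \<Rightarrow> bool" where
  "computable_ref f \<longleftrightarrow> (\<forall>M v w. PF M v \<longrightarrow> PF M w \<longrightarrow> PF M (\<lambda>s. f s (v s) (w s)))"

definition computable_schema :: "schema \<Rightarrow> bool" where
  "computable_schema \<sigma> \<longleftrightarrow> (\<forall>M v w. PF M v \<longrightarrow> PF M w \<longrightarrow> PB M (\<lambda>s. grd \<sigma> s (v s) (w s))) \<and> base \<sigma> \<in> {0, 1} \<and>
     computable_ref (ref1 \<sigma>) \<and> computable_ref (ref2 \<sigma>) \<and> computable_ref (ref3 \<sigma>)"

text \<open>Rule number \<open>(t * P + c) * J + j\<close> is schema \<open>j\<close> at time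
  \<open>t\<close> and column \<open>c\<close>. The schemas are a fixed finite list, so
  \<open>PF_select\<close> can choose among them.\<close>

lemma computable_ref_select:
  assumes f: "\<And>\<sigma>. \<sigma> \<in> set \<sigma>s \<Longrightarrow> computable_ref (f \<sigma>)"
    and g: "\<And>\<sigma>. \<sigma> \<in> set \<sigma>s \<Longrightarrow> computable_schema \<sigma>" and J: "\<sigma>s \<noteq> []"
    and P: "\<And>M. PF M P" and v: "PF M v"
  shows "PF M (\<lambda>s. let j = v s mod length \<sigma>s; c = v s div length \<sigma>s mod P s; t = v s div length \<sigma>s div P s
    in if grd (\<sigma>s ! j) s t c then f (\<sigma>s ! j) s t c else 0)"
  unfolding Let_def
proof (rule PF_select[where n = "length \<sigma>s" and j = "\<lambda>s. v s mod length \<sigma>s" and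
      F = "\<lambda>i s. if grd (\<sigma>s ! i) s (v s div length \<sigma>s div P s) (v s div length \<sigma>s mod P s)
        then f (\<sigma>s ! i) s (v s div length \<sigma>s div P s) (v s div length \<sigma>s mod P s) else 0"])
  show "PF M (\<lambda>s. v s mod length \<sigma>s)" by (intro PF_PB_intros v)
  show "v s mod length \<sigma>s < length \<sigma>s" for s using J by simp
  fix i assume i: "i < length \<sigma>s"
  have t: "PF M (\<lambda>s. v s div length \<sigma>s div P s)" and c: "PF M (\<lambda>s. v s div length \<sigma>s mod P s)"
    by (intro PF_PB_intros v P)+
  show "PF M (\<lambda>s. if grd (\<sigma>s ! i) s (v s div length \<sigma>s div P s) (v s div length \<sigma>s mod P s)
      then f (\<sigma>s ! i) s (v s div length \<sigma>s div P s) (v s div length \<sigma>s mod P s) else 0)"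
  proof (rule PF_if[OF _ _ PF_const])
    show "PB M (\<lambda>s. grd (\<sigma>s ! i) s (v s div length \<sigma>s div P s) (v s div length \<sigma>s mod P s))"
      using g[of "\<sigma>s ! i"] i t c unfolding computable_schema_def by auto
    show "PF M (\<lambda>s. f (\<sigma>s ! i) s (v s div length \<sigma>s div P s) (v s div length \<sigma>s mod P s))"
      using f[of "\<sigma>s ! i"] i t c unfolding computable_ref_def by auto
  qed
qed

definition models :: "schema set \<Rightarrow> st \<Rightarrow> nat \<Rightarrow> nat \<Rightarrow> (nat \<Rightarrow> bool) \<Rightarrow> bool" where
  "models \<Sigma> s T P \<alpha> \<longleftrightarrow> \<alpha> 0 \<and> \<not> \<alpha> 1 \<and> (\<forall>\<sigma>\<in>\<Sigma>. \<forall>t\<le>T. \<forall>c<P. grd \<sigma> s t c \<longrightarrow>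
     rule_holds \<alpha> (base \<sigma>) (ref1 \<sigma> s t c) (ref2 \<sigma> s t c) (ref3 \<sigma> s t c))"

lemma schema_reduction:
  assumes d2: "d \<ge> 2" and fin: "finite \<Sigma>" and ne: "\<Sigma> \<noteq> {}" and comp: "\<And>\<sigma>. \<sigma> \<in> \<Sigma> \<Longrightarrow> computable_schema \<sigma>"
    and T: "\<And>M. PF M T" and P: "\<And>M. PF M P" and P1: "\<And>s. 1 \<le> P s"
    and L: "\<And>x. x \<in> L \<longleftrightarrow> (\<exists>\<alpha>. models \<Sigma> (x, [], env0) (T (x, [], env0)) (P (x, [], env0)) \<alpha>)"
  defines "C \<equiv> \<lambda>G. claw_free G \<and> max_degree G = 2 * d + 3"
  shows "\<exists>f. polytime_computable f \<and> (\<forall>x. f x \<in> encode_graph ` d_Cut_inputs C \<and>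
    (x \<in> L \<longleftrightarrow> f x \<in> encode_graph ` {G \<in> d_Cut_inputs C. \<exists>M. is_d_cut d G M}))"
proof -
  obtain \<sigma>s where \<sigma>s: "set \<sigma>s = \<Sigma>" using fin finite_list by blast
  have J: "\<sigma>s \<noteq> []" using ne \<sigma>s by auto
  let ?J = "length \<sigma>s"
  have J0: "0 < ?J" using J by simp
  \<comment> \<open>Where a guard fails, base and references all become 0, and the resulting rule
    holds trivially.\<close>
  let ?sel = "\<lambda>f r s. let j = r mod ?J; c = r div ?J mod P s; t = r div ?J div P s
    in if grd (\<sigma>s ! j) s t c then f (\<sigma>s ! j) s t c else 0 :: nat"
  have sel: "PF M (\<lambda>s. ?sel f (v s) s)" if "PF M v" "\<And>\<sigma>. \<sigma> \<in> \<Sigma> \<Longrightarrow> computable_ref (f \<sigma>)" for M v f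
    by (rule computable_ref_select[OF _ _ J P that(1)]) (use \<sigma>s comp that(2) in auto)
  have base: "computable_ref (\<lambda>s t c. base \<sigma>)" for \<sigma> unfolding computable_ref_def by (simp add: PF_const)
  have idx: "r div ?J div P s \<le> T s" "r div ?J mod P s < P s" if "r < (T s + 1) * P s * ?J" for r s
  proof -
    have "r div ?J < (T s + 1) * P s" using that by (simp add: less_mult_imp_div_less)
    then have "r div ?J div P s < T s + 1" by (rule less_mult_imp_div_less)
    then show "r div ?J div P s \<le> T s" by simp
    show "r div ?J mod P s < P s" using P1[of s] by simp
  qed
  show ?thesis
    unfolding C_def
  proof (rule reduction_I[where n = "\<lambda>s. (T s + 1) * P s * ?J" and kb = "?sel (\<lambda>\<sigma> s t c. base \<sigma>)"
        and ?a1.0 = "?sel ref1" and ?a2.0 = "?sel ref2" and ?a3.0 = "?sel ref3"])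
    show "PF M (\<lambda>s. (T s + 1) * P s * ?J)" for M by (intro PF_PB_intros T P)
    show "1 \<le> (T s + 1) * P s * ?J" for s using P1[of s] J0 by (simp add: Suc_le_eq)
    show "?sel (\<lambda>\<sigma> s t c. base \<sigma>) r s \<in> {0, 1}" for r s
    proof -
      have "\<sigma>s ! (r mod ?J) \<in> \<Sigma>" using \<sigma>s J0 by auto
      then have "base (\<sigma>s ! (r mod ?J)) \<in> {0, 1}" using comp unfolding computable_schema_def by blast
      then show ?thesis by (simp add: Let_def)
    qed
    show "2 \<le> d" by (rule d2)
    show "PF M (\<lambda>s. ?sel (\<lambda>\<sigma> s t c. base \<sigma>) (v s) s)" if "PF M v" for M v
      by (rule sel[OF that]) (rule base)
    show "PF M (\<lambda>s. ?sel ref1 (v s) s)" "PF M (\<lambda>s. ?sel ref2 (v s) s)" "PF M (\<lambda>s. ?sel ref3 (v s) s)"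
      if "PF M v" for M v
      by (rule sel[OF that]; use comp in \<open>simp add: computable_schema_def\<close>)+
    fix x :: "bool list"
    let ?s = "(x, [], env0)"
    have "models \<Sigma> ?s (T ?s) (P ?s) \<alpha> \<longleftrightarrow> satisfies ((T ?s + 1) * P ?s * ?J) (\<lambda>r. ?sel (\<lambda>\<sigma> s t c. base \<sigma>) r ?s)
      (\<lambda>r. ?sel ref1 r ?s) (\<lambda>r. ?sel ref2 r ?s) (\<lambda>r. ?sel ref3 r ?s) \<alpha>" (is "?l \<longleftrightarrow> ?r") for \<alpha>
    proof
      assume l: ?l
      have "rule_holds \<alpha> (?sel (\<lambda>\<sigma> s t c. base \<sigma>) r ?s) (?sel ref1 r ?s) (?sel ref2 r ?s) (?sel ref3 r ?s)"
        if r: "r < (T ?s + 1) * P ?s * ?J" for r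
      proof (cases "grd (\<sigma>s ! (r mod ?J)) ?s (r div ?J div P ?s) (r div ?J mod P ?s)")
        case True
        have "\<sigma>s ! (r mod ?J) \<in> \<Sigma>" using \<sigma>s J0 by auto
        then show ?thesis using l idx[OF r] True unfolding models_def by (simp add: Let_def)
      qed (simp add: Let_def rule_holds_def)
      then show ?r using l unfolding satisfies_def models_def by blast
    next
      assume r: ?r
      have "rule_holds \<alpha> (base \<sigma>) (ref1 \<sigma> ?s t c) (ref2 \<sigma> ?s t c) (ref3 \<sigma> ?s t c)"
        if \<sigma>: "\<sigma> \<in> \<Sigma>" and tc: "t \<le> T ?s" "c < P ?s" "grd \<sigma> ?s t c" for \<sigma> t c
      proof -
        obtain j where j: "j < ?J" "\<sigma> = \<sigma>s ! j" using \<sigma> \<sigma>s by (metis in_set_conv_nth)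
        let ?i = "(t * P ?s + c) * ?J + j"
        have "t * P ?s + c < Suc t * P ?s" using tc by simp
        also have "\<dots> \<le> (T ?s + 1) * P ?s" using tc by (intro mult_right_mono) auto
        finally have "Suc (t * P ?s + c) * ?J \<le> (T ?s + 1) * P ?s * ?J" by (intro mult_right_mono) auto
        then have "?i < (T ?s + 1) * P ?s * ?J" using j(1) by simp
        moreover have "(a * b + e) mod b = e" "(a * b + e) div b = a" if "e < b" for a b e :: nat using that by auto
        from this[OF j(1)] have "?i mod ?J = j" "?i div ?J = t * P ?s + c" .
        moreover have "(t * P ?s + c) div P ?s = t" "(t * P ?s + c) mod P ?s = c" using tc by auto
        ultimately show ?thesis using r tc(3) j(2) unfolding satisfies_def by (auto simp: Let_def)
      qed
      then show ?l using r unfolding satisfies_def models_def by blast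
    qed
    then show "x \<in> L \<longleftrightarrow> (\<exists>\<alpha>. satisfies ((T ?s + 1) * P ?s * ?J) (\<lambda>r. ?sel (\<lambda>\<sigma> s t c. base \<sigma>) r ?s)
      (\<lambda>r. ?sel ref1 r ?s) (\<lambda>r. ?sel ref2 r ?s) (\<lambda>r. ?sel ref3 r ?s) \<alpha>)"
      unfolding L by blast
  qed
qed

definition and_rule :: "(st \<Rightarrow> nat \<Rightarrow> nat \<Rightarrow> bool) \<Rightarrow> (st \<Rightarrow> nat \<Rightarrow> nat \<Rightarrow> nat) \<Rightarrow> (st \<Rightarrow> nat \<Rightarrow> nat \<Rightarrow> nat) \<Rightarrow> (st \<Rightarrow> nat \<Rightarrow> nat \<Rightarrow> nat) \<Rightarrow> schema" where
  "and_rule g h a b = \<lparr>grd = g, base = 0, ref1 = h, ref2 = a, ref3 = b\<rparr>"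

definition or_rule :: "(st \<Rightarrow> nat \<Rightarrow> nat \<Rightarrow> bool) \<Rightarrow> (st \<Rightarrow> nat \<Rightarrow> nat \<Rightarrow> nat) \<Rightarrow> (st \<Rightarrow> nat \<Rightarrow> nat \<Rightarrow> nat) \<Rightarrow> (st \<Rightarrow> nat \<Rightarrow> nat \<Rightarrow> nat) \<Rightarrow> schema" where
  "or_rule g h a b = \<lparr>grd = g, base = 1, ref1 = h, ref2 = a, ref3 = b\<rparr>"

lemma models_and_rule:
  assumes "models \<Sigma> s T P \<alpha>" "and_rule g h a b \<in> \<Sigma>" "t \<le> T" "c < P" "g s t c" "\<alpha> (a s t c)" "\<alpha> (b s t c)"
  shows "\<alpha> (h s t c)"
  using assms unfolding models_def and_rule_def rule_holds_def by fastforce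

lemma models_or_rule:
  assumes "models \<Sigma> s T P \<alpha>" "or_rule g h a b \<in> \<Sigma>" "t \<le> T" "c < P" "g s t c" "\<alpha> (h s t c)"
  shows "\<alpha> (a s t c) \<or> \<alpha> (b s t c)"
  using assms unfolding models_def or_rule_def rule_holds_def by fastforce

section \<open>Computations as rule systems\<close>

text \<open>Tapes are stored relative to the head position, which is always column \<open>T + 1\<close>; a move shifts the
  whole tape.  Hence only the columns at distance at most \<open>T - t\<close> from the head are known at time \<open>t\<close>.\<close>

fun shift :: "move \<Rightarrow> nat \<Rightarrow> nat" where
  "shift MoveLeft c = c + 1" | "shift Stay c = c" | "shift MoveRight c = c - 1"

fun state_code :: "nat \<Rightarrow> tm_state \<Rightarrow> nat" where
  "state_code n (Work q) = q" | "state_code n Accept = n" | "state_code n Reject = n + 1"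

locale np_machine =
  fixes M :: tm and p q :: "nat poly"
  assumes wf: "wf_tm M" and tapes: "num_tapes M \<ge> 2"
begin

abbreviation "k \<equiv> num_tapes M"
abbreviation "Q \<equiv> num_states M"
abbreviation "S \<equiv> num_symbols M"

definition T :: "st \<Rightarrow> nat" where "T s = poly q (length (fst s))"
text \<open>There are \<open>T\<close> columns on either side of the centre \<open>T + 1\<close> and
  a spare one at each end, so that shifted columns stay in range.\<close>

definition P :: "st \<Rightarrow> nat" where "P s = 2 * T s + 3"

text \<open>Numbers 0 and 1 are reserved for true and false. There are \<open>T s + 2\<close> times
  because rules at time \<open>T s\<close> still refer to the next one.\<close>

definition ident :: "nat \<times> nat \<times> nat list \<Rightarrow> nat \<Rightarrow> nat \<Rightarrow> st \<Rightarrow> nat" where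
  "ident w t c s = 2 + to_nat w * ((T s + 2) * P s) + (t * P s + c)"

text \<open>\<open>cell i a\<close>: tape \<open>i\<close> holds \<open>a\<close>.  \<open>seen z l\<close>: the state is \<open>z\<close> and the first tapes scan the symbols \<open>l\<close>.
  \<open>nonblank\<close>: the cell belongs to the certificate.\<close>

definition cell :: "nat \<Rightarrow> nat \<Rightarrow> nat \<times> nat \<times> nat list" where "cell i a = (0, i, [a])"
definition seen :: "nat \<Rightarrow> nat list \<Rightarrow> nat \<times> nat \<times> nat list" where "seen z l = (1, z, l)"
definition nonblank :: "nat \<times> nat \<times> nat list" where "nonblank = (2, 0, [])"

abbreviation (input) "vTrue \<equiv> \<lambda>(s :: st) (t :: nat) (c :: nat). 0 :: nat"
abbreviation (input) "vFalse \<equiv> \<lambda>(s :: st) (t :: nat) (c :: nat). 1 :: nat"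
abbreviation (input) "vSeen z l \<equiv> \<lambda>s t (c :: nat). ident (seen z l) t 0 s"
abbreviation (input) "vSeen' z l \<equiv> \<lambda>s t (c :: nat). ident (seen z l) (t + 1) 0 s"
abbreviation (input) "vCell i a \<equiv> \<lambda>s t c. ident (cell i a) t c s"

definition words :: "nat list set" where
  "words = {l. set l \<subseteq> {..<S} \<and> length l \<le> k}"

text \<open>A rule has only two premises, so the scanned symbols are collected tape by tape.\<close>

definition scan_rules :: "schema set" where
  "scan_rules = (\<lambda>(z, l, a). and_rule (\<lambda>s t c. True) (vSeen z (l @ [a])) (vSeen z l)
     (\<lambda>s t c. ident (cell (length l) a) t (T s + 1) s)) ` ({..<Q} \<times> {l \<in> words. length l < k} \<times> {..<S})"

text \<open>The second family carries a halting state on to time \<open>T\<close>; the tapes are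
  abandoned, as only the state is inspected there.\<close>

definition state_rules :: "schema set" where
  "state_rules = (\<lambda>(z, l). and_rule (\<lambda>s t c. True) (vSeen' (state_code Q (fst (delta M z l))) []) (vSeen z l) vTrue)
     ` ({..<Q} \<times> {l \<in> words. length l = k}) \<union>
     (\<lambda>z. and_rule (\<lambda>s t c. True) (vSeen' z []) (vSeen z []) vTrue) ` {Q, Q + 1}"

text \<open>The range of \<open>c\<close> keeps the shifted column inside the table and the
  subtraction in \<open>shift\<close> exact.\<close>

definition move_rules :: "schema set" where
  "move_rules = (\<lambda>(z, l, i, a). and_rule (\<lambda>s t c. c \<noteq> T s + 1 \<and> 1 \<le> c \<and> c + 1 < P s)
       (\<lambda>s t c. ident (cell i a) (t + 1) (shift (snd (snd (delta M z l) ! i)) c) s) (vSeen z l) (vCell i a))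
     ` ({..<Q} \<times> {l \<in> words. length l = k} \<times> {..<k} \<times> {..<S})"

definition write_rules :: "schema set" where
  "write_rules = (\<lambda>(z, l, i). and_rule (\<lambda>s t c. True)
       (\<lambda>s t c. ident (cell i (fst (snd (delta M z l) ! i))) (t + 1) (shift (snd (snd (delta M z l) ! i)) (T s + 1)) s)
       (vSeen z l) vTrue)
     ` ({..<Q} \<times> {l \<in> words. length l = k} \<times> {..<k})"

text \<open>The only rules that conclude false: a derived state other than accepting at time
  \<open>T\<close> refutes the assignment.\<close>

definition final_rules :: "schema set" where
  "final_rules = (\<lambda>z. and_rule (\<lambda>s t c. t = T s) vFalse (vSeen z []) vTrue) ` {z \<in> {..Q + 1}. z \<noteq> Q}"

definition init_rules :: "schema set" where
  "init_rules = {and_rule (\<lambda>s t c. t = 0) (vSeen 0 []) vTrue vTrue} \<union>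
     (\<lambda>i. and_rule (\<lambda>s t c. t = 0) (vCell i 0) vTrue vTrue) ` {2..<k} \<union>
     {and_rule (\<lambda>s t c. t = 0 \<and> (c < T s + 1 \<or> length (fst s) \<le> c - (T s + 1))) (vCell 0 0) vTrue vTrue,
      and_rule (\<lambda>s t c. t = 0 \<and> T s + 1 \<le> c \<and> c - (T s + 1) < length (fst s) \<and> \<not> bit_at (fst s) (c - (T s + 1)))
        (vCell 0 1) vTrue vTrue,
      and_rule (\<lambda>s t c. t = 0 \<and> T s + 1 \<le> c \<and> bit_at (fst s) (c - (T s + 1))) (vCell 0 2) vTrue vTrue}"

text \<open>A cell may carry several symbols. Enforced is only what extracting a word requires: some
  symbol in every certificate cell, and blanks extending to the right, so that the first blank ends
  the word. \<open>nonblank\<close> splits the three-way choice into two binary ones.\<close>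

definition guess_rules :: "schema set" where
  "guess_rules =
     {and_rule (\<lambda>s t c. t = 0 \<and> (c < T s + 1 \<or> poly p (length (fst s)) \<le> c - (T s + 1))) (vCell 1 0) vTrue vTrue,
      or_rule (\<lambda>s t c. t = 0 \<and> T s + 1 \<le> c \<and> c - (T s + 1) < poly p (length (fst s)))
        vTrue (vCell 1 0) (\<lambda>s t c. ident nonblank t c s),
      or_rule (\<lambda>s t c. t = 0) (\<lambda>s t c. ident nonblank t c s) (vCell 1 1) (vCell 1 2),
      and_rule (\<lambda>s t c. t = 0 \<and> T s + 1 \<le> c \<and> c + 1 < P s)
        (\<lambda>s t c. ident (cell 1 0) t (c + 1) s) (vCell 1 0) vTrue}"

definition rules :: "schema set" where
  "rules = scan_rules \<union> state_rules \<union> move_rules \<union> write_rules \<union> final_rules \<union> init_rules \<union> guess_rules"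

lemma finite_words: "finite words"
  unfolding words_def by (rule finite_lists_length_le) simp

lemma finite_rules: "finite rules"
  unfolding rules_def scan_rules_def state_rules_def move_rules_def write_rules_def final_rules_def
    init_rules_def guess_rules_def
  using finite_words by auto

lemma rules_nonempty: "rules \<noteq> {}"
  unfolding rules_def init_rules_def by blast

lemma PF_T: "PF N T"
  unfolding T_def by (intro PF_poly PF_len)

lemma PF_P: "PF N P"
  unfolding P_def by (intro PF_PB_intros PF_T)

lemma PF_ident: "PF N t \<Longrightarrow> PF N c \<Longrightarrow> PF N (\<lambda>s. ident w (t s) (c s) s)"
  unfolding ident_def by (intro PF_PB_intros PF_T PF_P)

lemma PF_shift:
  assumes "PF N c"
  shows "PF N (\<lambda>s. shift m (c s))"
proof (cases m)
  case MoveLeft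
  show ?thesis unfolding MoveLeft shift.simps by (intro PF_add PF_const assms)
next
  case MoveRight
  show ?thesis unfolding MoveRight shift.simps by (intro PF_diff PF_const assms)
qed (use assms in simp)

lemma computable_rules: "\<sigma> \<in> rules \<Longrightarrow> computable_schema \<sigma>"
  unfolding rules_def scan_rules_def state_rules_def move_rules_def write_rules_def final_rules_def
    init_rules_def guess_rules_def
  by (auto simp: computable_schema_def computable_ref_def and_rule_def or_rule_def
      intro!: PF_PB_intros PF_ident PF_T PF_P PF_shift PF_len PB_bit simp del: One_nat_def)

end

section \<open>Runs as models of the rules, and models containing runs\<close>

context np_machine
begin

lemma wf_delta:
  assumes "z < Q" "length l = k" "set l \<subseteq> {..<S}"
  shows "fst (delta M z l) = Work r \<Longrightarrow> r < Q" "length (snd (delta M z l)) = k"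
    "i < k \<Longrightarrow> fst (snd (delta M z l) ! i) < S"
proof -
  have *: "case delta M z l of (q', acts) \<Rightarrow> (\<forall>r. q' = Work r \<longrightarrow> r < Q) \<and> length acts = k \<and> (\<forall>(s, m)\<in>set acts. s < S)"
  proof -
    have all: "\<forall>z<Q. \<forall>l. length l = k \<and> (\<forall>s\<in>set l. s < S) \<longrightarrow> (case delta M z l of (q', acts) \<Rightarrow>
        (\<forall>r. q' = Work r \<longrightarrow> r < Q) \<and> length acts = k \<and> (\<forall>(s, m)\<in>set acts. s < S))"
      using wf unfolding wf_tm_def by (elim conjE)
    have "\<forall>s\<in>set l. s < S" using assms(3) by auto
    with assms(2) have "length l = k \<and> (\<forall>s\<in>set l. s < S)" by (rule conjI)
    then show ?thesis by (rule all[THEN spec, THEN mp, OF assms(1), THEN spec, THEN mp])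
  qed
  then show "fst (delta M z l) = Work r \<Longrightarrow> r < Q" "length (snd (delta M z l)) = k" by auto
  show "fst (snd (delta M z l) ! i) < S" if "i < k"
    using * that by (metis (mono_tags, lifting) case_prod_beta nth_mem)
qed

context
  fixes x u :: "bool list"
begin

abbreviation "st t \<equiv> fst (tm_run M [x, u] t)"
abbreviation "tp t \<equiv> snd (tm_run M [x, u] t)"

definition scan :: "nat \<Rightarrow> nat list" where
  "scan t = map (\<lambda>(c, h). c h) (tp t)"

abbreviation (input) "s0 \<equiv> (x, [] :: bool list, env0)"

abbreviation "cen \<equiv> T s0 + 1"

definition val :: "nat \<Rightarrow> nat \<Rightarrow> nat \<Rightarrow> nat" where
  "val t i c = fst (tp t ! i) (snd (tp t ! i) + (int c - int cen))"

lemma run_Suc: "tm_run M [x, u] (Suc t) = tm_step M (tm_run M [x, u] t)"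
  by (simp add: tm_run_def)

lemma run_0: "st 0 = Work 0" "i < k \<Longrightarrow> tp 0 ! i = (word_contents (if i < 2 then [x, u] ! i else []), 0)"
    "length (tp 0) = k"
  by (simp_all add: tm_run_def tm_init_def numeral_2_eq_2)

lemma run_Work:
  assumes "st t = Work z"
  shows "st (Suc t) = fst (delta M z (scan t))" "tp (Suc t) = map2 act (snd (delta M z (scan t))) (tp t)"
proof -
  have run: "tm_run M [x, u] t = (Work z, tp t)" using assms by (metis prod.collapse)
  have step: "tm_step M (Work z, ts) = (fst (delta M z (map (\<lambda>(c, h). c h) ts)), map2 act (snd (delta M z (map (\<lambda>(c, h). c h) ts))) ts)" for ts
    by (simp add: tm_step.simps split: prod.split)
  have "tm_run M [x, u] (Suc t) = (fst (delta M z (scan t)), map2 act (snd (delta M z (scan t))) (tp t))"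
    by (simp only: run_Suc scan_def step[symmetric] run[symmetric])
  then show "st (Suc t) = fst (delta M z (scan t))" "tp (Suc t) = map2 act (snd (delta M z (scan t))) (tp t)"
    by simp_all
qed

lemma run_halted: "st t = Accept \<or> st t = Reject \<Longrightarrow> tm_run M [x, u] (Suc t) = tm_run M [x, u] t"
  unfolding run_Suc by (rule tm_step_halted) auto

lemma run_wf: "length (tp t) = k" "i < k \<Longrightarrow> fst (tp t ! i) j < S" "st t = Work r \<Longrightarrow> r < Q"
proof -
  have "length (tp t) = k \<and> (\<forall>i<k. \<forall>j. fst (tp t ! i) j < S) \<and> (\<forall>r. st t = Work r \<longrightarrow> r < Q)"
  proof (induction t)
    case 0
    have "word_contents w j < S" for w j using wf by (auto simp: wf_tm_def word_contents_def)
    moreover have "0 < Q" using wf by (simp add: wf_tm_def)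
    ultimately show ?case using run_0 by auto
  next
    case (Suc t)
    show ?case
    proof (cases "st t")
      case (Work z)
      have "scan t ! i < S" if "i < k" for i using Suc that by (simp add: scan_def case_prod_unfold)
      then have l: "length (scan t) = k" "set (scan t) \<subseteq> {..<S}" "z < Q"
        using Suc Work by (auto simp: scan_def set_conv_nth)
      have act: "fst (act am tc) j < S" if "fst am < S" "\<And>j. fst tc j < S" for am tc j
        using that by (cases am; cases tc) auto
      have nth: "tp (Suc t) ! i = act (snd (delta M z (scan t)) ! i) (tp t ! i)" if "i < k" for i
        using that Suc run_Work(2)[OF Work] wf_delta(2)[OF l(3,1,2)] by simp
      have "length (tp (Suc t)) = k" using Suc run_Work(2)[OF Work] wf_delta(2)[OF l(3,1,2)] by simp
      moreover have "fst (tp (Suc t) ! i) j < S" if "i < k" for i j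
        unfolding nth[OF that] by (rule act) (use that Suc wf_delta(3)[OF l(3,1,2)] in auto)
      moreover have "r < Q" if "st (Suc t) = Work r" for r
        using that run_Work(1)[OF Work] wf_delta(1)[OF l(3,1,2)] by metis
      ultimately show ?thesis by blast
    qed (use Suc run_halted[of t] in auto)
  qed
  then show "length (tp t) = k" "i < k \<Longrightarrow> fst (tp t ! i) j < S" "st t = Work r \<Longrightarrow> r < Q" by blast+
qed

lemma scan_wf: "length (scan t) = k" "set (scan t) \<subseteq> {..<S}" "scan t \<in> words"
proof -
  have "scan t ! i < S" if "i < k" for i using run_wf that by (simp add: scan_def case_prod_unfold)
  then show "length (scan t) = k" "set (scan t) \<subseteq> {..<S}"
    using run_wf(1) by (auto simp: scan_def set_conv_nth)
  then show "scan t \<in> words" by (simp add: words_def)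
qed

lemma val_less: "i < k \<Longrightarrow> val t i c < S"
  unfolding val_def by (rule run_wf)

lemma val_cen: "i < k \<Longrightarrow> val t i cen = scan t ! i"
  using run_wf(1) by (simp add: val_def scan_def case_prod_unfold)

text \<open>When the head moves right, contents move one column to the left;
  \<open>1 \<le> c\<close> keeps that subtraction exact.\<close>

lemma val_step:
  assumes "st t = Work z" "i < k" "1 \<le> c"
  shows "val (Suc t) i (shift (snd (snd (delta M z (scan t)) ! i)) c) =
    (if c = cen then fst (snd (delta M z (scan t)) ! i) else val t i c)"
proof -
  let ?a = "snd (delta M z (scan t)) ! i"
  obtain a m where am: "?a = (a, m)" by (cases ?a)
  obtain f h where fh: "tp t ! i = (f, h)" by (cases "tp t ! i")
  have "tp (Suc t) ! i = act ?a (tp t ! i)"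
    using run_Work[OF assms(1)] run_wf(1)[of t] wf_delta(2)[OF run_wf(3)[OF assms(1)] scan_wf(1,2)] assms(2)
    by simp
  then show ?thesis
    using am fh assms(3) by (cases m) (auto simp: val_def algebra_simps of_nat_diff)
qed

lemma val_0:
  assumes "i < k"
  shows "val 0 i c = word_contents (if i = 0 then x else if i = 1 then u else []) (int c - int cen)"
  using run_0(2)[OF assms] by (auto simp: val_def numeral_2_eq_2 less_Suc_eq)

definition truth :: "nat \<times> nat \<times> nat list \<Rightarrow> nat \<Rightarrow> nat \<Rightarrow> bool" where
  "truth = (\<lambda>(g, a, l) t c. if g = 0 then l = [val t a c]
     else if g = 1 then state_code Q (st t) = a \<and> l = take (length l) (scan t) else val t 1 c \<noteq> 0)"

lemma truth_simps:
  "truth (cell i a) t c \<longleftrightarrow> val t i c = a"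
  "truth (seen z l) t c \<longleftrightarrow> state_code Q (st t) = z \<and> l = take (length l) (scan t)"
  "truth nonblank t c \<longleftrightarrow> val t 1 c \<noteq> 0"
  by (auto simp: truth_def cell_def seen_def nonblank_def)

text \<open>Inverse of \<open>ident\<close>: division and remainder recover time and column, and
  \<open>from_nat\<close> recovers the description \<open>w\<close>.\<close>

definition assignment :: "nat \<Rightarrow> bool" where
  "assignment v \<longleftrightarrow> v = 0 \<or> 2 \<le> v \<and>
     truth (from_nat ((v - 2) div ((T s0 + 2) * P s0)))
       ((v - 2) mod ((T s0 + 2) * P s0) div P s0) ((v - 2) mod ((T s0 + 2) * P s0) mod P s0)"

lemma assignment_ident:
  assumes "t \<le> T s0 + 1" "c < P s0"
  shows "assignment (ident w t c s0) \<longleftrightarrow> truth w t c"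
proof -
  let ?B = "(T s0 + 2) * P s0"
  have "t * P s0 + c < Suc t * P s0" using assms by simp
  also have "\<dots> \<le> ?B" using assms by (intro mult_right_mono) auto
  finally have less: "t * P s0 + c < ?B" .
  have "(a * b + e) div b = a" "(a * b + e) mod b = e" if "e < b" for a b e :: nat using that by auto
  from this[OF less] have "(ident w t c s0 - 2) div ?B = to_nat w" "(ident w t c s0 - 2) mod ?B = t * P s0 + c"
    unfolding ident_def by simp_all
  moreover have "(t * P s0 + c) div P s0 = t" "(t * P s0 + c) mod P s0 = c" using assms by auto
  moreover have "ident w t c s0 \<noteq> 0" "2 \<le> ident w t c s0" by (auto simp: ident_def)
  ultimately show ?thesis unfolding assignment_def by simp
qed

lemma state_code_Work: "state_code Q (st t) = z \<Longrightarrow> z < Q \<Longrightarrow> st t = Work z"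
  by (cases "st t") auto

lemma shift_less: "c + 1 < P s \<Longrightarrow> shift m c < P s"
  by (cases m) auto

lemma cen_less: "cen + 1 < P s0"
  by (simp add: P_def)

lemma zero_less_P: "0 < P s0"
  by (simp add: P_def)

text \<open>The part of \<open>models\<close> that concerns a single schema, so that each family of
  rules can be verified on its own.\<close>

definition holds :: "schema \<Rightarrow> bool" where
  "holds \<sigma> \<longleftrightarrow> (\<forall>t\<le>T s0. \<forall>c<P s0. grd \<sigma> s0 t c \<longrightarrow>
     rule_holds assignment (base \<sigma>) (ref1 \<sigma> s0 t c) (ref2 \<sigma> s0 t c) (ref3 \<sigma> s0 t c))"

lemma assignment_const: "assignment 0" "\<not> assignment 1"
  by (simp_all add: assignment_def)

lemma holds_and_ruleI:
  assumes "\<And>t c. t \<le> T s0 \<Longrightarrow> c < P s0 \<Longrightarrow> g s0 t c \<Longrightarrow> assignment (a s0 t c) \<Longrightarrow> assignment (b s0 t c) \<Longrightarrow>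
    assignment (h s0 t c)"
  shows "holds (and_rule g h a b)"
  using assms unfolding holds_def and_rule_def rule_holds_def using assignment_const by auto

lemma holds_or_ruleI:
  assumes "\<And>t c. t \<le> T s0 \<Longrightarrow> c < P s0 \<Longrightarrow> g s0 t c \<Longrightarrow> assignment (h s0 t c) \<Longrightarrow>
    assignment (a s0 t c) \<or> assignment (b s0 t c)"
  shows "holds (or_rule g h a b)"
  using assms unfolding holds_def or_rule_def rule_holds_def using assignment_const by auto

lemma holds_scan: "\<sigma> \<in> scan_rules \<Longrightarrow> holds \<sigma>"
  unfolding scan_rules_def
proof (elim imageE, clarify, rule holds_and_ruleI)
  fix z l a t c
  assume l: "length l < k" and t: "t \<le> T s0"
    and 1: "assignment (ident (seen z l) t 0 s0)" and 2: "assignment (ident (cell (length l) a) t (T s0 + 1) s0)"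
  have s: "state_code Q (st t) = z" "l = take (length l) (scan t)" and v: "val t (length l) cen = a"
    using 1 2 t zero_less_P cen_less by (auto simp: assignment_ident truth_simps)
  have "take (Suc (length l)) (scan t) = l @ [a]"
    using s(2) v val_cen[OF l] scan_wf(1)[of t] l by (metis take_Suc_conv_app_nth)
  then show "assignment (ident (seen z (l @ [a])) t 0 s0)"
    using s t zero_less_P by (simp add: assignment_ident truth_simps)
qed

lemma seenD:
  assumes "t \<le> T s0" "assignment (ident (seen z l) t 0 s0)" "z < Q" "length l = k"
  shows "st t = Work z" "l = scan t"
  using assms zero_less_P scan_wf(1)[of t] state_code_Work by (auto simp: assignment_ident truth_simps)

lemma holds_state: "\<sigma> \<in> state_rules \<Longrightarrow> holds \<sigma>"
  unfolding state_rules_def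
proof (elim UnE imageE; clarify; rule holds_and_ruleI)
  fix z l t c
  assume z: "z < Q" and l: "l \<in> words" "length l = k" and t: "t \<le> T s0"
    and 1: "assignment (ident (seen z l) t 0 s0)"
  have "st t = Work z" "l = scan t" using seenD[OF t 1] z l by auto
  then have "st (Suc t) = fst (delta M z l)" using run_Work by simp
  then show "assignment (ident (seen (state_code Q (fst (delta M z l))) []) (t + 1) 0 s0)"
    using t zero_less_P by (simp add: assignment_ident truth_simps)
next
  fix z t c
  assume z: "z \<in> {Q, Q + 1}" and t: "t \<le> T s0" and 1: "assignment (ident (seen z []) t 0 s0)"
  have s: "state_code Q (st t) = z" using 1 t zero_less_P by (simp add: assignment_ident truth_simps)
  then have "st t = Accept \<or> st t = Reject" using z run_wf(3)[of t] by (cases "st t") auto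
  then have "st (Suc t) = st t" using run_halted by simp
  then show "assignment (ident (seen z []) (t + 1) 0 s0)"
    using s t zero_less_P by (simp add: assignment_ident truth_simps)
qed

lemma holds_move: "\<sigma> \<in> move_rules \<Longrightarrow> holds \<sigma>"
  unfolding move_rules_def
proof (elim imageE, clarify, rule holds_and_ruleI)
  fix z l i a t c
  assume z: "z < Q" and l: "l \<in> words" "length l = k" and i: "i < k" and t: "t \<le> T s0" and c: "c < P s0"
    and g: "c \<noteq> T s0 + 1 \<and> 1 \<le> c \<and> c + 1 < P s0"
    and 1: "assignment (ident (seen z l) t 0 s0)" and 2: "assignment (ident (cell i a) t c s0)"
  have w: "st t = Work z" "l = scan t" using seenD[OF t 1] z l by auto
  have "val t i c = a" using 2 t c by (simp add: assignment_ident truth_simps)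
  then show "assignment (ident (cell i a) (t + 1) (shift (snd (snd (delta M z l) ! i)) c) s0)"
    using val_step[OF w(1), of i c] i g w(2) t shift_less[of c s0] by (simp add: assignment_ident truth_simps)
qed

lemma holds_write: "\<sigma> \<in> write_rules \<Longrightarrow> holds \<sigma>"
  unfolding write_rules_def
proof (elim imageE, clarify, rule holds_and_ruleI)
  fix z l i t c
  assume z: "z < Q" and l: "l \<in> words" "length l = k" and i: "i < k" and t: "t \<le> T s0"
    and 1: "assignment (ident (seen z l) t 0 s0)"
  have w: "st t = Work z" "l = scan t" using seenD[OF t 1] z l by auto
  show "assignment (ident (cell i (fst (snd (delta M z l) ! i))) (t + 1)
      (shift (snd (snd (delta M z l) ! i)) (T s0 + 1)) s0)"
    using val_step[OF w(1), of i cen] i w(2) t shift_less[OF cen_less] by (simp add: assignment_ident truth_simps)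
qed

lemma holds_final:
  assumes "st (T s0) = Accept"
  shows "\<sigma> \<in> final_rules \<Longrightarrow> holds \<sigma>"
  unfolding final_rules_def
proof (elim imageE, clarify, rule holds_and_ruleI)
  fix z t c
  assume z: "z \<noteq> Q" and t: "t = T s0" and 1: "assignment (ident (seen z []) t 0 s0)"
  have "state_code Q (st t) = z" using 1 t zero_less_P by (simp add: assignment_ident truth_simps)
  then show "assignment 1" using z t assms by simp
qed

lemma holds_init: "\<sigma> \<in> init_rules \<Longrightarrow> holds \<sigma>"
proof -
  have k: "0 < k" using tapes by simp
  show "\<sigma> \<in> init_rules \<Longrightarrow> holds \<sigma>"
    unfolding init_rules_def
    by (auto intro!: holds_and_ruleI simp: assignment_const(1) assignment_ident truth_simps run_0 val_0 k zero_less_P word_contents_def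
        bit_at_def nat_diff_distrib' nat_add_distrib)
qed

text \<open>The length bound on \<open>u\<close> makes all cells at distance
  \<open>poly p (length x)\<close> or more to the right of the start blank.\<close>

lemma holds_guess:
  assumes "length u \<le> poly p (length x)"
  shows "\<sigma> \<in> guess_rules \<Longrightarrow> holds \<sigma>"
proof -
  have k: "Suc 0 < k" using tapes by simp
  show "\<sigma> \<in> guess_rules \<Longrightarrow> holds \<sigma>"
    unfolding guess_rules_def using assms
    by (auto intro!: holds_and_ruleI holds_or_ruleI simp: assignment_const(1) assignment_ident truth_simps val_0 k word_contents_def
        nat_diff_distrib' nat_add_distrib split: if_splits)
qed

lemma complete:
  assumes "length u \<le> poly p (length x)" "accepts_within M [x, u] (poly q (length x))"
  shows "models rules s0 (T s0) (P s0) assignment"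
proof -
  have "st (T s0) = Accept" using assms(2) by (simp add: accepts_within_def T_def)
  then have "holds \<sigma>" if "\<sigma> \<in> rules" for \<sigma>
    using that holds_scan holds_state holds_move holds_write holds_final holds_init holds_guess[OF assms(1)]
    unfolding rules_def by blast
  then show ?thesis unfolding models_def holds_def using assignment_const by auto
qed

text \<open>With the initial tapes given, the rules are Horn rules, so every fact of the run holds
  in \<open>\<alpha>\<close>, whatever else does. A run that fails to accept would thus trigger a
  final rule.\<close>

lemma sound_run:
  assumes mod: "models rules s0 (T s0) (P s0) \<alpha>"
    and init: "\<And>i c. i < k \<Longrightarrow> 1 \<le> c \<Longrightarrow> c \<le> 2 * T s0 + 1 \<Longrightarrow> \<alpha> (ident (cell i (val 0 i c)) 0 c s0)"
  shows "accepts_within M [x, u] (T s0)"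
proof -
  have \<alpha>: "\<alpha> 0" "\<not> \<alpha> 1" using mod by (auto simp: models_def)
  \<comment> \<open>Each step loses one column on both sides, because a border cell may be shifted
    in from outside; up to time \<open>T\<close> the centre remains known.\<close>
  have inv: "\<alpha> (ident (seen (state_code Q (st t)) []) t 0 s0) \<and>
      ((\<exists>z. st t = Work z) \<longrightarrow> (\<forall>i<k. \<forall>c. t + 1 \<le> c \<and> c + t \<le> 2 * T s0 + 1 \<longrightarrow> \<alpha> (ident (cell i (val t i c)) t c s0)))"
    if "t \<le> T s0" for t
    using that
  proof (induction t)
    case 0
    have "and_rule (\<lambda>s t c. t = 0) (vSeen 0 []) vTrue vTrue \<in> rules" by (simp add: rules_def init_rules_def)
    from models_and_rule[OF mod this, of 0 0] have "\<alpha> (ident (seen 0 []) 0 0 s0)"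
      using \<alpha> zero_less_P by simp
    then show ?case using init run_0(1) by simp
  next
    case (Suc t)
    then have t: "t \<le> T s0" "Suc t \<le> T s0" by auto
    note IH = Suc.IH[OF t(1)]
    have halted: "\<alpha> (ident (seen z []) (Suc t) 0 s0)" if z: "z \<in> {Q, Q + 1}" "\<alpha> (ident (seen z []) t 0 s0)" for z
    proof -
      have "and_rule (\<lambda>s t c. True) (vSeen' z []) (vSeen z []) vTrue \<in> rules"
        unfolding rules_def state_rules_def using z(1) by blast
      from models_and_rule[OF mod this t(1) zero_less_P] show ?thesis using z(2) \<alpha> by simp
    qed
    show ?case
    proof (cases "st t")
      case (Work z)
      have z: "z < Q" using run_wf(3)[OF Work] .
      have cells: "\<alpha> (ident (cell i (val t i c)) t c s0)" if "i < k" "t + 1 \<le> c" "c + t \<le> 2 * T s0 + 1" for i c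
        using IH Work that by blast
      let ?l = "scan t"
      have "\<alpha> (ident (seen z (take i ?l)) t 0 s0)" if "i \<le> k" for i
        using that
      proof (induction i)
        case 0
        then show ?case using IH Work by simp
      next
        case (Suc i)
        let ?t = "take i ?l"
        have i: "i < k" "length ?t = i" using Suc scan_wf(1)[of t] by auto
        have nth: "?l ! i < S" using scan_wf(1,2)[of t] i(1) by (metis lessThan_iff nth_mem subsetD)
        have "and_rule (\<lambda>s t c. True) (vSeen z (?t @ [?l ! i])) (vSeen z ?t)
            (\<lambda>s t c. ident (cell (length ?t) (?l ! i)) t (T s + 1) s) \<in> scan_rules"
          unfolding scan_rules_def using z nth scan_wf(2)[of t] i set_take_subset[of i ?l]
          by (intro image_eqI[of _ _ "(z, ?t, ?l ! i)"]) (auto simp: words_def)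
        then have "and_rule (\<lambda>s t c. True) (vSeen z (?t @ [?l ! i])) (vSeen z ?t)
            (\<lambda>s t c. ident (cell (length ?t) (?l ! i)) t (T s + 1) s) \<in> rules" by (simp add: rules_def)
        from models_and_rule[OF mod this t(1) zero_less_P]
        have "\<alpha> (ident (seen z (?t @ [?l ! i])) t 0 s0)"
          using Suc cells[of i cen] i t val_cen[OF i(1), of t] by simp
        then show ?case using take_Suc_conv_app_nth[of i ?l] i scan_wf(1)[of t] by simp
      qed
      from this[of k] have seen: "\<alpha> (ident (seen z ?l) t 0 s0)" using scan_wf(1)[of t] by simp
      have l: "?l \<in> {l \<in> words. length l = k}" using scan_wf by simp
      let ?a = "delta M z ?l"
      have "and_rule (\<lambda>s t c. True) (vSeen' (state_code Q (fst ?a)) []) (vSeen z ?l) vTrue \<in> rules"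
        unfolding rules_def state_rules_def using z l by (auto intro!: image_eqI[of _ _ "(z, ?l)"])
      from models_and_rule[OF mod this t(1) zero_less_P]
      have st: "\<alpha> (ident (seen (state_code Q (st (Suc t))) []) (Suc t) 0 s0)"
        using seen \<alpha> run_Work(1)[OF Work] by simp
      have "\<alpha> (ident (cell i (val (Suc t) i c)) (Suc t) c s0)"
        if i: "i < k" and c: "Suc t + 1 \<le> c" "c + Suc t \<le> 2 * T s0 + 1" for i c
      proof -
        let ?m = "snd (snd ?a ! i)"
        obtain c' where c': "shift ?m c' = c" "t + 1 \<le> c'" "c' + t \<le> 2 * T s0 + 1"
          using c that(1) by (cases ?m) (auto intro: that[of "c - 1"] that[of c] that[of "c + 1"])
        note step = val_step[OF Work i, of c']
        show ?thesis
        proof (cases "c' = cen")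
          case True
          have "and_rule (\<lambda>s t c. True) (\<lambda>s t c. ident (cell i (fst (snd ?a ! i))) (t + 1) (shift ?m (T s + 1)) s)
              (vSeen z ?l) vTrue \<in> rules"
            unfolding rules_def write_rules_def using z l i by (auto intro!: image_eqI[of _ _ "(z, ?l, i)"])
          from models_and_rule[OF mod this t(1) zero_less_P]
          have "\<alpha> (ident (cell i (fst (snd ?a ! i))) (t + 1) (shift ?m (T s0 + 1)) s0)"
            using seen \<alpha> by simp
          then show ?thesis using step True c' by simp
        next
          case False
          define v where "v = val t i c'"
          have mem: "and_rule (\<lambda>s t c. c \<noteq> T s + 1 \<and> 1 \<le> c \<and> c + 1 < P s)
             (\<lambda>s t c. ident (cell i v) (t + 1) (shift ?m c) s) (vSeen z ?l) (vCell i v) \<in> rules"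
            unfolding rules_def move_rules_def using z l i val_less[OF i, of t c']
            by (auto simp: v_def intro!: image_eqI[of _ _ "(z, ?l, i, val t i c')"])
          have less: "c' < P s0" "c' + 1 < P s0" "1 \<le> c'" using c' by (auto simp: P_def)
          from models_and_rule[OF mod mem t(1) less(1)]
          have "\<alpha> (ident (cell i v) (t + 1) (shift ?m c') s0)"
            using seen cells[OF i c'(2,3)] False less(2,3) by (simp add: v_def)
          then show ?thesis using step False c' by (simp add: v_def)
        qed
      qed
      then show ?thesis using st by simp
    next
      case Accept
      then show ?thesis using halted IH run_halted[of t] by simp
    next
      case Reject
      then show ?thesis using halted IH run_halted[of t] by simp
    qed
  qed
  have "state_code Q (st (T s0)) = Q"
  proof (rule ccontr)
    let ?z = "state_code Q (st (T s0))"
    assume ne: "?z \<noteq> Q"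
    have "?z \<le> Q + 1" using run_wf(3)[of "T s0"] by (cases "st (T s0)") (auto intro: less_imp_le le_SucI)
    then have "and_rule (\<lambda>s t c. t = T s) vFalse (vSeen ?z []) vTrue \<in> rules"
      unfolding rules_def final_rules_def using ne by (auto intro!: image_eqI[of _ _ ?z])
    from models_and_rule[OF mod this order_refl zero_less_P] show False
      using inv[of "T s0"] \<alpha> by simp
  qed
  then have "st (T s0) = Accept" using run_wf(3)[of "T s0"] by (cases "st (T s0)") auto
  then show ?thesis by (simp add: accepts_within_def)
qed

end

end

section \<open>Extracting a certificate from a model\<close>

context np_machine
begin

lemma sound:
  assumes mod: "models rules (x, [], env0) (T (x, [], env0)) (P (x, [], env0)) \<alpha>"
  shows "\<exists>u. length u \<le> poly p (length x) \<and> accepts_within M [x, u] (poly q (length x))"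
proof -
  let ?s = "(x, [] :: bool list, env0)"
  let ?cen = "T ?s + 1"
  define n where "n = poly p (length x)"
  define holds where "holds i a c = \<alpha> (ident (cell i a) 0 c ?s)" for i a c
  \<comment> \<open>The last column is \<open>2 * T + 2\<close>, so the table shows
    \<open>T + 2\<close> cells from the start of the certificate on; cells further right are out of
    reach within \<open>T\<close> steps.\<close>
  define K where "K = min n (T ?s + 2)"
  define len where "len = (LEAST j. K \<le> j \<or> holds 1 0 (?cen + j))"
  \<comment> \<open>Cells before the first one marked blank are marked 1 or 2; if both, symbol 2 is
    chosen, and if not 2, then 1 is known to hold.\<close>
  define u where "u = map (\<lambda>j. holds 1 2 (?cen + j)) [0..<len]"
  have \<alpha>: "\<alpha> 0" "\<not> \<alpha> 1" using mod by (auto simp: models_def)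
  have len: "K \<le> len \<or> holds 1 0 (?cen + len)" "len \<le> K"
    unfolding len_def by (rule LeastI[of _ K], simp, rule Least_le, simp)
  have before: "\<not> holds 1 0 (?cen + j)" if "j < len" for j
    using not_less_Least[of j "\<lambda>j. K \<le> j \<or> holds 1 0 (?cen + j)"] that unfolding len_def by blast
  have propagate: "holds 1 0 (?cen + j)" if "len \<le> j" "j < K" for j
    using that
  proof (induction j rule: dec_induct)
    case base
    then show ?case using len by auto
  next
    case (step j)
    have mem: "and_rule (\<lambda>s t c. t = 0 \<and> T s + 1 \<le> c \<and> c + 1 < P s)
        (\<lambda>s t c. ident (cell 1 0) t (c + 1) s) (vCell 1 0) vTrue \<in> rules"
      by (simp add: rules_def guess_rules_def)
    have less: "?cen + j < P ?s" "?cen + j + 1 < P ?s" using step by (auto simp: P_def K_def)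
    from models_and_rule[OF mod mem le0 less(1)] show ?case
      using step less(2) \<alpha> by (simp add: holds_def)
  qed
  have "\<alpha> (ident (cell i (val x u 0 i c)) 0 c ?s)" if i: "i < k" and c: "1 \<le> c" "c \<le> 2 * T ?s + 1" for i c
  proof -
    have cP: "c < P ?s" using c by (simp add: P_def)
    consider "i = 0" | "i = 1" | "2 \<le> i" by linarith
    then show ?thesis
    proof cases
      case 1
      have v: "val x u 0 i c = word_contents x (int c - int ?cen)" using val_0[OF i] 1 by simp
      consider "c < ?cen \<or> length x \<le> c - ?cen" | "?cen \<le> c" "c - ?cen < length x" "\<not> bit_at x (c - ?cen)"
        | "?cen \<le> c" "bit_at x (c - ?cen)"
        by (metis not_le)
      then show ?thesis
      proof cases
        case 1
        then have "val x u 0 i c = 0" unfolding v by (auto simp: word_contents_def)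
        moreover have mem: "and_rule (\<lambda>s t c. t = 0 \<and> (c < T s + 1 \<or> length (fst s) \<le> c - (T s + 1))) (vCell 0 0) vTrue vTrue \<in> rules"
          by (simp add: rules_def init_rules_def)
        moreover from models_and_rule[OF mod mem le0 cP] have "\<alpha> (ident (cell 0 0) 0 c ?s)" using 1 \<alpha> by simp
        ultimately show ?thesis using \<open>i = 0\<close> by simp
      next
        case 2
        then have "val x u 0 i c = 1" unfolding v by (auto simp: word_contents_def bit_at_def nat_diff_distrib' nat_add_distrib)
        moreover have mem: "and_rule (\<lambda>s t c. t = 0 \<and> T s + 1 \<le> c \<and> c - (T s + 1) < length (fst s) \<and> \<not> bit_at (fst s) (c - (T s + 1)))
            (vCell 0 1) vTrue vTrue \<in> rules"
          by (simp add: rules_def init_rules_def)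
        moreover from models_and_rule[OF mod mem le0 cP] have "\<alpha> (ident (cell 0 1) 0 c ?s)" using 2 \<alpha> by simp
        ultimately show ?thesis using \<open>i = 0\<close> by simp
      next
        case 3
        then have "val x u 0 i c = 2" unfolding v by (auto simp: word_contents_def bit_at_def nat_diff_distrib' nat_add_distrib)
        moreover have mem: "and_rule (\<lambda>s t c. t = 0 \<and> T s + 1 \<le> c \<and> bit_at (fst s) (c - (T s + 1))) (vCell 0 2) vTrue vTrue \<in> rules"
          by (simp add: rules_def init_rules_def)
        moreover from models_and_rule[OF mod mem le0 cP] have "\<alpha> (ident (cell 0 2) 0 c ?s)" using 3 \<alpha> by simp
        ultimately show ?thesis using \<open>i = 0\<close> by simp
      qed
    next
      case 2
      have v: "val x u 0 i c = word_contents u (int c - int ?cen)" using val_0[OF i] 2 by simp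
      have lenu: "length u = len" by (simp add: u_def)
      have len_n: "len \<le> n" using len(2) by (simp add: K_def)
      show ?thesis
      proof (cases "c < ?cen \<or> n \<le> c - ?cen")
        case True
        then have "val x u 0 i c = 0" unfolding v using lenu len_n by (auto simp: word_contents_def)
        moreover have mem: "and_rule (\<lambda>s t c. t = 0 \<and> (c < T s + 1 \<or> poly p (length (fst s)) \<le> c - (T s + 1))) (vCell 1 0) vTrue vTrue \<in> rules"
          by (simp add: rules_def guess_rules_def)
        moreover from models_and_rule[OF mod mem le0 cP] have "\<alpha> (ident (cell 1 0) 0 c ?s)"
          using True \<alpha> by (simp add: n_def)
        ultimately show ?thesis using \<open>i = 1\<close> by simp
      next
        case False
        define j where "j = c - ?cen"
        have j: "c = ?cen + j" "j < n" "j < K" using False c by (auto simp: j_def K_def)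
        show ?thesis
        proof (cases "j < len")
          case True
          have "val x u 0 i c = (if u ! j then 2 else 1)"
            unfolding v using j(1) True lenu by (simp add: word_contents_def)
          then have vj: "val x u 0 i c = (if holds 1 2 c then 2 else 1)" using True j(1) by (simp add: u_def)
          have mem1: "or_rule (\<lambda>s t c. t = 0 \<and> T s + 1 \<le> c \<and> c - (T s + 1) < poly p (length (fst s)))
              vTrue (vCell 1 0) (\<lambda>s t c. ident nonblank t c s) \<in> rules"
            by (simp add: rules_def guess_rules_def)
          have mem2: "or_rule (\<lambda>s t c. t = 0) (\<lambda>s t c. ident nonblank t c s) (vCell 1 1) (vCell 1 2) \<in> rules"
            by (simp add: rules_def guess_rules_def)
          from models_or_rule[OF mod mem1 le0 cP] have "\<alpha> (ident nonblank 0 c ?s)"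
            using j \<alpha> before[OF True] by (auto simp: n_def holds_def)
          with models_or_rule[OF mod mem2 le0 cP] have "holds 1 1 c \<or> holds 1 2 c" by (simp add: holds_def)
          then show ?thesis using vj \<open>i = 1\<close> by (auto simp: holds_def)
        next
          case False
          then have "val x u 0 i c = 0" unfolding v using lenu j(1) by (auto simp: word_contents_def)
          then show ?thesis using propagate[of j] False j \<open>i = 1\<close> by (simp add: holds_def)
        qed
      qed
    next
      case 3
      have "and_rule (\<lambda>s t c. t = 0) (vCell i 0) vTrue vTrue \<in> rules"
        unfolding rules_def init_rules_def using 3 i by auto
      from models_and_rule[OF mod this le0 cP] have "\<alpha> (ident (cell i 0) 0 c ?s)" using \<alpha> by simp
      moreover have "val x u 0 i c = 0" using val_0[OF i] 3 by (simp add: word_contents_Nil)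
      ultimately show ?thesis by simp
    qed
  qed
  then have "accepts_within M [x, u] (T ?s)" by (rule sound_run[OF mod])
  moreover have "length u \<le> poly p (length x)" using len(2) by (simp add: u_def K_def n_def)
  ultimately show ?thesis by (auto simp: T_def)
qed

end

lemma d_cut_NP_hard:
  assumes "d \<ge> 2" "L \<in> NP"
  defines "C \<equiv> \<lambda>G. claw_free G \<and> max_degree G = 2 * d + 3"
  shows "\<exists>f. polytime_computable f \<and> (\<forall>x. f x \<in> encode_graph ` d_Cut_inputs C \<and>
    (x \<in> L \<longleftrightarrow> f x \<in> encode_graph ` {G \<in> d_Cut_inputs C. \<exists>M. is_d_cut d G M}))"
proof -
  obtain M p q where M: "wf_tm M" "num_tapes M \<ge> 2" and L: "\<And>x. x \<in> L \<longleftrightarrow>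
      (\<exists>u. length u \<le> poly p (length x) \<and> accepts_within M [x, u] (poly q (length x)))"
    using assms(2) unfolding NP_def by blast
  interpret np_machine M p q using M by unfold_locales
  show ?thesis
    unfolding C_def
  proof (rule schema_reduction[OF assms(1) finite_rules rules_nonempty computable_rules PF_T PF_P])
    show "1 \<le> P s" for s by (simp add: P_def)
    show "x \<in> L \<longleftrightarrow> (\<exists>\<alpha>. models rules (x, [], env0) (T (x, [], env0)) (P (x, [], env0)) \<alpha>)" for x
      unfolding L using sound complete by blast
  qed
qed

section \<open>Membership in NP\<close>

text \<open>Every graph on an initial segment is a drawing of itself, which makes the colouring
  criterion \<open>d_cut_iff\<close> available for input graphs.\<close>

lemma draw_id:
  fixes G :: "nat ugraph"
  assumes "simple_graph G" "verts G = {..<n}"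
  shows "draw {..<n} (\<lambda>i j. {i, j} \<in> edges G) id = G" "drawing {..<n} (\<lambda>i j. {i, j} \<in> edges G) id"
proof -
  have "\<exists>i j. e = {i, j} \<and> i < n \<and> j < n" if "e \<in> edges G" for e
  proof -
    have "e \<subseteq> {..<n}" "card e = 2" using that assms unfolding simple_graph_def by auto
    then show ?thesis by (auto simp: card_2_iff)
  qed
  then have "{{i, j} | i j. i < n \<and> j < n \<and> {i, j} \<in> edges G} = edges G" by blast
  then show "draw {..<n} (\<lambda>i j. {i, j} \<in> edges G) id = G" using assms(2) by (simp add: draw_def)
  show "drawing {..<n} (\<lambda>i j. {i, j} \<in> edges G) id"
    using simple_edge[OF assms(1), of i i for i] by unfold_locales (auto simp: insert_commute)
qed

lemma sum_of_bool_card: "(\<Sum>j<n. of_bool (Q j)) = card {j \<in> {..<n}. Q j}" for n :: nat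
  by (simp add: Int_def)

lemma d_cut_colouring:
  fixes G :: "nat ugraph"
  assumes "simple_graph G" "verts G = {..<n}"
  shows "(\<exists>M. is_d_cut d G M) \<longleftrightarrow> (\<exists>col. (\<exists>i<n. col i) \<and> (\<exists>i<n. \<not> col i) \<and>
    (\<forall>i<n. (\<Sum>j<n. of_bool ({i, j} \<in> edges G \<and> col i \<noteq> col j)) \<le> d))"
proof -
  interpret drawing "{..<n}" "\<lambda>i j. {i, j} \<in> edges G" id using draw_id[OF assms] by simp
  have nb: "{j \<in> nbrs i. col j \<noteq> col i} = {j \<in> {..<n}. {i, j} \<in> edges G \<and> col i \<noteq> col j}" for i col
    by (auto simp: nbrs_def)
  have "balanced d col \<longleftrightarrow> (\<exists>i<n. col i) \<and> (\<exists>i<n. \<not> col i) \<and>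
    (\<forall>i<n. (\<Sum>j<n. of_bool ({i, j} \<in> edges G \<and> col i \<noteq> col j)) \<le> d)" for col
    unfolding balanced_def sum_of_bool_card nb by auto
  then show ?thesis using d_cut_iff[of d] draw_id[OF assms] by simp
qed

lemma max_degree_eq_iff:
  fixes G :: "nat ugraph"
  assumes "simple_graph G" "verts G = {..<n}" "0 < n"
  shows "max_degree G = k \<longleftrightarrow> (\<forall>i<n. (\<Sum>j<n. of_bool ({i, j} \<in> edges G)) \<le> k) \<and>
    (\<exists>i<n. (\<Sum>j<n. of_bool ({i, j} \<in> edges G)) = k)"
proof -
  have "neighbours G i = {j \<in> {..<n}. {i, j} \<in> edges G}" for i
    using neighbours_subset[OF assms(1)] assms(2) by (auto simp: neighbours_def)
  then have "max_degree G = Max ((\<lambda>i. \<Sum>j<n. of_bool ({i, j} \<in> edges G)) ` {..<n})"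
    unfolding max_degree_def assms(2) sum_of_bool_card by simp
  moreover have "Max (f ` {..<n}) = k \<longleftrightarrow> (\<forall>i<n. f i \<le> k) \<and> (\<exists>i<n. f i = k)" for f :: "nat \<Rightarrow> nat"
    using assms(3) by (subst Max_eq_iff) auto
  ultimately show ?thesis by (simp only:)
qed

text \<open>\<open>R t v\<close> claims a walk of length \<open>t\<close> from vertex 0 to
  \<open>v\<close>; every claim has to be backed by one at time \<open>t - 1\<close>, so false
  claims cannot arise. There are at most \<open>n * n\<close> ordered adjacent pairs, which bounds
  the walk lengths needed, and makes \<open>R\<close> a table that can be guessed.\<close>

lemma connected_iff_layers:
  fixes G :: "nat ugraph"
  assumes "simple_graph G" "verts G = {..<n}" "0 < n"
  shows "connected_graph G \<longleftrightarrow> (\<exists>R. (\<forall>v<n. \<exists>t<n * n + 1. R t v) \<and>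
    (\<forall>t<n * n + 1. \<forall>v<n. R t v \<longrightarrow> (if t = 0 then v = 0 else \<exists>w<n. R (t - 1) w \<and> {w, v} \<in> edges G)))"
    (is "_ \<longleftrightarrow> (\<exists>R. ?L R)")
proof
  let ?E = "{(x, y). {x, y} \<in> edges G}"
  assume conn: "connected_graph G"
  have sub: "?E \<subseteq> {..<n} \<times> {..<n}" using simple_edge[OF assms(1)] assms(2) by auto
  then have fin: "finite ?E" by (rule finite_subset) simp
  have card: "card ?E \<le> n * n" using card_mono[OF _ sub] by simp
  define R where "R t v \<longleftrightarrow> (0, v) \<in> ?E ^^ t" for t v
  have "\<exists>t<n * n + 1. R t v" if "v < n" for v
  proof -
    have "(0, v) \<in> ?E\<^sup>*" using conn that assms(2,3) unfolding connected_graph_def by simp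
    then obtain t where "t \<le> card ?E" "(0, v) \<in> ?E ^^ t"
      unfolding rtrancl_finite_eq_relpow[OF fin] by auto
    then show ?thesis using card unfolding R_def by (intro exI[of _ t]) auto
  qed
  moreover have "if t = 0 then v = 0 else \<exists>w<n. R (t - 1) w \<and> {w, v} \<in> edges G" if "R t v" for t v
  proof (cases t)
    case (Suc t')
    have "(0, v) \<in> ?E ^^ Suc t'" using that unfolding R_def Suc .
    then obtain w where "(0, w) \<in> ?E ^^ t'" "(w, v) \<in> ?E" by (rule relpow_Suc_E)
    then show ?thesis using Suc sub unfolding R_def by auto
  qed (use that in \<open>simp add: R_def\<close>)
  ultimately show "\<exists>R. ?L R" by blast
next
  let ?E = "{(x, y). {x, y} \<in> edges G}"
  assume "\<exists>R. ?L R"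
  then obtain R where R: "?L R" ..
  have "(0, v) \<in> ?E\<^sup>*" if "R t v" "t < n * n + 1" "v < n" for t v
    using that
  proof (induction t arbitrary: v)
    case 0
    then show ?case using R[THEN conjunct2, rule_format, of 0 v] by simp
  next
    case (Suc t)
    then obtain w where "w < n" "R t w" "{w, v} \<in> edges G"
      using R[THEN conjunct2, rule_format, of "Suc t" v] by auto
    then show ?case using Suc.IH[of w] Suc.prems by (auto intro: rtrancl_into_rtrancl)
  qed
  then have reach: "(0, v) \<in> ?E\<^sup>*" if "v < n" for v using R that by blast
  have "Relation.sym (?E\<^sup>*)" by (rule sym_rtrancl) (auto simp: Relation.sym_def insert_commute)
  then have "(u, v) \<in> ?E\<^sup>*" if "u < n" "v < n" for u v
    using reach[OF that(1)] reach[OF that(2)] by (meson rtrancl_trans symD)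
  then show "connected_graph G" using assms(2,3) unfolding connected_graph_def by auto
qed

definition edge_bit :: "nat \<Rightarrow> nat \<Rightarrow> nat \<Rightarrow> bool list \<Rightarrow> bool" where
  "edge_bit n i j x = bit_at x (n + 1 + (i * n + j))"

text \<open>The certificate starts with \<open>n\<close> colours; the table of layers follows row by
  row.\<close>

definition layer_bit :: "nat \<Rightarrow> nat \<Rightarrow> nat \<Rightarrow> bool list \<Rightarrow> bool" where
  "layer_bit n t v u = bit_at u (n + (t * n + v))"

definition graph_code :: "nat \<Rightarrow> bool list \<Rightarrow> bool" where
  "graph_code n x \<longleftrightarrow> length x = n + 1 + n * n \<and> 0 < n \<and> (\<forall>i<n. bit_at x i) \<and> \<not> bit_at x n \<and>
     (\<forall>i<n. \<not> edge_bit n i i x) \<and> (\<forall>i<n. \<forall>j<n. edge_bit n i j x \<longrightarrow> edge_bit n j i x)"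

definition claw_free_code :: "nat \<Rightarrow> bool list \<Rightarrow> bool" where
  "claw_free_code n x \<longleftrightarrow> (\<forall>v<n. \<forall>a<n. \<forall>b<n. \<forall>c<n. edge_bit n v a x \<longrightarrow> edge_bit n v b x \<longrightarrow> edge_bit n v c x \<longrightarrow>
     a \<noteq> b \<longrightarrow> a \<noteq> c \<longrightarrow> b \<noteq> c \<longrightarrow> edge_bit n a b x \<or> edge_bit n a c x \<or> edge_bit n b c x)"

definition degree_code :: "nat \<Rightarrow> nat \<Rightarrow> bool list \<Rightarrow> bool" where
  "degree_code k n x \<longleftrightarrow> (\<forall>i<n. (\<Sum>j<n. of_bool (edge_bit n i j x)) \<le> k) \<and>
     (\<exists>i<n. (\<Sum>j<n. of_bool (edge_bit n i j x)) = k)"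

definition cut_code :: "nat \<Rightarrow> nat \<Rightarrow> bool list \<Rightarrow> bool list \<Rightarrow> bool" where
  "cut_code d n x u \<longleftrightarrow> (\<exists>i<n. bit_at u i) \<and> (\<exists>i<n. \<not> bit_at u i) \<and>
     (\<forall>i<n. (\<Sum>j<n. of_bool (edge_bit n i j x \<and> bit_at u i \<noteq> bit_at u j)) \<le> d)"

definition layer_code :: "nat \<Rightarrow> bool list \<Rightarrow> bool list \<Rightarrow> bool" where
  "layer_code n x u \<longleftrightarrow> (\<forall>v<n. \<exists>t<n * n + 1. layer_bit n t v u) \<and>
     (\<forall>t<n * n + 1. \<forall>v<n. layer_bit n t v u \<longrightarrow> (if t = 0 then v = 0 else \<exists>w<n. layer_bit n (t - 1) w u \<and> edge_bit n w v x))"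

lemma PB_edge_bit: "PF N n \<Longrightarrow> PF N i \<Longrightarrow> PF N j \<Longrightarrow> PB N (\<lambda>s. edge_bit (n s) (i s) (j s) (fst s))"
  unfolding edge_bit_def by (intro PF_PB_intros PB_bit)

lemma PB_layer_bit: "PF N n \<Longrightarrow> PF N i \<Longrightarrow> PF N j \<Longrightarrow> PB N (\<lambda>s. layer_bit (n s) (i s) (j s) (fst (snd s)))"
  unfolding layer_bit_def by (intro PF_PB_intros PB_bit_cert)

lemma PB_codes:
  assumes "PF N n"
  shows "PB N (\<lambda>s. graph_code (n s) (fst s))" "PB N (\<lambda>s. claw_free_code (n s) (fst s))"
    "PB N (\<lambda>s. degree_code k (n s) (fst s))" "PB N (\<lambda>s. cut_code d (n s) (fst s) (fst (snd s)))"
    "PB N (\<lambda>s. layer_code (n s) (fst s) (fst (snd s)))"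
  unfolding graph_code_def claw_free_code_def degree_code_def cut_code_def layer_code_def
  by ((intro PF_PB_intros PF_sum PB_edge_bit PB_layer_bit PB_bit PB_bit_cert PF_len assms | assumption |
      (erule PF_weaken, linarith) | (rule PF_weaken[OF assms], linarith))+)

lemma graph_code_codes:
  fixes G :: "nat ugraph"
  assumes G: "simple_graph G" "verts G = {..<n}"
    and e: "\<forall>i<n. \<forall>j<n. edge_bit n i j x \<longleftrightarrow> {i, j} \<in> edges G"
  shows "claw_free_code n x \<longleftrightarrow> claw_free G"
    and "0 < n \<Longrightarrow> degree_code k n x \<longleftrightarrow> max_degree G = k"
    and "cut_code d n x u \<longleftrightarrow> (\<exists>i<n. bit_at u i) \<and> (\<exists>i<n. \<not> bit_at u i) \<and>
      (\<forall>i<n. (\<Sum>j<n. of_bool ({i, j} \<in> edges G \<and> bit_at u i \<noteq> bit_at u j)) \<le> d)"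
    and "layer_code n x u \<longleftrightarrow> (\<forall>v<n. \<exists>t<n * n + 1. layer_bit n t v u) \<and>
      (\<forall>t<n * n + 1. \<forall>v<n. layer_bit n t v u \<longrightarrow> (if t = 0 then v = 0 else \<exists>w<n. layer_bit n (t - 1) w u \<and> {w, v} \<in> edges G))"
proof -
  have lt: "i < n \<and> j < n" if "{i, j} \<in> edges G" for i j
    using simple_edge[OF G(1) that] G(2) by auto
  show "claw_free_code n x \<longleftrightarrow> claw_free G"
    unfolding claw_free_code_def claw_free_iff[OF G(1)] using lt by (simp add: e) blast
  show "0 < n \<Longrightarrow> degree_code k n x \<longleftrightarrow> max_degree G = k"
  proof -
    have "(\<Sum>j<n. of_bool (edge_bit n i j x)) = (\<Sum>j<n. of_bool ({i, j} \<in> edges G) :: nat)" if "i < n" for i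
      using that by (intro sum.cong) (auto simp: e)
    then show "0 < n \<Longrightarrow> degree_code k n x \<longleftrightarrow> max_degree G = k"
      unfolding degree_code_def by (subst max_degree_eq_iff[OF G]) (auto simp del: sum_of_bool_eq)
  qed
  show "cut_code d n x u \<longleftrightarrow> (\<exists>i<n. bit_at u i) \<and> (\<exists>i<n. \<not> bit_at u i) \<and>
      (\<forall>i<n. (\<Sum>j<n. of_bool ({i, j} \<in> edges G \<and> bit_at u i \<noteq> bit_at u j)) \<le> d)"
    unfolding cut_code_def by (simp add: e)
  show "layer_code n x u \<longleftrightarrow> (\<forall>v<n. \<exists>t<n * n + 1. layer_bit n t v u) \<and>
      (\<forall>t<n * n + 1. \<forall>v<n. layer_bit n t v u \<longrightarrow> (if t = 0 then v = 0 else \<exists>w<n. layer_bit n (t - 1) w u \<and> {w, v} \<in> edges G))"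
    unfolding layer_code_def by (simp add: e cong: conj_cong imp_cong if_cong)
qed

text \<open>A word of the right length and prefix is the code of a simple graph exactly if its
  matrix is symmetric with an empty diagonal.\<close>

lemma graph_code_iff:
  "graph_code n x \<longleftrightarrow> (\<exists>G. simple_graph G \<and> verts G = {..<n} \<and> 0 < n \<and> x = encode_graph G \<and>
     (\<forall>i<n. \<forall>j<n. edge_bit n i j x \<longleftrightarrow> {i, j} \<in> edges G))"
proof
  assume code: "graph_code n x"
  then have len: "length x = n + 1 + n * n" and n: "0 < n" and pre: "\<And>i. i < n \<Longrightarrow> bit_at x i" "\<not> bit_at x n"
    and irr: "\<And>i. i < n \<Longrightarrow> \<not> edge_bit n i i x"
    and sym: "\<And>i j. i < n \<Longrightarrow> j < n \<Longrightarrow> edge_bit n i j x \<Longrightarrow> edge_bit n j i x"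
    unfolding graph_code_def by blast+
  define G where "G = \<lparr>verts = {..<n}, edges = {{i, j} | i j. i < n \<and> j < n \<and> edge_bit n i j x}\<rparr>"
  have vG: "verts G = {..<n}" by (simp add: G_def)
  have edge: "edge_bit n i j x \<longleftrightarrow> {i, j} \<in> edges G" if "i < n" "j < n" for i j
    using that sym by (auto simp: G_def doubleton_eq_iff)
  have "card {i, j} = 2" if "i < n" "edge_bit n i j x" for i j
    using that irr by (cases "i = j") auto
  then have simple: "simple_graph G" by (auto simp: simple_graph_def G_def)
  have "x = encode_graph G"
  proof (rule nth_equalityI)
    show "length x = length (encode_graph G)" using len vG by (simp add: length_encode_graph)
    fix k assume "k < length x"
    then have k: "k < n + 1 + n * n" using len by simp
    have "encode_graph G ! k = (k < n \<or> n < k \<and> {(k - n - 1) div n, (k - n - 1) mod n} \<in> edges G)"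
      unfolding encode_graph_alt[OF vG] using k by (simp del: upt_Suc)
    also have "\<dots> = x ! k"
    proof -
      consider "k < n" | "k = n" | "n < k" by linarith
      then show ?thesis
      proof cases
        case 3
        let ?l = "k - n - 1"
        have "?l < n * n" using 3 k by simp
        then have "?l div n < n" "?l mod n < n" using n by (auto simp: less_mult_imp_div_less)
        moreover have "n + 1 + (?l div n * n + ?l mod n) = k" using 3 by simp
        then have "edge_bit n (?l div n) (?l mod n) x = x ! k" using k len by (simp add: edge_bit_def bit_at_def)
        ultimately show ?thesis using edge 3 by simp
      qed (use pre len k in \<open>auto simp: bit_at_def\<close>)
    qed
    finally show "x ! k = encode_graph G ! k" by simp
  qed
  then show "\<exists>G. simple_graph G \<and> verts G = {..<n} \<and> 0 < n \<and> x = encode_graph G \<and>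
     (\<forall>i<n. \<forall>j<n. edge_bit n i j x \<longleftrightarrow> {i, j} \<in> edges G)"
    using simple vG n edge by blast
next
  assume "\<exists>G. simple_graph G \<and> verts G = {..<n} \<and> 0 < n \<and> x = encode_graph G \<and>
     (\<forall>i<n. \<forall>j<n. edge_bit n i j x \<longleftrightarrow> {i, j} \<in> edges G)"
  then obtain G where G: "simple_graph G" "verts G = {..<n}" "0 < n" "x = encode_graph G"
    and e: "\<And>i j. i < n \<Longrightarrow> j < n \<Longrightarrow> edge_bit n i j x \<longleftrightarrow> {i, j} \<in> edges G"
    by blast
  have len: "length x = n + 1 + n * n" using G by (simp add: length_encode_graph)
  have "bit_at x i" if "i < n" for i
    using that unfolding bit_at_def len unfolding G(4) encode_graph_alt[OF G(2)] by (simp del: upt_Suc)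
  moreover have "\<not> bit_at x n"
    unfolding bit_at_def len unfolding G(4) encode_graph_alt[OF G(2)] by (simp del: upt_Suc)
  moreover have "{i} \<notin> edges G" for i using simple_edge[OF G(1), of i i] by auto
  ultimately show "graph_code n x"
    unfolding graph_code_def using len G(3) e by (auto simp: insert_commute)
qed

lemma edge_bit_encode_graph:
  assumes "verts G = {..<n}" "i < n" "j < n"
  shows "edge_bit n i j (encode_graph G) \<longleftrightarrow> {i, j} \<in> edges G"
  using encode_graph_edge[OF assms] assms(1) by (simp add: edge_bit_def bit_at_def length_encode_graph)

text \<open>The number \<open>n\<close> of vertices is searched for below the length of
  \<open>x\<close> instead of being parsed. A certificate has \<open>n + (n * n + 1) * n\<close>
  bits, which is at most the square of the input length \<open>n + 1 + n * n\<close>.\<close>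

lemma d_cut_in_NP:
  fixes d :: nat
  defines "C \<equiv> \<lambda>G. claw_free G \<and> max_degree G = 2 * d + 3"
  shows "encode_graph ` {G \<in> d_Cut_inputs C. \<exists>M. is_d_cut d G M} \<in> NP"
proof (rule NP_I[where q = "[:0, 0, 1:]" and P = "\<lambda>s. \<exists>n<length (fst s). graph_code n (fst s) \<and>
    claw_free_code n (fst s) \<and> degree_code (2 * d + 3) n (fst s) \<and> cut_code d n (fst s) (fst (snd s)) \<and>
    layer_code n (fst s) (fst (snd s))"])
  show "PB 0 (\<lambda>s. \<exists>n<length (fst s). graph_code n (fst s) \<and>
    claw_free_code n (fst s) \<and> degree_code (2 * d + 3) n (fst s) \<and> cut_code d n (fst s) (fst (snd s)) \<and>
    layer_code n (fst s) (fst (snd s)))"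
    by (intro PB_ex PF_len PB_conj PB_codes)
  fix x
  show "x \<in> encode_graph ` {G \<in> d_Cut_inputs C. \<exists>M. is_d_cut d G M} \<longleftrightarrow>
    (\<exists>u. length u \<le> poly [:0, 0, 1:] (length x) \<and> (\<exists>n<length (fst (x, u, env0)). graph_code n (fst (x, u, env0)) \<and>
    claw_free_code n (fst (x, u, env0)) \<and> degree_code (2 * d + 3) n (fst (x, u, env0)) \<and>
    cut_code d n (fst (x, u, env0)) (fst (snd (x, u, env0))) \<and>
    layer_code n (fst (x, u, env0)) (fst (snd (x, u, env0)))))" (is "?L \<longleftrightarrow> ?R")
  proof
    assume ?L
    then obtain G n where G: "simple_graph G" "verts G = {..<n}" "connected_graph G" "claw_free G"
      "max_degree G = 2 * d + 3" "\<exists>M. is_d_cut d G M" and x: "x = encode_graph G"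
      unfolding d_Cut_inputs_def C_def by blast
    have n: "0 < n" using G(2,3) unfolding connected_graph_def by (cases n) auto
    have e: "\<forall>i<n. \<forall>j<n. edge_bit n i j x \<longleftrightarrow> {i, j} \<in> edges G"
      unfolding x using edge_bit_encode_graph[OF G(2)] by blast
    obtain col where col: "\<exists>i<n. col i" "\<exists>i<n. \<not> col i"
      "\<forall>i<n. (\<Sum>j<n. of_bool ({i, j} \<in> edges G \<and> col i \<noteq> col j)) \<le> d"
      using G(6) unfolding d_cut_colouring[OF G(1,2)] by blast
    obtain R where R: "\<forall>v<n. \<exists>t<n * n + 1. R t v"
      "\<forall>t<n * n + 1. \<forall>v<n. R t v \<longrightarrow> (if t = 0 then v = 0 else \<exists>w<n. R (t - 1) w \<and> {w, v} \<in> edges G)"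
      using G(3) unfolding connected_iff_layers[OF G(1,2) n] by blast
    define u where "u = map (\<lambda>k. if k < n then col k else R ((k - n) div n) ((k - n) mod n)) [0..<n + (n * n + 1) * n]"
    have "bit_at u i \<longleftrightarrow> col i" if "i < n" for i
      using that by (simp add: u_def bit_at_def)
    then have "cut_code d n x u" using graph_code_codes(3)[OF G(1,2) e] col by (simp del: sum_of_bool_eq) blast
    moreover have R_bit: "layer_bit n t v u \<longleftrightarrow> R t v" if "t < n * n + 1" "v < n" for t v
    proof -
      have "t * n + v < Suc t * n" using that(2) by simp
      also have "\<dots> \<le> (n * n + 1) * n" using that(1) by (intro mult_right_mono) auto
      finally have "n + (t * n + v) < n + (n * n + 1) * n" by simp
      moreover have "(t * n + v) div n = t" "(t * n + v) mod n = v" using that(2) by auto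
      ultimately show ?thesis by (simp add: layer_bit_def bit_at_def u_def del: upt_Suc mult_Suc)
    qed
    have "layer_code n x u"
      unfolding graph_code_codes(4)[OF G(1,2) e]
    proof (intro conjI allI impI)
      show "\<exists>t<n * n + 1. layer_bit n t v u" if "v < n" for v using R(1) R_bit that by blast
      fix t v assume t: "t < n * n + 1" "v < n" "layer_bit n t v u"
      have "if t = 0 then v = 0 else \<exists>w<n. R (t - 1) w \<and> {w, v} \<in> edges G" using R(2) R_bit t by blast
      moreover have "R (t - 1) w \<longleftrightarrow> layer_bit n (t - 1) w u" if "w < n" for w using R_bit[of "t - 1" w] t(1) that by simp
      ultimately show "if t = 0 then v = 0 else \<exists>w<n. layer_bit n (t - 1) w u \<and> {w, v} \<in> edges G"
        by (cases "t = 0") (simp, metis)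
    qed
    moreover have "graph_code n x" unfolding graph_code_iff using G(1,2) n x e by blast
    moreover have "claw_free_code n x" "degree_code (2 * d + 3) n x"
      using graph_code_codes(1,2)[OF G(1,2) e] n G by auto
    moreover have len: "length x = n + 1 + n * n" using x G(2) by (simp add: length_encode_graph)
    moreover have "length u \<le> poly [:0, 0, 1:] (length x)"
    proof -
      have "n + (n * n + 1) * n \<le> (n + 1 + n * n) * (n + 1 + n * n)" by (simp add: algebra_simps)
      then show ?thesis unfolding len by (simp add: u_def)
    qed
    ultimately show ?R by (intro exI[of _ u] conjI exI[of _ n]) auto
  next
    assume ?R
    then obtain u n where code: "graph_code n x" "claw_free_code n x" "degree_code (2 * d + 3) n x" "cut_code d n x u"
      "layer_code n x u" by auto
    obtain G where G: "simple_graph G" "verts G = {..<n}" "0 < n" "x = encode_graph G"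
      and e: "\<forall>i<n. \<forall>j<n. edge_bit n i j x \<longleftrightarrow> {i, j} \<in> edges G"
      using code(1) unfolding graph_code_iff by blast
    note codes = graph_code_codes[OF G(1,2) e]
    have "claw_free G" "max_degree G = 2 * d + 3" using code(2,3) codes(1,2) G(3) by auto
    moreover have "connected_graph G"
      unfolding connected_iff_layers[OF G(1-3)] using code(5) unfolding codes(4) by (rule exI[of _ "\<lambda>t v. layer_bit n t v u"])
    moreover have "\<exists>M. is_d_cut d G M"
      unfolding d_cut_colouring[OF G(1,2)] using code(4) unfolding codes(3) by (rule exI[of _ "bit_at u"])
    ultimately show ?L using G unfolding d_Cut_inputs_def C_def by blast
  qed
qed

theorem theorem1p4:
  fixes d :: nat
  assumes "d \<ge> 2"
  shows "constant_time_solvable (d_Cut d (\<lambda>G. claw_free G \<and> max_degree G \<le> 2 * d + 1)) \<and>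
         NP_complete (d_Cut d (\<lambda>G. claw_free G \<and> max_degree G = 2 * d + 3))"
  using constant_time_small_degree d_cut_in_NP d_cut_NP_hard[OF assms]
  unfolding NP_complete_def d_Cut_def by auto

end
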